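(* Let $X_1,X_2,\dots$ be i.i.d. real-valued random variables with common distribution function $F$, and for each $n\ge 1$ let $X_{1:n}\le\dots\le X_{n:n}$ be the order statistics of $X_1,\dots,X_n$. Let $k_n,m_n$ be integers with $0\le k_n<n-m_n\le n$, put $\alpha_n=k_n/n$, $\beta_n=m_n/n$, and assume $\alpha_n\to\alpha$, $\beta_n\to\beta$ with $0<\alpha<1-\beta<1$. For real weights $c_{i,n}$ define the trimmed $L$-statistic $$L_n=n^{-1}\sum_{i=k_n+1}^{n-m_n}c_{i,n}X_{i:n}.$$ Suppose: (ii) there exists $\varepsilon>0$ such that for each $t\in\mathbb{R}$, as $n\to\infty$, $$F^{-1}\bigl(\alpha+t\sqrt{\log n/n}\bigr)-F^{-1}(\alpha)=O\bigl((\log n)^{-(1+\varepsilon)}\bigr),\qquad F^{-1}\bigl(1-\beta+t\sqrt{\log n/n}\bigr)-F^{-1}(1-\beta)=O\bigl((\log n)^{-(1+\varepsilon)}\bigr);$$ (iii) $\max(|\alpha_n-\alpha|,|\beta_n-\beta|)=O\bigl(\sqrt{\log n/n}\bigr)$ as $n\to\infty$; and assume there is a function $J$, defined on an open set $I$ with $[\alpha,1-\beta]\subset I\subseteq(0,1)$, such that (i) $J$ is Lipschitz on $I$: there is $C\ge0$ with $|J(u)-J(v)|\le C|u-v|$ for all $u,v\in I$; (iv) with $c^0_{i,n}=n\int_{(i-1)/n}^{i/n}J(u)\,du$, there is $\tilde\varepsilon>0$ such that $$\sum_{i=k_n+1}^{n-m_n}|c_{i,n}-c^0_{i,n}|=O\Bigl(\frac{1}{(\log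 n)^{\tilde\varepsilon}}\sqrt{\frac{n}{\log n}}\Bigr)\quad (n\to\infty).$$ Let $\mu_n=\int_{\alpha_n}^{1-\beta_n}J(u)F^{-1}(u)\,du$, let $$\sigma^2=\int_\alpha^{1-\beta}\int_\alpha^{1-\beta}J(u)J(v)(u\wedge v-uv)\,dF^{-1}(u)\,dF^{-1}(v),$$ assumed to satisfy $\sigma>0$, and let $F_{L_n}(x)=\mathbf{P}\{\sqrt n(L_n-\mu_n)/\sigma\le x\}$. Then for each $c>0$ and $A>0$, $$1-F_{L_n}(x)=[1-\Phi(x)](1+o(1)),\qquad F_{L_n}(-x)=\Phi(-x)(1+o(1))$$ as $n\to\infty$, uniformly in the range $-A\le x\le c\sqrt{\log n}$, where $\Phi$ is the standard normal distribution function.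
   Context: $F^{-1}$ denotes the left-continuous inverse $F^{-1}(u)=\inf\{x:F(x)\ge u\}$ for $0<u\le1$, with $F^{-1}(0)=F^{-1}(0^+)$. Integrals with respect to the left-continuous integrator $F^{-1}$ are taken over half-open intervals: $\int_a^b=\int_{[a,b)}$. $u\wedge v=\min(u,v)$. The quantities $\mu_n$ are well defined for all sufficiently large $n$ since $\alpha_n\to\alpha$, $\beta_n\to\beta$. *)

theory Defs
  imports "HOL-Probability.Probability" "HOL-Library.Landau_Symbols"
begin

definition order_stat :: "(nat \<Rightarrow> real) \<Rightarrow> nat \<Rightarrow> nat \<Rightarrow> real" where
  "order_stat x n i = sort (map x [0..<n]) ! (i - 1)"

definition quantile :: "(real \<Rightarrow> real) \<Rightarrow> real \<Rightarrow> real" where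
  "quantile F u = (if 0 < u then Inf {x. u \<le> F x}
                   else Lim (at_right 0) (\<lambda>v. Inf {x. v \<le> F x}))"

text \<open>Lebesgue-Stieltjes measure of a nondecreasing left-continuous function Q,
  restricted to [a,b): the measure of [x,y) is Q y - Q x for a <= x <= y <= b.
  (Built from the right-continuous function t |-> - Q(clamp(-t)) and reflection.)\<close>
definition lstieltjes :: "(real \<Rightarrow> real) \<Rightarrow> real \<Rightarrow> real \<Rightarrow> real measure" where
  "lstieltjes Q a b = distr (interval_measure (\<lambda>t. - Q (max a (min b (- t))))) borel uminus"

definition Phi :: "real \<Rightarrow> real" where
  "Phi x = measure (density lborel std_normal_density) {..x}"

end

theory Submission
  imports Defs "HOL-Real_Asymp.Real_Asymp"
begin

text \<open>
  Write $Q = F^{-1}$, let $K$ be a primitive of $J$ and $F_n$ the empirical distribution function.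
  With the weights $c^0_{i,n}$ the statistic minus $\mu_n$ equals
  $-\int (K(F_n^*) - K(F^*))\,dx$, where the star clamps to $[\alpha_n, 1-\beta_n]$. Linearizing $K$ at $F$
  gives the mean of the bounded i.i.d. variables
  $h(X_i) = -\int_{\alpha \le F < 1-\beta} J(F(x)) (1\{X_i \le x\} - F(x))\,dx$. These have
  variance $\sigma^2$, because $dQ$ is the image of Lebesgue measure under $F$. On the event
  $\sup |F_n - F| \le r_n$ with $r_n$ of order $\sqrt{\log n/n}$, which by Hoeffding's inequality
  fails with probability at most $n^{-p}$ for any prescribed $p$, the linearization error is
  $O(r_n^2)$, except where $F$ is within $O(r_n)$ of $\alpha$ or $1-\beta$. There it is $O(r_n)$ on a set
  of length $O((\log n)^{-1-\varepsilon})$ by (ii).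

  For the i.i.d. sum, Lindeberg's replacement is applied to a cubic spline that smooths the
  indicator of $(x, \infty)$ at scale $1/\log n$. Its Taylor remainder vanishes while the argument
  stays to the left of $x$, hence carries a factor $e^{\lambda(s-x)}$ with $\lambda = \max(x, 0)$, and the exponential moment of the
  partial sums turns it into a relative error $O(n^{-1/2} (\log n)^4)$. No change of measure is needed.
\<close>

section \<open>Lindeberg replacement with exponential weights\<close>

text \<open>At \<open>x\<close> of order sqrt(log n) the tail is only a power of \<open>1/n\<close>,
  about \<open>n^(-c^2/2)\<close>, and the error must be small relative to it. An unweighted bound
  of Lindeberg or Berry-Esseen type has absolute error of order \<open>n^(-1/2)\<close>, which says
  nothing once \<open>c >= 1\<close>. Weighting the Taylor remainder by an exponential with
  parameter \<open>l = x\<close> produces the factor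
  \<open>exp (l^2/2 - l*x) = exp (-x^2/2)\<close>, the size of the tail up to a factor
  \<open>1 + x\<close>.

  Moving \<open>x\<close> by \<open>t\<close> multiplies the tail by roughly
  \<open>exp (x*t)\<close>, so every perturbation of the normalized statistic has to be o(1/sqrt(log
  n)). This is what the exponents in (ii) and (iv) provide: after multiplication by sqrt n, the
  boundary zones contribute (log n)^(-1/2-\<epsilon>) and the change of weights contributes a
  similar power with the exponent from (iv). The smoothing scale 1/log n is admissible for the same
  reason, and costs only (log n)^3 through the third derivative.

  No moment of \<open>F\<close> is involved: the quantile function is bounded on compact
  subintervals of (0,1), so the linear term is bounded whatever the tails of
  \<open>F\<close>.\<close>

lemma pos_cube_taylor:
  fixes s h :: real
  shows "\<bar>max 0 (s + h) ^ 3 - max 0 s ^ 3 - 3 * (max 0 s)\<^sup>2 * h - 3 * max 0 s * h\<^sup>2\<bar>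
    \<le> (if s + \<bar>h\<bar> \<le> 0 then 0 else \<bar>h\<bar> ^ 3)"
proof -
  have e: "(s + h)^3 = s^3 + 3 * s\<^sup>2 * h + 3 * s * h\<^sup>2 + h^3"
    by (simp add: power2_eq_square power3_eq_cube algebra_simps)
  \<comment> \<open>If \<open>s + \<bar>h\<bar> \<le> 0\<close>, both points lie on the flat side
    and the remainder is exactly zero, not merely cubic; this is what later permits an exponential
    weight. If zero separates the two points, \<open>s + h\<close> is at distance at most
    \<open>\<bar>h\<bar>\<close> from zero.\<close>
  consider "s \<ge> 0" "s + h \<ge> 0" | "s \<ge> 0" "s + h < 0" | "s < 0" "s + h \<ge> 0" | "s < 0" "s + h < 0"
    by linarith
  then show ?thesis
  proof cases
    case 1
    have "\<bar>h ^ 3\<bar> = \<bar>h\<bar> ^ 3" by (simp add: power_abs)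
    then show ?thesis using 1 e by auto
  next
    case 2
    have "(-(s+h))^3 \<le> (-h)^3" using 2 by (intro power_mono) auto
    moreover have "0 \<le> (-(s+h))^3" using 2 by (intro zero_le_power) auto
    moreover have "(-(s+h))^3 = - ((s+h)^3)" "(-h)^3 = - (h^3)" by (rule power_minus_odd, simp)+
    moreover have "\<bar>h\<bar>^3 = - (h^3)" using 2 by (simp add: power3_eq_cube)
    ultimately have "\<bar>h^3 - (s+h)^3\<bar> \<le> \<bar>h\<bar>^3" by linarith
    moreover have "max 0 (s + h) ^ 3 - max 0 s ^ 3 - 3 * (max 0 s)\<^sup>2 * h - 3 * max 0 s * h\<^sup>2 = h^3 - (s+h)^3"
      unfolding e using 2 by simp
    ultimately show ?thesis using 2 by auto
  next
    case 3
    have "(s+h)^3 \<le> h^3" "0 \<le> (s+h)^3" using 3 by (auto intro!: power_mono)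
    then show ?thesis using 3 by auto
  next
    case 4
    then show ?thesis by auto
  qed
qed

text \<open>This is the distribution function of the sum of three independent uniform variables on
  [0,1], hence twice continuously differentiable and rising from 0 at 0 to 1 at 3. Truncated powers
  are used so that \<open>pos_cube_taylor\<close> applies to each knot separately.\<close>

definition spline :: "real \<Rightarrow> real" where
  "spline z = (max 0 z ^ 3 - 3 * max 0 (z - 1) ^ 3 + 3 * max 0 (z - 2) ^ 3 - max 0 (z - 3) ^ 3) / 6"

lemma spline_eq_0: "z \<le> 0 \<Longrightarrow> spline z = 0"
  by (simp add: spline_def max_def)

lemma spline_eq_1: "z \<ge> 3 \<Longrightarrow> spline z = 1"
  by (simp add: spline_def max_def power3_eq_cube algebra_simps)

lemma spline_bounds: "0 \<le> spline z" "spline z \<le> 1"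
proof -
  consider "z \<le> 0" | "0 \<le> z" "z \<le> 1" | "1 \<le> z" "z \<le> 2" | "2 \<le> z" "z \<le> 3" | "3 \<le> z" by linarith
  then have "0 \<le> spline z \<and> spline z \<le> 1"
  proof cases
    case 1 then show ?thesis by (simp add: spline_eq_0)
  next
    case 2
    have "z^3 \<le> 1" using 2 by (simp add: power_le_one)
    then show ?thesis using 2 by (simp add: spline_def)
  next
    case 3
    define w where "w = z - 1"
    have w: "0 \<le> w" "w \<le> 1" using 3 by (auto simp: w_def)
    have "spline z = ((w+1)^3 - 3 * w^3) / 6" using 3 by (simp add: spline_def w_def)
    also have "\<dots> = (1 + 3*w + 3*w*w - 2*w*w*w)/6"
      by (simp add: power3_eq_cube algebra_simps)
    finally have e: "spline z = (1 + 3*w + 3*w*w - 2*w*w*w)/6" .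
    have a: "w*w \<le> w" "0 \<le> w*w" using w by (auto simp: mult_left_le)
    have b: "w*w*w \<le> w*w" "0 \<le> w*w*w" using w by (auto simp: mult_left_le)
    have "3*w*w - 2*w*w*w = 3*(w*w) - 2*(w*w*w)" by simp
    \<comment> \<open>This is \<open>w * (1 - w)^2 \<ge> 0\<close>, the cubic information that
      brings the upper bound down to 6.\<close>
    have c: "2 * (w*w) - w \<le> w*w*w"
      using mult_nonneg_nonneg[OF w(1) zero_le_power2[of "1 - w"]]
      by (simp add: power2_eq_square algebra_simps)
    have d: "1 + 3*w + 3*w*w - 2*w*w*w = 1 + 3 * w + 3*(w*w) - 2*(w*w*w)" by simp
    have "0 \<le> 1 + 3*w + 3*w*w - 2*w*w*w" "1 + 3*w + 3*w*w - 2*w*w*w \<le> 6"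
      unfolding d using a b c w by linarith+
    then show ?thesis unfolding e by simp
  next
    case 4
    define w where "w = 3 - z"
    have w: "0 \<le> w" "w \<le> 1" using 4 by (auto simp: w_def)
    have "spline z = ((3-w)^3 - 3 * (2-w)^3 + 3*(1-w)^3) / 6" using 4 by (simp add: spline_def w_def)
    also have "\<dots> = 1 - w^3/6"
      by (simp add: power3_eq_cube field_simps)
    finally have e: "spline z = 1 - w^3/6" .
    have "w^3 \<le> 1" "0 \<le> w^3" using w by (auto simp: power_le_one)
    then show ?thesis unfolding e by simp
  next
    case 5 then show ?thesis by (simp add: spline_eq_1)
  qed
  then show "0 \<le> spline z" "spline z \<le> 1" by auto
qed

lemma borel_measurable_spline [measurable]: "spline \<in> borel_measurable borel"
  unfolding spline_def by measurable

text \<open>The remainder at a knot vanishes unless \<open>s + \<bar>h\<bar>\<close> is positive,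
  and there the factor \<open>exp (l * (s + \<bar>h\<bar>))\<close> is at least 1, so the weight can
  be inserted for free with any \<open>l \<ge> 0\<close>. The constant is (1 + 3 + 3 + 1)/6. The
  coefficients may depend on \<open>s\<close> only, which is all that moment matching
  requires.\<close>

lemma spline_taylor:
  assumes l: "l \<ge> 0"
  shows "\<exists>p q. \<forall>h. \<bar>spline (s + h) - spline s - p * h - q * h\<^sup>2\<bar> \<le> 4/3 * \<bar>h\<bar>^3 * exp (l * (s + \<bar>h\<bar>))"
proof -
  define R where "R j h = max 0 (s - j + h) ^ 3 - max 0 (s - j) ^ 3 - 3 * (max 0 (s-j))\<^sup>2 * h - 3 * max 0 (s-j) * h\<^sup>2" for j h
  have R: "\<bar>R j h\<bar> \<le> \<bar>h\<bar>^3 * exp (l * (s + \<bar>h\<bar>))" if "j \<ge> 0" for j h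
  proof -
    have "\<bar>R j h\<bar> \<le> (if s - j + \<bar>h\<bar> \<le> 0 then 0 else \<bar>h\<bar> ^ 3)"
      unfolding R_def by (rule pos_cube_taylor)
    also have "\<dots> \<le> \<bar>h\<bar>^3 * exp (l * (s + \<bar>h\<bar>))"
    proof (cases "s - j + \<bar>h\<bar> \<le> 0")
      case False
      then have "s + \<bar>h\<bar> \<ge> 0" using that by linarith
      then have "1 \<le> exp (l * (s + \<bar>h\<bar>))" using l by simp
      then show ?thesis using False by (simp add: mult_left_le mult_le_cancel_left1)
    qed auto
    finally show ?thesis .
  qed
  \<comment> \<open>\<open>p\<close> is the first derivative of the spline at \<open>s\<close>, and
    \<open>q\<close> is half the second.\<close>
  define p where "p = (3 * (max 0 s)\<^sup>2 - 9 * (max 0 (s-1))\<^sup>2 + 9 * (max 0 (s-2))\<^sup>2 - 3 * (max 0 (s-3))\<^sup>2)/6"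
  define q where "q = (3 * (max 0 s) - 9 * (max 0 (s-1)) + 9 * (max 0 (s-2)) - 3 * (max 0 (s-3)))/6"
  show ?thesis
  proof (rule exI[of _ p], rule exI[of _ q], rule allI)
    fix h
    have e: "spline (s + h) - spline s - p * h - q * h\<^sup>2 = (R 0 h - 3 * R 1 h + 3 * R 2 h - R 3 h) / 6"
      unfolding spline_def p_def q_def R_def by (simp add: field_simps)
    have "\<bar>(R 0 h - 3 * R 1 h + 3 * R 2 h - R 3 h) / 6\<bar> \<le> (\<bar>R 0 h\<bar> + 3 * \<bar>R 1 h\<bar> + 3 * \<bar>R 2 h\<bar> + \<bar>R 3 h\<bar>) / 6" by (simp add: abs_le_iff) linarith
    also have "\<dots> \<le> 4/3 * (\<bar>h\<bar>^3 * exp (l * (s + \<bar>h\<bar>)))"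
      using R[of 0 h] R[of 1 h] R[of 2 h] R[of 3 h] by simp
    finally show "\<bar>spline (s + h) - spline s - p * h - q * h\<^sup>2\<bar> \<le> 4/3 * \<bar>h\<bar>^3 * exp (l * (s + \<bar>h\<bar>))"
      by (simp only: e mult.assoc)
  qed
qed

text \<open>The parameter is taken as \<open>l * d\<close> in the unscaled bound, so that division
  by \<open>d\<close> restores \<open>l\<close>. The exponential is split so that the dependence on
  the base point \<open>s\<close> is the single factor \<open>exp (l * (s - a))\<close>, whose
  expectation factorizes over independent summands.\<close>

lemma scaled_spline_taylor:
  assumes l: "l \<ge> 0" and d: "d > 0"
  shows "\<exists>p q. \<forall>h. \<bar>spline ((s + h - a) / d) - spline ((s - a) / d) - p * h - q * h\<^sup>2\<bar>
    \<le> 4/3 / d^3 * exp (l * (s - a)) * (\<bar>h\<bar>^3 * exp (l * \<bar>h\<bar>))"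
proof -
  obtain p q where pq: "\<And>h. \<bar>spline ((s - a) / d + h) - spline ((s - a) / d) - p * h - q * h\<^sup>2\<bar>
      \<le> 4/3 * \<bar>h\<bar>^3 * exp (l * d * ((s - a) / d + \<bar>h\<bar>))"
    using spline_taylor[of "l * d" "(s - a) / d"] l d by auto
  show ?thesis
  proof (rule exI[of _ "p/d"], rule exI[of _ "q/d\<^sup>2"], rule allI)
    fix h
    have "l * d * ((s - a) / d + \<bar>h / d\<bar>) = l * (s - a) + l * \<bar>h\<bar>"
      using d by (simp add: field_simps)
    moreover have "(s - a) / d + h / d = (s + h - a) / d" by (simp add: algebra_simps flip: add_divide_distrib)
    moreover have "\<bar>h / d\<bar> ^ 3 = \<bar>h\<bar>^3 / d^3" using d by (simp add: power_divide abs_divide)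
    ultimately show "\<bar>spline ((s + h - a) / d) - spline ((s - a) / d) - p/d * h - q/d\<^sup>2 * h\<^sup>2\<bar>
        \<le> 4/3 / d^3 * exp (l * (s - a)) * (\<bar>h\<bar>^3 * exp (l * \<bar>h\<bar>))"
      using pq[of "h/d"] using d by (simp add: exp_add power_divide mult_ac)
  qed
qed

section \<open>Gaussian moments, convolution and the replacement scheme\<close>

abbreviation std_normal :: "real measure" where
  "std_normal \<equiv> density lborel (\<lambda>x. ennreal (std_normal_density x))"

lemma prob_space_std_normal: "prob_space std_normal"
  using prob_space_normal_density[of 1 0] by simp

text \<open>Completing the square: the exponentially tilted density is \<open>exp (t^2/2)\<close>
  times the normal density with mean \<open>t\<close>.\<close>

lemma normal_mgf:
  "has_bochner_integral std_normal (\<lambda>z. exp (t * z)) (exp (t\<^sup>2 / 2))"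
proof -
  have "has_bochner_integral lborel (\<lambda>z. exp (t\<^sup>2/2) * normal_density t 1 z) (exp (t\<^sup>2/2) * 1)"
    by (intro has_bochner_integral_mult_right) (simp add: has_bochner_integral_iff)
  also have "(\<lambda>z. exp (t\<^sup>2/2) * normal_density t 1 z) = (\<lambda>z. std_normal_density z *\<^sub>R exp (t * z))"
    by (auto simp: normal_density_def fun_eq_iff field_simps power2_eq_square simp flip: exp_add)
  finally show ?thesis
    by (intro has_bochner_integral_density) auto
qed

text \<open>This function dominates the third-order remainder of the Gaussian increments uniformly
  in the sample size. The cube is absorbed by \<open>y \<le> exp y\<close> at
  \<open>y = \<bar>z\<bar> / 3\<close>, which is the source of 27.\<close>

lemma integrable_cube_exp_std_normal: "integrable std_normal (\<lambda>z. \<bar>z\<bar>^3 * exp \<bar>z\<bar>)"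
proof (rule Bochner_Integration.integrable_bound)
  show "integrable std_normal (\<lambda>z. 27 * (exp (2 * z) + exp ((-2) * z)))"
    using normal_mgf[of 2] normal_mgf[of "-2"] by (auto simp: has_bochner_integral_iff)
  have "\<bar>z\<bar>^3 * exp \<bar>z\<bar> \<le> 27 * (exp (2 * z) + exp ((-2) * z))" for z :: real
  proof -
    have "\<bar>z\<bar> / 3 \<le> exp (\<bar>z\<bar> / 3)" using exp_ge_add_one_self[of "\<bar>z\<bar> / 3"] by linarith
    then have "(\<bar>z\<bar> / 3)^3 \<le> exp (\<bar>z\<bar> / 3) ^ 3" by (intro power_mono) auto
    also have "\<dots> = exp \<bar>z\<bar>" by (simp flip: exp_of_nat_mult)
    finally have "\<bar>z\<bar>^3 \<le> 27 * exp \<bar>z\<bar>" by (simp add: power_divide)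
    then have "\<bar>z\<bar>^3 * exp \<bar>z\<bar> \<le> 27 * exp \<bar>z\<bar> * exp \<bar>z\<bar>" by (intro mult_right_mono) auto
    also have "\<dots> = 27 * exp (2 * \<bar>z\<bar>)" by (simp flip: exp_add)
    also have "\<dots> \<le> 27 * (exp (2 * z) + exp ((-2) * z))" by (cases "z \<ge> 0") auto
    finally show ?thesis .
  qed
  then show "AE z in std_normal. norm (\<bar>z\<bar>^3 * exp \<bar>z\<bar>) \<le> norm (27 * (exp (2 * z) + exp ((-2) * z)))"
    by (auto intro!: always_eventually order_trans[OF _ abs_ge_self])
qed simp

text \<open>Expanding at the same base point gives the same quadratic polynomial under both laws.
  Since mean and second moment agree, the polynomial cancels and only the two expected remainders
  survive.\<close>

lemma swap_bound:
  fixes f R :: "real \<Rightarrow> real"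
  assumes mu: "prob_space \<mu>" "sets \<mu> = sets borel" and nu: "prob_space \<nu>" "sets \<nu> = sets borel"
    and taylor: "\<And>h. \<bar>f (s + h) - f s - p * h - q * h\<^sup>2\<bar> \<le> R h"
    and f[measurable]: "f \<in> borel_measurable borel" and fB: "\<And>x. \<bar>f x\<bar> \<le> B"
    and i1: "integrable \<mu> (\<lambda>h. h)" "integrable \<mu> (\<lambda>h. h\<^sup>2)" "integrable \<mu> R"
    and i2: "integrable \<nu> (\<lambda>h. h)" "integrable \<nu> (\<lambda>h. h\<^sup>2)" "integrable \<nu> R"
    and m1: "(LINT h|\<mu>. h) = (LINT h|\<nu>. h)" and m2: "(LINT h|\<mu>. h\<^sup>2) = (LINT h|\<nu>. h\<^sup>2)"
  shows "\<bar>(LINT h|\<mu>. f (s + h)) - (LINT h|\<nu>. f (s + h))\<bar> \<le> (LINT h|\<mu>. R h) + (LINT h|\<nu>. R h)"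
proof -
  have key: "integrable \<rho> (\<lambda>h. f (s + h)) \<and>
      \<bar>(LINT h|\<rho>. f (s + h)) - f s - p * (LINT h|\<rho>. h) - q * (LINT h|\<rho>. h\<^sup>2)\<bar> \<le> (LINT h|\<rho>. R h)"
    if \<rho>: "prob_space \<rho>" "sets \<rho> = sets borel" "integrable \<rho> (\<lambda>h. h)" "integrable \<rho> (\<lambda>h. h\<^sup>2)" "integrable \<rho> R" for \<rho>
  proof -
    interpret prob_space \<rho> by fact
    have [measurable_cong]: "sets \<rho> = sets borel" by fact
    have i: "integrable \<rho> (\<lambda>h. f (s + h))"
      by (rule integrable_const_bound[of _ B]) (auto simp: fB)
    have "(LINT h|\<rho>. f (s + h)) - f s - p * (LINT h|\<rho>. h) - q * (LINT h|\<rho>. h\<^sup>2)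
        = (LINT h|\<rho>. f (s + h) - f s - p * h - q * h\<^sup>2)"
      using i \<rho> by (simp add: prob_space)
    also have "\<bar>\<dots>\<bar> \<le> (LINT h|\<rho>. \<bar>f (s + h) - f s - p * h - q * h\<^sup>2\<bar>)"
      by (rule integral_abs_bound)
    also have "\<dots> \<le> (LINT h|\<rho>. R h)"
      using i \<rho> taylor by (intro integral_mono) auto
    finally show ?thesis using i by simp
  qed
  show ?thesis
    using key[OF mu i1] key[OF nu i2] m1 m2 by auto
qed

text \<open>The degenerate scales are separated because the density calculus for normal laws needs
  positive standard deviations; scale 0 occurs when no Gaussian increment has been collected
  yet.\<close>

lemma std_normal_convolution:
  fixes f :: "real \<Rightarrow> real"
  assumes f[measurable]: "f \<in> borel_measurable borel" and fB: "\<And>x. \<bar>f x\<bar> \<le> B"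
    and ab: "a \<ge> 0" "b \<ge> 0"
  shows "(LINT z|std_normal. LINT w|std_normal. f (a * z + b * w)) = (LINT z|std_normal. f (sqrt (a\<^sup>2 + b\<^sup>2) * z))"
proof -
  interpret N: prob_space std_normal by (rule prob_space_std_normal)
  interpret P: pair_prob_space std_normal std_normal ..
  consider "a = 0" | "b = 0" | "a > 0" "b > 0" using ab by fastforce
  then show ?thesis
  proof cases
    case 1
    then show ?thesis using ab N.prob_space by simp
  next
    case 2
    then show ?thesis using ab N.prob_space by simp
  next
    case 3
    have D: "distr std_normal borel (\<lambda>z. c * z) = density lborel (\<lambda>x. ennreal (normal_density 0 c x))" if "c > 0" for c
    proof -
      have i: "distr std_normal lborel (\<lambda>x. x) = std_normal"
        by (rule distr_id2) simp
      have d: "distributed std_normal lborel (\<lambda>x. x) (normal_density 0 1)"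
        unfolding distributed_def i by simp
      have "distributed std_normal lborel (\<lambda>x. 0 + c * x) (normal_density (0 + c * 0) (\<bar>c\<bar> * 1))"
        by (rule N.normal_density_affine[OF d]) (use that in auto)
      then have "distr std_normal lborel (\<lambda>x. c * x) = density lborel (\<lambda>x. ennreal (normal_density 0 c x))"
        using that unfolding distributed_def by simp
      moreover have "distr std_normal borel (\<lambda>z. c * z) = distr std_normal lborel (\<lambda>z. c * z)"
        by (rule distr_cong) simp_all
      ultimately show ?thesis by simp
    qed
    have c: "sqrt (a\<^sup>2 + b\<^sup>2) > 0" using 3 by (simp add: add_pos_pos)
    have "(LINT z|std_normal. LINT w|std_normal. f (a * z + b * w)) =
        (LINT p|(std_normal \<Otimes>\<^sub>M std_normal). f (a * fst p + b * snd p))"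
      by (subst P.integral_fst'[symmetric])
         (auto intro!: P.P.integrable_const_bound[of _ B] simp: fB)
    also have "\<dots> = (LINT x|(distr (std_normal \<Otimes>\<^sub>M std_normal) borel (\<lambda>p. a * fst p + b * snd p)). f x)"
      by (subst integral_distr) auto
    also have "distr (std_normal \<Otimes>\<^sub>M std_normal) borel (\<lambda>p. a * fst p + b * snd p) =
       convolution (distr std_normal borel (\<lambda>z. a * z)) (distr std_normal borel (\<lambda>z. b * z))"
    proof -
      have "distr std_normal borel (\<lambda>z. a * z) \<Otimes>\<^sub>M distr std_normal borel (\<lambda>z. b * z) =
         distr (std_normal \<Otimes>\<^sub>M std_normal) (borel \<Otimes>\<^sub>M borel) (\<lambda>(x, y). (a * x, b * y))"
        by (rule pair_measure_distr)
           (auto intro!: prob_space_imp_sigma_finite N.prob_space_distr)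
      then show ?thesis
        unfolding convolution_def
        by (simp add: distr_distr comp_def case_prod_beta')
    qed
    also have "convolution (distr std_normal borel (\<lambda>z. a * z)) (distr std_normal borel (\<lambda>z. b * z)) = 
       distr std_normal borel (\<lambda>z. sqrt (a\<^sup>2 + b\<^sup>2) * z)"
    proof -
      have fin: "finite_measure (density lborel (\<lambda>x. ennreal (normal_density 0 c x)))" if "c > 0" for c
        using prob_space_normal_density[OF that] by (rule prob_space.finite_measure)
      show ?thesis
        unfolding D[OF 3(1)] D[OF 3(2)] D[OF c]
          convolution_density[OF _ _ fin[OF 3(1)] fin[OF 3(2)], simplified]
        using conv_normal_density_zero_mean[OF 3] by (simp flip: ennreal_mult)
    qed
    finally show ?thesis by (simp add: integral_distr)
  qed
qed

lemma std_normal_first_moment: "has_bochner_integral std_normal (\<lambda>z. z) 0"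
  using std_normal_moment_odd[of 0] by (intro has_bochner_integral_density) auto

lemma std_normal_second_moment: "has_bochner_integral std_normal (\<lambda>z. z\<^sup>2) 1"
proof -
  have "has_bochner_integral lborel (\<lambda>x. std_normal_density x *\<^sub>R x\<^sup>2) 1"
    using std_normal_moment_even[of 1] by (simp add: fact_2)
  then show ?thesis by (rule has_bochner_integral_density[rotated 3]) auto
qed

text \<open>Summands are exchanged for Gaussian ones of equal variance one at a time. The exchange
  with \<open>j\<close> original and \<open>i\<close> Gaussian summands present costs
  \<open>exp (l * s)\<close> at their sum \<open>s\<close>. Averaging this over the independent
  remaining summands gives \<open>j\<close> exponential moments of the one kind and \<open>i\<close>
  of the other, each at most \<open>D\<close>, with \<open>i + j = n - 1\<close>.\<close>

lemma (in prob_space) lindeberg_telescope: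
  fixes f r :: "real \<Rightarrow> real" and Y :: "nat \<Rightarrow> 'a \<Rightarrow> real"
  assumes indep: "indep_vars (\<lambda>_. borel) Y UNIV"
    and law: "\<And>i. distr M borel (Y i) = \<mu>"
    and f[measurable]: "f \<in> borel_measurable borel" and fB: "\<And>x. \<bar>f x\<bar> \<le> B"
    and r[measurable]: "r \<in> borel_measurable borel"
    and taylor: "\<And>s. \<exists>p q. \<forall>h. \<bar>f (s + h) - f s - p * h - q * h\<^sup>2\<bar> \<le> \<kappa> * exp (l * s) * r h"
    and \<kappa>: "\<kappa> \<ge> 0" and r0: "\<And>h. r h \<ge> 0" and \<tau>: "\<tau> \<ge> 0"
    and i1: "integrable \<mu> (\<lambda>h. h)" "integrable \<mu> (\<lambda>h. h\<^sup>2)" "integrable \<mu> r" "integrable \<mu> (\<lambda>h. exp (l * h))"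
    and i2: "integrable std_normal (\<lambda>z. r (\<tau> * z))"
    and mom: "(LINT h|\<mu>. h) = 0" "(LINT h|\<mu>. h\<^sup>2) = \<tau>\<^sup>2"
    and D: "(LINT h|\<mu>. exp (l * h)) \<le> D" "exp (l\<^sup>2 * \<tau>\<^sup>2 / 2) \<le> D"
  shows "\<bar>expectation (\<lambda>\<omega>. f (\<Sum>i<n. Y i \<omega>)) - (LINT z|std_normal. f (sqrt n * \<tau> * z))\<bar>
    \<le> \<kappa> * ((LINT h|\<mu>. r h) + (LINT z|std_normal. r (\<tau> * z))) * n * D ^ (n - 1)"
proof -
  interpret N: prob_space std_normal by (rule prob_space_std_normal)
  have Ym[measurable]: "Y i \<in> borel_measurable M" for i using indep by (auto simp: indep_vars_def)
  have mu: "prob_space \<mu>" "sets \<mu> = sets borel" using law[of 0] by (auto intro: prob_space_distr)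
  interpret mu: prob_space \<mu> by fact
  have [measurable_cong]: "sets \<mu> = sets borel" by fact
  interpret muN: pair_prob_space \<mu> std_normal ..
  define m where "m = (LINT h|\<mu>. r h) + (LINT z|std_normal. r (\<tau> * z))"
  have m0: "m \<ge> 0" unfolding m_def using r0 by (intro add_nonneg_nonneg integral_nonneg_AE) auto
  have D1: "D \<ge> 1" using D(2) by (smt (verit) divide_nonneg_nonneg exp_ge_add_one_self mult_nonneg_nonneg zero_le_power2)
  \<comment> \<open>\<open>g i\<close> is \<open>f\<close> averaged over \<open>i\<close> Gaussian
    increments, merged into one normal variable of variance \<open>i * \<tau>^2\<close>.\<close>
  define g where "g i s = (LINT z|std_normal. f (s + sqrt (real i) * \<tau> * z))" for i :: nat and s
  have g[measurable]: "g i \<in> borel_measurable borel" for i unfolding g_def by measurable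
  have gB: "\<bar>g i s\<bar> \<le> B" for i s
  proof -
    have "\<bar>g i s\<bar> \<le> (LINT z|std_normal. \<bar>f (s + sqrt (real i) * \<tau> * z)\<bar>)"
      unfolding g_def by (rule integral_abs_bound)
    also have "\<dots> \<le> (LINT z|std_normal. B)"
      by (intro integral_mono) (auto simp: fB intro!: N.integrable_const_bound[of _ B])
    finally show ?thesis using N.prob_space by simp
  qed
  have scaled: "prob_space (distr std_normal borel (\<lambda>z. \<tau> * z))"
    by (intro N.prob_space_distr) simp
  have swap: "\<bar>(LINT h|\<mu>. f (s + h)) - (LINT w|std_normal. f (s + \<tau> * w))\<bar> \<le> \<kappa> * m * exp (l * s)" for s
  proof -
    obtain p q where pq: "\<And>h. \<bar>f (s + h) - f s - p * h - q * h\<^sup>2\<bar> \<le> \<kappa> * exp (l * s) * r h"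
      using taylor[of s] by (elim exE) (rule that, erule spec)
    note s1 = std_normal_first_moment[unfolded has_bochner_integral_iff]
      std_normal_second_moment[unfolded has_bochner_integral_iff]
    let ?N = "distr std_normal borel (\<lambda>z. \<tau> * z)" and ?R = "\<lambda>h. \<kappa> * exp (l * s) * r h"
    have iN: "integrable ?N w = integrable std_normal (\<lambda>z. w (\<tau> * z))" if "w \<in> borel_measurable borel" for w :: "real \<Rightarrow> real"
      using that by (intro integrable_distr_eq) measurable
    have eN: "(LINT h|?N. w h) = (LINT z|std_normal. w (\<tau> * z))" if "w \<in> borel_measurable borel" for w :: "real \<Rightarrow> real"
      using that by (intro integral_distr) measurable
    have j2: "integrable ?N (\<lambda>h. h)" "integrable ?N (\<lambda>h. h\<^sup>2)" "integrable ?N ?R" "integrable \<mu> ?R"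
      subgoal by (subst iN) (use s1 in auto)
      subgoal by (subst iN) (use s1 in \<open>auto simp: power_mult_distrib\<close>)
      subgoal by (subst iN) (use i2 in auto)
      subgoal using i1(3) by (rule integrable_mult_right)
      done
    have m: "(LINT h|\<mu>. h) = (LINT h|?N. h)" "(LINT h|\<mu>. h\<^sup>2) = (LINT h|?N. h\<^sup>2)"
      subgoal by (subst eN) (use mom s1 in auto)
      subgoal by (subst eN) (use mom s1 in \<open>auto simp: power_mult_distrib\<close>)
      done
    have "\<bar>(LINT h|\<mu>. f (s + h)) - (LINT h|?N. f (s + h))\<bar> \<le> (LINT h|\<mu>. ?R h) + (LINT h|?N. ?R h)"
      by (rule swap_bound[OF mu scaled _ pq f fB i1(1,2) j2(4) j2(1-3) m]) simp
    also have "\<dots> = \<kappa> * m * exp (l * s)"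
      by (subst eN) (simp_all add: m_def algebra_simps)
    finally show ?thesis by (subst (asm) eN) simp_all
  qed
  \<comment> \<open>Averaging over the Gaussian part last means that only \<open>f\<close>, never its smoothed version \<open>g i\<close>, has to be expanded.\<close>
  have step: "\<bar>(LINT h|\<mu>. g i (s + h)) - g (Suc i) s\<bar> \<le> \<kappa> * m * D ^ i * exp (l * s)" for i s
  proof -
    have a: "(LINT h|\<mu>. g i (s + h)) = (LINT z|std_normal. LINT h|\<mu>. f ((s + sqrt i * \<tau> * z) + h))"
    proof -
      have "(LINT h|\<mu>. g i (s + h)) = (LINT z|std_normal. LINT h|\<mu>. f (s + h + sqrt i * \<tau> * z))"
        unfolding g_def
        by (rule muN.Fubini_integral[symmetric])
           (auto intro!: muN.P.integrable_const_bound[of _ B] simp: fB)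
      then show ?thesis by (simp add: add_ac)
    qed
    have b: "g (Suc i) s = (LINT z|std_normal. LINT w|std_normal. f ((s + sqrt i * \<tau> * z) + \<tau> * w))"
    proof -
      have "(LINT z|std_normal. LINT w|std_normal. f (s + ((sqrt i * \<tau>) * z + \<tau> * w))) =
        (LINT z|std_normal. f (s + sqrt ((sqrt i * \<tau>)\<^sup>2 + \<tau>\<^sup>2) * z))"
        by (rule std_normal_convolution[of "\<lambda>x. f (s + x)" B]) (auto simp: fB \<tau>)
      moreover have "sqrt ((sqrt i * \<tau>)\<^sup>2 + \<tau>\<^sup>2) = sqrt (real (Suc i)) * \<tau>"
      proof -
        have "(sqrt i * \<tau>)\<^sup>2 + \<tau>\<^sup>2 = (real i + 1) * \<tau>\<^sup>2"
          by (simp add: power_mult_distrib algebra_simps)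
        then show ?thesis using \<tau> by (simp add: real_sqrt_mult add_ac)
      qed
      ultimately show ?thesis by (simp add: g_def add_ac)
    qed
    have mi: "integrable std_normal (\<lambda>z. LINT h|\<mu>. f ((s + sqrt i * \<tau> * z) + h))"
      by (rule N.integrable_const_bound[of _ B])
         (auto intro!: order_trans[OF integral_abs_bound] mu.integral_le_const mu.integrable_const_bound[of _ B] simp: fB)
    have ni: "integrable std_normal (\<lambda>z. LINT w|std_normal. f ((s + sqrt i * \<tau> * z) + \<tau> * w))"
      by (rule N.integrable_const_bound[of _ B])
         (auto intro!: order_trans[OF integral_abs_bound] N.integral_le_const N.integrable_const_bound[of _ B] simp: fB)
    have e: "exp (l * (s + sqrt i * \<tau> * z)) = exp (l * s) * exp (l * sqrt i * \<tau> * z)" for z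
      by (simp add: algebra_simps flip: exp_add)
    have mg: "integrable std_normal (\<lambda>z. exp (l * sqrt i * \<tau> * z))"
        "(LINT z|std_normal. exp (l * sqrt i * \<tau> * z)) = exp ((l * sqrt i * \<tau>)\<^sup>2 / 2)"
      using normal_mgf[of "l * sqrt i * \<tau>"] by (auto simp: has_bochner_integral_iff)
    have "(l * sqrt i * \<tau>)\<^sup>2 / 2 = real i * (l\<^sup>2 * \<tau>\<^sup>2 / 2)" by (simp add: power_mult_distrib)
    then have mg2: "exp ((l * sqrt i * \<tau>)\<^sup>2 / 2) \<le> D ^ i"
      unfolding \<open>(l * sqrt i * \<tau>)\<^sup>2 / 2 = real i * (l\<^sup>2 * \<tau>\<^sup>2 / 2)\<close> exp_of_nat_mult
      using D(2) by (intro power_mono) auto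
    have "\<bar>(LINT h|\<mu>. g i (s + h)) - g (Suc i) s\<bar> = \<bar>LINT z|std_normal. (LINT h|\<mu>. f ((s + sqrt i * \<tau> * z) + h)) - (LINT w|std_normal. f ((s + sqrt i * \<tau> * z) + \<tau> * w))\<bar>"
      unfolding a b using mi ni by simp
    also have "\<dots> \<le> (LINT z|std_normal. \<bar>(LINT h|\<mu>. f ((s + sqrt i * \<tau> * z) + h)) - (LINT w|std_normal. f ((s + sqrt i * \<tau> * z) + \<tau> * w))\<bar>)"
      by (rule integral_abs_bound)
    also have "\<dots> \<le> (LINT z|std_normal. \<kappa> * m * exp (l * s) * exp (l * sqrt i * \<tau> * z))"
    proof (rule integral_mono)
      show "integrable std_normal (\<lambda>z. \<bar>(LINT h|\<mu>. f ((s + sqrt i * \<tau> * z) + h)) - (LINT w|std_normal. f ((s + sqrt i * \<tau> * z) + \<tau> * w))\<bar>)"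
        by (intro integrable_abs Bochner_Integration.integrable_diff mi ni)
      show "integrable std_normal (\<lambda>z. \<kappa> * m * exp (l * s) * exp (l * sqrt i * \<tau> * z))"
        by (intro integrable_mult_right mg)
      show "\<bar>(LINT h|\<mu>. f ((s + sqrt i * \<tau> * z) + h)) - (LINT w|std_normal. f ((s + sqrt i * \<tau> * z) + \<tau> * w))\<bar>
          \<le> \<kappa> * m * exp (l * s) * exp (l * sqrt i * \<tau> * z)" for z
        using swap[of "s + sqrt i * \<tau> * z"] unfolding e by (simp only: mult.assoc)
    qed
    also have "\<dots> = \<kappa> * m * exp (l * s) * exp ((l * sqrt i * \<tau>)\<^sup>2 / 2)"
      using mg by simp
    also have "\<dots> \<le> \<kappa> * m * exp (l * s) * D ^ i"
      using mg2 \<kappa> m0 by (intro mult_left_mono) auto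
    finally show ?thesis by (simp add: mult_ac)
  qed
  define S where "S j \<omega> = (\<Sum>i<j. Y i \<omega>)" for j \<omega>
  have Sm[measurable]: "S j \<in> borel_measurable M" for j unfolding S_def by measurable
  define A where "A = (LINT h|\<mu>. exp (l * h))"
  have A0: "A \<ge> 0" unfolding A_def by (intro integral_nonneg_AE) auto
  have expS: "integrable M (\<lambda>\<omega>. exp (l * S j \<omega>)) \<and> expectation (\<lambda>\<omega>. exp (l * S j \<omega>)) = A ^ j" for j
  proof -
    have 1: "indep_vars (\<lambda>_. borel) (\<lambda>i \<omega>. exp (l * Y i \<omega>)) {..<j}"
      by (rule indep_vars_compose2[OF indep_vars_subset[OF indep], of "{..<j}" "\<lambda>_ y. exp (l * y)"]) auto
    have 2: "integrable M (\<lambda>\<omega>. exp (l * Y i \<omega>))" for i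
      using i1(4) law[of i] by (auto simp: integrable_distr_eq)
    have 3: "expectation (\<lambda>\<omega>. exp (l * Y i \<omega>)) = A" for i
      unfolding A_def law[of i, symmetric] by (simp add: integral_distr)
    have 4: "exp (l * S j \<omega>) = (\<Prod>i<j. exp (l * Y i \<omega>))" for \<omega>
      by (simp add: S_def sum_distrib_left exp_sum)
    show ?thesis unfolding 4
      using indep_vars_integrable[OF _ 1 2] indep_vars_lebesgue_integral[OF _ 1 2] by (simp add: 3)
  qed
  \<comment> \<open>The last summand is independent of the partial sum before it, so it can be
    integrated out first under its own law \<open>\<mu>\<close>.\<close>
  have joint: "expectation (\<lambda>\<omega>. g i (S (Suc j) \<omega>)) = expectation (\<lambda>\<omega>. LINT h|\<mu>. g i (S j \<omega> + h))" for i j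
  proof -
    have "indep_var borel (Y j) borel (\<lambda>\<omega>. \<Sum>i\<in>{..<j}. Y i \<omega>)"
      by (rule indep_vars_sum) (auto intro: indep_vars_subset[OF indep])
    then have d: "\<mu> \<Otimes>\<^sub>M distr M borel (S j) = distr M (borel \<Otimes>\<^sub>M borel) (\<lambda>\<omega>. (Y j \<omega>, S j \<omega>))"
      unfolding indep_var_distribution_eq law[of j] S_def by simp
    interpret Sd: prob_space "distr M borel (S j)" by (rule prob_space_distr) simp
    interpret Sm: pair_prob_space \<mu> "distr M borel (S j)" ..
    have "expectation (\<lambda>\<omega>. g i (S (Suc j) \<omega>)) = (LINT p|distr M (borel \<Otimes>\<^sub>M borel) (\<lambda>\<omega>. (Y j \<omega>, S j \<omega>)). (case p of (h, s) \<Rightarrow> g i (s + h)))"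
      by (subst integral_distr) (auto simp: S_def)
    also have "\<dots> = (LINT p|(\<mu> \<Otimes>\<^sub>M distr M borel (S j)). (case p of (h, s) \<Rightarrow> g i (s + h)))" unfolding d ..
    also have "\<dots> = (LINT s|distr M borel (S j). LINT h|\<mu>. g i (s + h))"
      by (rule Sm.integral_snd[symmetric])
         (auto intro!: Sm.P.integrable_const_bound[of _ B] simp: gB)
    also have "\<dots> = expectation (\<lambda>\<omega>. LINT h|\<mu>. g i (S j \<omega> + h))"
      by (subst integral_distr) auto
    finally show ?thesis .
  qed
  \<comment> \<open>\<open>a j\<close> has the first \<open>j\<close> summands original and the
    other \<open>n - j\<close> Gaussian: \<open>a n\<close> is the expectation under study and
    \<open>a 0\<close> the purely Gaussian one.\<close>
  define a where "a j = expectation (\<lambda>\<omega>. g (n - j) (S j \<omega>))" for j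
  have diff: "\<bar>a (Suc j) - a j\<bar> \<le> \<kappa> * m * D ^ (n - 1)" if "j < n" for j
  proof -
    define i where "i = n - Suc j"
    have i: "n - j = Suc i" "n - 1 = i + j" using that by (auto simp: i_def)
    have x1: "integrable M (\<lambda>\<omega>. LINT h|\<mu>. g i (S j \<omega> + h))"
      by (rule integrable_const_bound[of _ B])
         (auto intro!: order_trans[OF integral_abs_bound] mu.integral_le_const mu.integrable_const_bound[of _ B] simp: gB)
    have x2: "integrable M (\<lambda>\<omega>. g (Suc i) (S j \<omega>))"
      by (rule integrable_const_bound[of _ B]) (auto simp: gB)
    have "\<bar>a (Suc j) - a j\<bar> = \<bar>expectation (\<lambda>\<omega>. (LINT h|\<mu>. g i (S j \<omega> + h)) - g (Suc i) (S j \<omega>))\<bar>"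
      unfolding a_def i joint i_def[symmetric] using x1 x2 by simp
    also have "\<dots> \<le> expectation (\<lambda>\<omega>. \<bar>(LINT h|\<mu>. g i (S j \<omega> + h)) - g (Suc i) (S j \<omega>)\<bar>)"
      by (rule integral_abs_bound)
    also have "\<dots> \<le> expectation (\<lambda>\<omega>. \<kappa> * m * D ^ i * exp (l * S j \<omega>))"
      using x1 x2 expS[of j] step by (intro integral_mono) auto
    also have "\<dots> = \<kappa> * m * (D ^ i * A ^ j)" using expS[of j] by simp
    also have "\<dots> \<le> \<kappa> * m * (D ^ i * D ^ j)"
      using A0 D D1 \<kappa> m0 by (intro mult_left_mono power_mono) (auto simp: A_def)
    finally show ?thesis unfolding i by (simp add: power_add)
  qed
  have "\<bar>a n - a 0\<bar> = \<bar>\<Sum>j<n. a (Suc j) - a j\<bar>" by (simp add: sum_lessThan_telescope)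
  also have "\<dots> \<le> (\<Sum>j<n. \<bar>a (Suc j) - a j\<bar>)" by (rule sum_abs)
  also have "\<dots> \<le> (\<Sum>j<n. \<kappa> * m * D ^ (n - 1))" by (intro sum_mono diff) auto
  finally have "\<bar>a n - a 0\<bar> \<le> \<kappa> * m * n * D ^ (n - 1)" by (simp add: mult_ac)
  moreover have "a n = expectation (\<lambda>\<omega>. f (\<Sum>i<n. Y i \<omega>))"
    using N.prob_space by (simp add: a_def g_def S_def)
  moreover have "a 0 = (LINT z|std_normal. f (sqrt n * \<tau> * z))"
    using prob_space by (simp add: a_def g_def S_def)
  ultimately show ?thesis unfolding m_def by simp
qed

text \<open>The coefficient 1/2 has to be exact: in the \<open>n\<close>-th power of an exponential
  moment it becomes \<open>exp (l^2/2)\<close>, where any larger coefficient would be lost by a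
  power of \<open>n\<close>. The cubic coefficient only has to be bounded, and
  \<open>exp t / 6 \<le> 1\<close> because \<open>exp 1 \<le> 3\<close>.\<close>

lemma exp_le_cubic:
  fixes y :: real
  assumes "\<bar>y\<bar> \<le> 1"
  shows "exp y \<le> 1 + y + y\<^sup>2 / 2 + \<bar>y\<bar>^3"
proof -
  obtain t where t: "\<bar>t\<bar> \<le> \<bar>y\<bar>" "exp y = (\<Sum>m<3. y ^ m / fact m) + exp t / fact 3 * y ^ 3"
    using Maclaurin_exp_le by blast
  have "exp t \<le> exp 1" using t assms by simp
  also have "\<dots> \<le> 3" by (rule exp_le)
  finally have "exp t / fact 3 \<le> 1" by (simp add: fact_numeral)
  then have "exp t / fact 3 * y ^ 3 \<le> 1 * \<bar>y\<bar>^3"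
    using abs_ge_self[of "y^3"] mult_left_le_one_le[of "\<bar>y\<bar>^3" "exp t / fact 3"]
      mult_left_mono[of "y^3" "\<bar>y\<bar>^3" "exp t / fact 3"] by (auto simp: power_abs)
  moreover have "(\<Sum>m<3. y ^ m / fact m) = 1 + y + y\<^sup>2 / 2"
    by (simp add: eval_nat_numeral)
  ultimately show ?thesis using t by simp
qed

definition cubic_exp_moment :: real where
  "cubic_exp_moment = (LINT z|std_normal. \<bar>z\<bar>^3 * exp \<bar>z\<bar>)"

lemma cubic_exp_moment_nonneg: "cubic_exp_moment \<ge> 0"
  unfolding cubic_exp_moment_def by (intro integral_nonneg_AE) auto

text \<open>Each of the \<open>n\<close> exchanges costs a third moment of size
  \<open>n^(-3/2)\<close>, so together they cost \<open>1 / sqrt n\<close>. The exponential moments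
  multiply to at most \<open>exp (l^2/2 + 1)\<close>, and \<open>exp (- l * a)\<close> comes from
  the weight measured from the left end \<open>a\<close> of the smoothing window. The hypothesis on
  \<open>l^3 * b^3\<close> keeps the non-Gaussian part of the exponential moment within one factor
  e.\<close>

lemma (in prob_space) spline_normal_approx:
  fixes Y :: "nat \<Rightarrow> 'a \<Rightarrow> real"
  assumes indep: "indep_vars (\<lambda>_. borel) Y UNIV"
    and law: "\<And>i. distr M borel (Y i) = distr M borel (Y 0)"
    and bound: "\<And>i \<omega>. \<bar>Y i \<omega>\<bar> \<le> b" and b: "b \<ge> 1"
    and mom: "expectation (Y 0) = 0" "expectation (\<lambda>\<omega>. (Y 0 \<omega>)\<^sup>2) = 1"
    and l: "l \<ge> 0" and n: "n \<ge> 1" and lb: "l * b \<le> sqrt n" "l^3 * b^3 \<le> sqrt n" and d: "d > 0"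
  shows "\<bar>expectation (\<lambda>\<omega>. spline (((\<Sum>i<n. Y i \<omega>) / sqrt n - a) / d)) - (LINT z|std_normal. spline ((z - a) / d))\<bar>
    \<le> 4/3 / d^3 * (3 * b^3 + cubic_exp_moment) / sqrt n * exp (l\<^sup>2 / 2 - l * a + 1)"
proof -
  interpret N: prob_space std_normal by (rule prob_space_std_normal)
  have Ym[measurable]: "Y i \<in> borel_measurable M" for i using indep by (auto simp: indep_vars_def)
  define u where "u = 1 / sqrt n"
  have u: "u > 0" "real n * u\<^sup>2 = 1" "sqrt n * u = 1" "real n * u^3 = u"
    using n by (auto simp: u_def power_divide power3_eq_cube power2_eq_square)
  have lub: "l * (u * b) \<le> 1" using lb(1) n by (simp add: u_def field_simps)
  \<comment> \<open>This uses \<open>b \<ge> 1\<close>. It bounds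
    \<open>exp (l * u * \<bar>z\<bar>)\<close> by \<open>exp \<bar>z\<bar>\<close>, so one Gaussian
    integral serves for all \<open>n\<close> and \<open>l\<close>.\<close>
  have lu: "l * u \<le> 1"
  proof -
    have "l * u * 1 \<le> l * u * b" using l u b by (intro mult_left_mono) auto
    then show ?thesis using lub by (simp add: mult_ac)
  qed
  define f where "f z = spline ((z - a) / d)" for z
  define r where "r h = \<bar>h\<bar>^3 * exp (l * \<bar>h\<bar>)" for h :: real
  define \<mu> where "\<mu> = distr M borel (\<lambda>\<omega>. u * Y 0 \<omega>)"
  have fm[measurable]: "f \<in> borel_measurable borel" unfolding f_def by measurable
  have rm[measurable]: "r \<in> borel_measurable borel" unfolding r_def by measurable
  have indep': "indep_vars (\<lambda>_. borel) (\<lambda>i \<omega>. u * Y i \<omega>) UNIV"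
    by (rule indep_vars_compose2[OF indep, of "\<lambda>_ y. u * y"]) simp
  have law': "distr M borel (\<lambda>\<omega>. u * Y i \<omega>) = \<mu>" for i
  proof -
    have "distr M borel (\<lambda>\<omega>. u * Y i \<omega>) = distr (distr M borel (Y i)) borel (\<lambda>y. u * y)"
      by (subst distr_distr) (auto simp: comp_def)
    also have "\<dots> = \<mu>" unfolding law[of i] \<mu>_def
      by (subst distr_distr) (auto simp: comp_def)
    finally show ?thesis .
  qed
  have bnd: "integrable M (\<lambda>\<omega>. w (u * Y 0 \<omega>))" if "w \<in> borel_measurable borel" "\<And>y. \<bar>y\<bar> \<le> u * b \<Longrightarrow> \<bar>w y\<bar> \<le> B" for w :: "real \<Rightarrow> real" and B
    using that(1) bound[of 0] u by (intro integrable_const_bound[of _ B]) (auto intro!: that(2) simp: abs_mult)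
  have iM: "integrable \<mu> w = integrable M (\<lambda>\<omega>. w (u * Y 0 \<omega>))" if "w \<in> borel_measurable borel" for w :: "real \<Rightarrow> real"
    unfolding \<mu>_def using that by (intro integrable_distr_eq) measurable
  have eM: "(LINT h|\<mu>. w h) = expectation (\<lambda>\<omega>. w (u * Y 0 \<omega>))" if "w \<in> borel_measurable borel" for w :: "real \<Rightarrow> real"
    unfolding \<mu>_def using that by (intro integral_distr) measurable
  have uY: "\<bar>u * Y 0 \<omega>\<bar> \<le> u * b" for \<omega> using bound[of 0] u by (simp add: abs_mult)
  have pw: "\<bar>y\<bar> ^ j \<le> (u * b) ^ j" if "\<bar>y\<bar> \<le> u * b" for y j using that by (intro power_mono) auto
  have lab: "l * \<bar>y\<bar> \<le> 1" if "\<bar>y\<bar> \<le> u * b" for y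
    using mult_left_mono[OF that l] lub by linarith
  have rb: "r y \<le> u^3 * (3 * b^3)" if "\<bar>y\<bar> \<le> u * b" for y
  proof -
    have "exp (l * \<bar>y\<bar>) \<le> exp 1" using lab[OF that] by simp
    also have "\<dots> \<le> 3" by (rule exp_le)
    finally have "r y \<le> (u * b)^3 * 3" unfolding r_def using pw[OF that, of 3] u b by (intro mult_mono) auto
    then show ?thesis by (simp add: power_mult_distrib mult_ac)
  qed
  have r0: "r h \<ge> 0" for h by (simp add: r_def)
  have i1: "integrable \<mu> (\<lambda>h. h)" "integrable \<mu> (\<lambda>h. h\<^sup>2)" "integrable \<mu> r" "integrable \<mu> (\<lambda>h. exp (l * h))"
    subgoal by (subst iM) (rule measurable_ident_sets, simp, rule bnd[of "\<lambda>h. h" "u * b"], auto)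
    subgoal by (subst iM) (simp, rule bnd[of "\<lambda>h. h\<^sup>2" "(u * b)\<^sup>2"], use pw[of _ 2] in auto)
    subgoal by (subst iM) (rule rm, rule bnd[of r "u^3 * (3 * b^3)"], use rb r0 in auto)
    subgoal
    proof (subst iM)
      have "l * y \<le> 1" if "\<bar>y\<bar> \<le> u * b" for y using mult_left_mono[OF abs_ge_self[of y] l] lab[OF that] by linarith
      then show "integrable M (\<lambda>\<omega>. exp (l * (u * Y 0 \<omega>)))"
        by (intro bnd[of "\<lambda>h. exp (l * h)" "exp 1"]) auto
    qed simp
    done
  have ur: "r (u * z) \<le> u^3 * (\<bar>z\<bar>^3 * exp \<bar>z\<bar>)" for z
  proof -
    have "l * \<bar>u * z\<bar> \<le> \<bar>z\<bar>" using mult_right_mono[OF lu, of "\<bar>z\<bar>"] u by (simp add: abs_mult mult_ac)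
    then have "r (u * z) \<le> \<bar>u * z\<bar>^3 * exp \<bar>z\<bar>" unfolding r_def by (intro mult_left_mono) auto
    then show ?thesis using u by (simp add: abs_mult power_mult_distrib mult_ac)
  qed
  have i3: "integrable std_normal (\<lambda>z. u^3 * (\<bar>z\<bar>^3 * exp \<bar>z\<bar>))"
    by (intro integrable_mult_right integrable_cube_exp_std_normal)
  have i2: "integrable std_normal (\<lambda>z. r (u * z))"
    by (rule Bochner_Integration.integrable_bound[OF i3])
       (use ur r0 in \<open>auto intro!: always_eventually order_trans[OF _ abs_ge_self]\<close>)
  have mom': "(LINT h|\<mu>. h) = 0" "(LINT h|\<mu>. h\<^sup>2) = u\<^sup>2"
    using mom by (simp_all add: eM power_mult_distrib)
  have iY: "integrable M (Y 0)" "integrable M (\<lambda>\<omega>. (Y 0 \<omega>)\<^sup>2)"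
    subgoal using bound[of 0] by (intro integrable_const_bound[of _ b]) auto
    subgoal using power_mono[OF bound[of 0] abs_ge_zero, where n=2] by (intro integrable_const_bound[of _ "b\<^sup>2"]) auto
    done
  \<comment> \<open>A common bound for both exponential moments: the Gaussian exponent plus the
    cubic error of \<open>exp_le_cubic\<close> for increments of size at most
    \<open>u * b\<close>.\<close>
  define D where "D = exp (l\<^sup>2 * u\<^sup>2 / 2 + (l * (u * b))^3)"
  have A: "(LINT h|\<mu>. exp (l * h)) \<le> D"
  proof -
    have "(LINT h|\<mu>. exp (l * h)) = expectation (\<lambda>\<omega>. exp (l * (u * Y 0 \<omega>)))" by (rule eM) simp
    also have "\<dots> \<le> expectation (\<lambda>\<omega>. 1 + l * (u * Y 0 \<omega>) + l\<^sup>2 / 2 * (u * Y 0 \<omega>)\<^sup>2 + (l * (u * b))^3)"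
    proof (rule integral_mono)
      show "integrable M (\<lambda>\<omega>. exp (l * (u * Y 0 \<omega>)))" using i1(4) by (simp add: iM)
      show "integrable M (\<lambda>\<omega>. 1 + l * (u * Y 0 \<omega>) + l\<^sup>2 / 2 * (u * Y 0 \<omega>)\<^sup>2 + (l * (u * b))^3)"
        using iY by (intro Bochner_Integration.integrable_add integrable_mult_right integrable_const) (simp_all add: power_mult_distrib)
      fix \<omega>
      have y: "\<bar>l * (u * Y 0 \<omega>)\<bar> = l * \<bar>u * Y 0 \<omega>\<bar>" using l by (simp add: abs_mult)
      have "\<bar>l * (u * Y 0 \<omega>)\<bar> \<le> 1" unfolding y by (rule lab[OF uY])
      from exp_le_cubic[OF this]
      have "exp (l * (u * Y 0 \<omega>)) \<le> 1 + l * (u * Y 0 \<omega>) + (l * (u * Y 0 \<omega>))\<^sup>2 / 2 + \<bar>l * (u * Y 0 \<omega>)\<bar>^3" .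
      moreover have "\<bar>l * (u * Y 0 \<omega>)\<bar>^3 \<le> (l * (u * b))^3"
        unfolding y using l mult_left_mono[OF uY l] by (intro power_mono) auto
      ultimately show "exp (l * (u * Y 0 \<omega>)) \<le> 1 + l * (u * Y 0 \<omega>) + l\<^sup>2 / 2 * (u * Y 0 \<omega>)\<^sup>2 + (l * (u * b))^3"
        by (simp add: power_mult_distrib)
    qed
    also have "\<dots> = 1 + l * (LINT h|\<mu>. h) + l\<^sup>2 / 2 * (LINT h|\<mu>. h\<^sup>2) + (l * (u * b))^3"
    proof -
      show ?thesis using iY by (subst (1 2) eM) (simp_all add: prob_space power_mult_distrib)
    qed
    also have "\<dots> = 1 + (l\<^sup>2 * u\<^sup>2 / 2 + (l * (u * b))^3)" unfolding mom' by simp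
    also have "\<dots> \<le> D" unfolding D_def by (rule exp_ge_add_one_self)
    finally show ?thesis .
  qed
  have lub0: "0 \<le> l * (u * b)" using l u b by simp
  have D1: "exp (l\<^sup>2 * u\<^sup>2 / 2) \<le> D" "1 \<le> D" unfolding D_def using lub0 by auto
  define \<kappa> where "\<kappa> = 4/3 / d^3 * exp (- l * a)"
  have \<kappa>0: "\<kappa> \<ge> 0" using d by (simp add: \<kappa>_def)
  have taylor: "\<exists>p q. \<forall>h. \<bar>f (s + h) - f s - p * h - q * h\<^sup>2\<bar> \<le> \<kappa> * exp (l * s) * r h" for s
  proof -
    have "4/3 / d^3 * exp (l * (s - a)) * (\<bar>h\<bar>^3 * exp (l * \<bar>h\<bar>)) = \<kappa> * exp (l * s) * r h" for h
      by (simp add: \<kappa>_def r_def right_diff_distrib exp_diff exp_minus divide_simps)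
    then show ?thesis unfolding f_def using scaled_spline_taylor[OF l d, of s a] by simp
  qed
  have fB: "\<bar>f x\<bar> \<le> 1" for x unfolding f_def using spline_bounds[of "(x - a) / d"] by linarith
  have "\<bar>expectation (\<lambda>\<omega>. f (\<Sum>i<n. u * Y i \<omega>)) - (LINT z|std_normal. f (sqrt n * u * z))\<bar>
    \<le> \<kappa> * ((LINT h|\<mu>. r h) + (LINT z|std_normal. r (u * z))) * n * D ^ (n - 1)"
    by (rule lindeberg_telescope[OF indep' law' fm fB rm taylor \<kappa>0 r0 _ i1 i2 mom' A D1(1)]) (use u in auto)
  also have "\<dots> \<le> \<kappa> * (u^3 * (3 * b^3 + cubic_exp_moment)) * n * exp (l\<^sup>2 / 2 + 1)"
  proof -
    have "(LINT h|\<mu>. r h) \<le> u^3 * (3 * b^3)"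
      unfolding eM[OF rm] using i1(3) uY rb by (intro integral_le_const) (auto simp: iM)
    moreover have "(LINT z|std_normal. r (u * z)) \<le> u^3 * cubic_exp_moment"
      unfolding cubic_exp_moment_def integral_mult_right_zero[symmetric]
      by (intro integral_mono i2 i3 ur)
    moreover have "D ^ (n - 1) \<le> exp (l\<^sup>2 / 2 + 1)"
    proof -
      have "D ^ (n - 1) \<le> D ^ n" using D1 by (intro power_increasing) auto
      also have "\<dots> = exp (real n * (l\<^sup>2 * u\<^sup>2 / 2 + (l * (u * b))^3))"
        unfolding D_def exp_of_nat_mult ..
      also have "real n * (l\<^sup>2 * u\<^sup>2 / 2 + (l * (u * b))^3) = l\<^sup>2 / 2 * (real n * u\<^sup>2) + l^3 * b^3 * (real n * u^3)"
        by (simp add: algebra_simps power_mult_distrib)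
      also have "\<dots> = l\<^sup>2 / 2 + l^3 * b^3 / sqrt n" unfolding u(2,4) by (simp add: u_def)
      also have "\<dots> \<le> l\<^sup>2 / 2 + 1" using lb n by (simp add: field_simps)
      finally show ?thesis by simp
    qed
    moreover have "(LINT h|\<mu>. r h) + (LINT z|std_normal. r (u * z)) \<ge> 0"
      using r0 by (intro add_nonneg_nonneg integral_nonneg_AE) auto
    ultimately show ?thesis
      using \<kappa>0 D1 u(1) b cubic_exp_moment_nonneg by (intro mult_mono mult_nonneg_nonneg) (auto simp: algebra_simps)
  qed
  also have "\<dots> = \<kappa> * (3 * b^3 + cubic_exp_moment) * (real n * u^3) * exp (l\<^sup>2 / 2 + 1)" by (simp add: mult_ac)
  also have "\<dots> = 4/3 / d^3 * (3 * b^3 + cubic_exp_moment) / sqrt n * exp (l\<^sup>2 / 2 - l * a + 1)"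
  proof -
    have "exp (l\<^sup>2 / 2 - l * a + 1) = exp (- l * a) * exp (l\<^sup>2 / 2 + 1)"
      by (simp flip: exp_add)
    then show ?thesis unfolding u(4) by (simp add: \<kappa>_def u_def)
  qed
  finally show ?thesis unfolding u(3) by (simp add: f_def u_def flip: sum_distrib_left sum_divide_distrib)
qed

section \<open>Moderate deviations of perturbed sums\<close>

lemma measure_std_normal_atom: "measure std_normal {x} = 0"
  by (simp add: measure_def emeasure_density nn_integral_null_delta)

lemma Phi_mono: "x \<le> y \<Longrightarrow> Phi x \<le> Phi y"
proof -
  interpret N: prob_space std_normal by (rule prob_space_std_normal)
  show "x \<le> y \<Longrightarrow> Phi x \<le> Phi y" unfolding Phi_def by (intro N.finite_measure_mono) auto
qed

lemma measure_std_normal_greaterThan: "measure std_normal {x<..} = 1 - Phi x"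
proof -
  interpret N: prob_space std_normal by (rule prob_space_std_normal)
  have "{x<..} = space std_normal - {..x}" by auto
  then show ?thesis unfolding Phi_def using N.prob_compl[of "{..x}"] by simp
qed

lemma measure_std_normal_atLeast: "measure std_normal {x..} = 1 - Phi x"
proof -
  interpret N: prob_space std_normal by (rule prob_space_std_normal)
  have "{x..} = {x<..} \<union> {x}" by auto
  then have "measure std_normal {x..} = measure std_normal {x<..} + measure std_normal {x}"
    by (subst N.finite_measure_Union[symmetric]) auto
  then show ?thesis using measure_std_normal_greaterThan measure_std_normal_atom by simp
qed

lemma Phi_minus: "Phi (- x) = 1 - Phi x"
proof -
  interpret N: prob_space std_normal by (rule prob_space_std_normal)
  have i: "distr std_normal lborel (\<lambda>x. x) = std_normal"
    by (rule distr_id2) simp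
  have d: "distributed std_normal lborel (\<lambda>x. x) (normal_density 0 1)"
    unfolding distributed_def i by simp
  have "distributed std_normal lborel (\<lambda>x. 0 + (-1) * x) (normal_density (0 + (-1) * 0) (\<bar>-1\<bar> * 1))"
    by (rule N.normal_density_affine[OF d]) auto
  then have "distr std_normal lborel (\<lambda>x. - x) = std_normal"
    unfolding distributed_def by simp
  then have "Phi (-x) = measure (distr std_normal lborel (\<lambda>x. - x)) {.. - x}"
    by (simp add: Phi_def)
  also have "\<dots> = measure std_normal {x..}"
    by (subst measure_distr) (auto intro!: arg_cong[where f="measure std_normal"])
  finally show ?thesis by (simp add: measure_std_normal_atLeast)
qed

lemma Phi_diff_integral:
  assumes "a \<le> b"
  shows "Phi b - Phi a = (LINT z|lborel. indicator {a<..b} z * std_normal_density z)"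
proof -
  interpret N: prob_space std_normal by (rule prob_space_std_normal)
  have "{..b} = {..a} \<union> {a<..b}" using assms by auto
  then have "Phi b = Phi a + measure std_normal {a<..b}"
    unfolding Phi_def by (subst N.finite_measure_Union[symmetric]) auto
  also have "measure std_normal {a<..b} = (LINT z|std_normal. indicator {a<..b} z)" by simp
  also have "\<dots> = (LINT z|lborel. std_normal_density z * indicator {a<..b} z)"
    by (subst integral_density) auto
  finally show ?thesis by (simp add: mult.commute)
qed

text \<open>From \<open>(z - l)^2 \<ge> 0\<close> follows
  \<open>- z^2/2 \<le> l^2/2 - l * z\<close>, so the density lies below this exponential, which
  touches its Gaussian shape at \<open>z = l\<close>. Near a point \<open>a = l\<close> the bound
  has the order of the density itself.\<close>

lemma Phi_diff_le:
  assumes ab: "a \<le> b" and l: "l \<ge> 0"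
  shows "Phi b - Phi a \<le> (b - a) * exp (l\<^sup>2 / 2 - l * a)"
proof -
  have "Phi b - Phi a = (LINT z|lborel. indicator {a<..b} z * std_normal_density z)"
    by (rule Phi_diff_integral[OF ab])
  also have "\<dots> \<le> (LINT z|lborel. indicator {a<..b} z * exp (l\<^sup>2 / 2 - l * a))"
  proof (rule integral_mono)
    show "integrable lborel (\<lambda>z. indicator {a<..b} z * std_normal_density z)"
      using integrable_mult_indicator[of "{a<..b}" lborel "std_normal_density"] by simp
    show "integrable lborel (\<lambda>z. indicator {a<..b} z * exp (l\<^sup>2 / 2 - l * a))"
      using ab by (simp add: emeasure_lborel_Ioc)
    fix z :: real
    show "indicator {a<..b} z * std_normal_density z \<le> indicator {a<..b} z * exp (l\<^sup>2 / 2 - l * a)"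
    proof (cases "a < z \<and> z \<le> b")
      case True
      have "l * a \<le> l * z" using True l by (intro mult_left_mono) auto
      moreover have "0 \<le> (z - l)\<^sup>2" by simp
      ultimately have "- z\<^sup>2 / 2 \<le> l\<^sup>2 / 2 - l * a" by (simp add: power2_eq_square algebra_simps)
      moreover have "sqrt (2 * pi) \<ge> 1" using pi_ge_two by simp
      ultimately have "1 / sqrt (2 * pi) * exp (- z\<^sup>2 / 2) \<le> 1 * exp (l\<^sup>2 / 2 - l * a)"
        by (intro mult_mono) auto
      then show ?thesis using True by (simp add: std_normal_density_def)
    qed auto
  qed
  also have "\<dots> = (b - a) * exp (l\<^sup>2 / 2 - l * a)" using ab by simp
  finally show ?thesis .
qed

text \<open>The constant in a lower bound of Mills ratio type; \<open>exp (-3/2)\<close> is the loss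
  of the density over an interval of length \<open>1 / (1 + l)\<close> to the right of
  \<open>l\<close>.\<close>

definition mills :: real where "mills = exp (-3/2) / sqrt (2 * pi)"

lemma mills_pos: "mills > 0" by (simp add: mills_def)

text \<open>The tail contains the mass of \<open>{l<..l + w}\<close> with
  \<open>w = 1 / (1 + l)\<close>. This width is chosen to give \<open>l * w \<le> 1\<close> and
  \<open>w \<le> 1\<close>, hence \<open>(l + w)^2 \<le> l^2 + 3\<close>. For negative
  \<open>x\<close> the tail beyond 0 is used.\<close>

lemma normal_tail_ge:
  "1 - Phi x \<ge> mills * exp (- (max x 0)\<^sup>2 / 2) / (1 + max x 0)"
proof -
  define l where "l = max x 0"
  have l: "l \<ge> 0" "x \<le> l" by (auto simp: l_def)
  define w where "w = 1 / (1 + l)"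
  have w: "0 < w" "w \<le> 1" "l * w \<le> 1" using l by (auto simp: w_def)
  have "w * (mills * exp (- l\<^sup>2 / 2)) = (LINT z|lborel. indicator {l<..l+w} z * (mills * exp (- l\<^sup>2 / 2)))"
    using w by simp
  also have "\<dots> \<le> (LINT z|lborel. indicator {l<..l+w} z * std_normal_density z)"
  proof (rule integral_mono)
    show "integrable lborel (\<lambda>z. indicator {l<..l+w} z * std_normal_density z)"
      using integrable_mult_indicator[of "{l<..l+w}" lborel "std_normal_density"] by simp
    show "integrable lborel (\<lambda>z. indicator {l<..l+w} z * (mills * exp (- l\<^sup>2 / 2)))"
      using w by (simp add: emeasure_lborel_Ioc)
    fix z :: real
    show "indicator {l<..l+w} z * (mills * exp (- l\<^sup>2 / 2)) \<le> indicator {l<..l+w} z * std_normal_density z"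
    proof (cases "l < z \<and> z \<le> l + w")
      case True
      have "z\<^sup>2 \<le> (l + w)\<^sup>2" using True l w by (intro power_mono) auto
      also have "\<dots> = l\<^sup>2 + 2 * (l * w) + w * w" by (simp add: power2_eq_square algebra_simps)
      also have "\<dots> \<le> l\<^sup>2 + 3" using w mult_mono[of w 1 w 1] by simp
      finally have "-3/2 + - l\<^sup>2 / 2 \<le> - z\<^sup>2 / 2" by simp
      then have "exp (-3/2) * exp (- l\<^sup>2 / 2) \<le> exp (- z\<^sup>2 / 2)" by (simp flip: exp_add)
      then have "mills * exp (- l\<^sup>2 / 2) \<le> std_normal_density z"
        unfolding mills_def std_normal_density_def by (simp add: divide_right_mono)
      then show ?thesis using True by simp
    qed auto
  qed
  also have "\<dots> = Phi (l + w) - Phi l" using w by (subst Phi_diff_integral) auto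
  also have "\<dots> \<le> 1 - Phi x"
  proof -
    have "Phi (l + w) \<le> 1" unfolding Phi_def
      using prob_space.prob_le_1[OF prob_space_std_normal] by simp
    then show ?thesis using Phi_mono[OF l(2)] by simp
  qed
  finally show ?thesis by (simp add: w_def l_def)
qed

text \<open>The indicator of a half-line is enclosed between two splines of width
  \<open>3 * d\<close>, shifted by \<open>\<eta>\<close> to absorb the difference between
  \<open>V\<close> and the sum. The total displacement is \<open>t\<close>, and
  \<open>l * t \<le> 1\<close> means that it costs at most one factor e. The upper bound is for the
  closed event and the lower bound for the open one, so that together they control both versions of
  the tail.\<close>

lemma (in prob_space) perturbed_sum_normal_approx:
  fixes Y :: "nat \<Rightarrow> 'a \<Rightarrow> real"
  assumes indep: "indep_vars (\<lambda>_. borel) Y UNIV"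
    and law: "\<And>i. distr M borel (Y i) = distr M borel (Y 0)"
    and bound: "\<And>i \<omega>. \<bar>Y i \<omega>\<bar> \<le> b" and b: "b \<ge> 1"
    and mom: "expectation (Y 0) = 0" "expectation (\<lambda>\<omega>. (Y 0 \<omega>)\<^sup>2) = 1"
    and l: "l = max x 0" and n: "n \<ge> 1" and lb: "l * b \<le> sqrt n" "l^3 * b^3 \<le> sqrt n" and d: "d > 0"
    and \<eta>: "\<eta> \<ge> 0" and t: "t = \<eta> + 3 * d" "l * t \<le> 1"
    and V[measurable]: "V \<in> borel_measurable M"
    and G: "G \<in> events" "prob G \<ge> 1 - \<rho>" "\<And>\<omega>. \<omega> \<in> G \<Longrightarrow> \<bar>V \<omega> - (\<Sum>i<n. Y i \<omega>) / sqrt n\<bar> \<le> \<eta>"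
  defines "R \<equiv> exp (- l\<^sup>2 / 2) * (3 * t + 12 * (3 * b^3 + cubic_exp_moment) / (d^3 * sqrt n)) + \<rho>"
  shows "prob {\<omega> \<in> space M. x \<le> V \<omega>} \<le> 1 - Phi x + R" "1 - Phi x - R \<le> prob {\<omega> \<in> space M. x < V \<omega>}"
proof -
  interpret N: prob_space std_normal by (rule prob_space_std_normal)
  have Ym[measurable]: "Y i \<in> borel_measurable M" for i using indep by (auto simp: indep_vars_def)
  define S where "S \<omega> = (\<Sum>i<n. Y i \<omega>) / sqrt n" for \<omega>
  have S[measurable]: "S \<in> borel_measurable M" unfolding S_def by measurable
  define C where "C = 4/3 * (3 * b^3 + cubic_exp_moment) / (d^3 * sqrt n)"
  have C0: "C \<ge> 0" unfolding C_def using b d cubic_exp_moment_nonneg by (intro divide_nonneg_nonneg mult_nonneg_nonneg add_nonneg_nonneg) auto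
  \<comment> \<open>For negative \<open>x\<close> both sides of \<open>l * x = l^2\<close> are zero,
    so both signs of \<open>x\<close> are handled at once.\<close>
  have l0: "l \<ge> 0" and lx: "l * x = l\<^sup>2" using l by (auto simp: max_def power2_eq_square)
  have t0: "t \<ge> 0" using t \<eta> d by simp
  have G': "prob (space M - G) \<le> \<rho>" using G by (simp add: prob_compl)
  \<comment> \<open>The factor 9 bounds e squared: one e comes from the exponential moments and one
    from moving \<open>a\<close> away from \<open>x\<close> by at most \<open>t\<close>. It turns
    4/3 into the 12 of \<open>R\<close>.\<close>
  have cmp: "\<bar>expectation (\<lambda>\<omega>. spline ((S \<omega> - a) / d)) - (LINT z|std_normal. spline ((z - a) / d))\<bar>
      \<le> 9 * C * exp (- l\<^sup>2 / 2)" if a: "a \<ge> x - t" for a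
  proof -
    have "\<bar>expectation (\<lambda>\<omega>. spline ((S \<omega> - a) / d)) - (LINT z|std_normal. spline ((z - a) / d))\<bar> \<le> C * exp (l\<^sup>2 / 2 - l * a + 1)"
      using spline_normal_approx[OF indep law bound b mom l0 n lb d, of a] by (simp add: S_def C_def mult_ac)
    also have "l\<^sup>2 / 2 - l * a + 1 \<le> - l\<^sup>2 / 2 + 2"
      using mult_left_mono[OF a l0] lx t(2) by (simp add: algebra_simps)
    then have "C * exp (l\<^sup>2 / 2 - l * a + 1) \<le> C * exp (- l\<^sup>2 / 2 + 2)"
      using C0 by (intro mult_left_mono) auto
    also have "\<dots> = C * (exp (- l\<^sup>2 / 2) * (exp 1 * exp 1))" by (simp flip: exp_add)
    also have "\<dots> \<le> C * (exp (- l\<^sup>2 / 2) * (3 * 3))"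
      using C0 exp_le by (intro mult_left_mono mult_mono) auto
    finally show ?thesis by simp
  qed
  have tl: "Phi y - Phi z \<le> 3 * t * exp (- l\<^sup>2 / 2)" if "z \<ge> x - t" "z \<le> y" "y - z \<le> t" for y z
  proof -
    have "Phi y - Phi z \<le> (y - z) * exp (l\<^sup>2 / 2 - l * z)" by (rule Phi_diff_le[OF that(2) l0])
    also have "l\<^sup>2 / 2 - l * z \<le> - l\<^sup>2 / 2 + 1"
      using mult_left_mono[OF that(1) l0] lx t(2) by (simp add: algebra_simps)
    then have "(y - z) * exp (l\<^sup>2 / 2 - l * z) \<le> t * exp (- l\<^sup>2 / 2 + 1)"
      using that t0 by (intro mult_mono) auto
    also have "\<dots> = t * (exp (- l\<^sup>2 / 2) * exp 1)" by (simp flip: exp_add)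
    also have "\<dots> \<le> t * (exp (- l\<^sup>2 / 2) * 3)" using t0 exp_le by (intro mult_left_mono) auto
    finally show ?thesis by simp
  qed
  have iS: "integrable M (\<lambda>\<omega>. spline ((S \<omega> - a) / d))" for a
    by (rule integrable_const_bound[of _ 1]) (auto simp: spline_bounds)
  have iN: "integrable std_normal (\<lambda>z. spline ((z - a) / d))" for a
    by (rule N.integrable_const_bound[of _ 1]) (auto simp: spline_bounds)
  have sl: "indicator {a + 3 * d..} z \<le> spline ((z - a) / d)" "spline ((z - a) / d) \<le> indicator {a<..} z" for a z
  proof -
    have "z \<ge> a + 3 * d \<Longrightarrow> 3 \<le> (z - a) / d" using d by (simp add: field_simps)
    then show "indicator {a + 3 * d..} z \<le> spline ((z - a) / d)"
      using spline_eq_1 spline_bounds by (auto simp: indicator_def)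
    have "\<not> z > a \<Longrightarrow> (z - a) / d \<le> 0" using d by (simp add: divide_nonpos_pos)
    then show "spline ((z - a) / d) \<le> indicator {a<..} z"
      using spline_eq_0 spline_bounds by (auto simp: indicator_def)
  qed
  have pe: "expectation (\<lambda>\<omega>. indicator A (S \<omega>)) = prob {\<omega> \<in> space M. S \<omega> \<in> A}" if [measurable]: "A \<in> sets borel" for A
  proof -
    have "expectation (\<lambda>\<omega>. indicator A (S \<omega>)) = expectation (indicator {\<omega> \<in> space M. S \<omega> \<in> A})"
      by (intro Bochner_Integration.integral_cong) (auto simp: indicator_def)
    also have "\<dots> = prob {\<omega> \<in> space M. S \<omega> \<in> A}" by simp
    finally show ?thesis .
  qed
  have R: "R = 3 * t * exp (- l\<^sup>2 / 2) + 9 * C * exp (- l\<^sup>2 / 2) + \<rho>"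
    unfolding R_def C_def by (simp add: algebra_simps)
  show "prob {\<omega> \<in> space M. x \<le> V \<omega>} \<le> 1 - Phi x + R"
  proof -
    \<comment> \<open>The spline started here is already 1 at \<open>x - \<eta>\<close>, the least
      value the sum can have when \<open>V\<close> is at least \<open>x\<close> on
      \<open>G\<close>.\<close>
    define a where "a = x - t"
    have "{\<omega> \<in> space M. x \<le> V \<omega>} \<subseteq> {\<omega> \<in> space M. a + 3 * d \<le> S \<omega>} \<union> (space M - G)"
      using G(3) by (fastforce simp: a_def t S_def)
    then have "prob {\<omega> \<in> space M. x \<le> V \<omega>} \<le> prob ({\<omega> \<in> space M. a + 3 * d \<le> S \<omega>} \<union> (space M - G))"
      using G(1) by (intro finite_measure_mono) auto
    also have "\<dots> \<le> prob {\<omega> \<in> space M. a + 3 * d \<le> S \<omega>} + prob (space M - G)"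
      using G(1) by (intro measure_Un_le) auto
    also have "prob {\<omega> \<in> space M. a + 3 * d \<le> S \<omega>} = expectation (\<lambda>\<omega>. indicator {a + 3 * d..} (S \<omega>))"
      using pe by simp
    also have "\<dots> \<le> expectation (\<lambda>\<omega>. spline ((S \<omega> - a) / d))"
      by (intro integral_mono iS sl integrable_const_bound[of _ 1]) auto
    also have "\<dots> \<le> (LINT z|std_normal. spline ((z - a) / d)) + 9 * C * exp (- l\<^sup>2 / 2)"
      using cmp[of a] by (simp add: a_def)
    also have "(LINT z|std_normal. spline ((z - a) / d)) \<le> (LINT z|std_normal. indicator {a<..} z)"
      by (intro integral_mono iN sl N.integrable_const_bound[of _ 1]) auto
    also have "\<dots> = 1 - Phi a" using measure_std_normal_greaterThan by simp
    also have "\<dots> \<le> 1 - Phi x + 3 * t * exp (- l\<^sup>2 / 2)" using tl[of a x] t0 by (simp add: a_def)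
    finally show ?thesis unfolding R using G' by simp
  qed
  show "1 - Phi x - R \<le> prob {\<omega> \<in> space M. x < V \<omega>}"
  proof -
    \<comment> \<open>The spline started here is positive only where the sum exceeds
      \<open>x + \<eta>\<close>, which forces \<open>V\<close> above \<open>x\<close> on
      \<open>G\<close>; it reaches 1 at \<open>x + t\<close>.\<close>
    define a where "a = x + \<eta>"
    have "{\<omega> \<in> space M. a < S \<omega>} \<subseteq> {\<omega> \<in> space M. x < V \<omega>} \<union> (space M - G)"
      using G(3) by (fastforce simp: a_def t S_def)
    then have "prob {\<omega> \<in> space M. a < S \<omega>} \<le> prob ({\<omega> \<in> space M. x < V \<omega>} \<union> (space M - G))"
      using G(1) by (intro finite_measure_mono) auto
    also have "\<dots> \<le> prob {\<omega> \<in> space M. x < V \<omega>} + prob (space M - G)"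
      using G(1) by (intro measure_Un_le) auto
    finally have 1: "prob {\<omega> \<in> space M. a < S \<omega>} \<le> prob {\<omega> \<in> space M. x < V \<omega>} + \<rho>" using G' by simp
    have "1 - Phi (a + 3 * d) = (LINT z|std_normal. indicator {a + 3 * d..} z)"
      using measure_std_normal_atLeast by simp
    also have "\<dots> \<le> (LINT z|std_normal. spline ((z - a) / d))"
      by (intro integral_mono iN sl N.integrable_const_bound[of _ 1]) auto
    also have "\<dots> \<le> expectation (\<lambda>\<omega>. spline ((S \<omega> - a) / d)) + 9 * C * exp (- l\<^sup>2 / 2)"
      using cmp[of a] t0 \<eta> by (simp add: a_def)
    also have "expectation (\<lambda>\<omega>. spline ((S \<omega> - a) / d)) \<le> expectation (\<lambda>\<omega>. indicator {a<..} (S \<omega>))"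
      by (intro integral_mono iS sl integrable_const_bound[of _ 1]) auto
    also have "\<dots> = prob {\<omega> \<in> space M. a < S \<omega>}"
      using pe by simp
    finally have "1 - Phi (a + 3 * d) \<le> prob {\<omega> \<in> space M. a < S \<omega>} + 9 * C * exp (- l\<^sup>2 / 2)" by simp
    moreover have "Phi (a + 3 * d) - Phi x \<le> 3 * t * exp (- l\<^sup>2 / 2)"
      using tl[of x "a + 3 * d"] t0 t by (simp add: a_def)
    ultimately show ?thesis unfolding R using 1 by simp
  qed
qed

text \<open>The absolute error is at most \<open>exp (- l^2/2) * W n\<close>, while the tail is at
  least \<open>mills * exp (- l^2/2) / (1 + l)\<close>. The exponentials cancel, and the relative
  error is at most \<open>(1 + \<Lambda> n) * W n / mills\<close>, a bound free of
  \<open>x\<close>.\<close>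

theorem (in prob_space) moderate_deviations_perturbed_sum:
  fixes Y V :: "nat \<Rightarrow> 'a \<Rightarrow> real"
  assumes indep: "indep_vars (\<lambda>_. borel) Y UNIV"
    and law: "\<And>i. distr M borel (Y i) = distr M borel (Y 0)"
    and bound: "\<And>i \<omega>. \<bar>Y i \<omega>\<bar> \<le> b"
    and mom: "expectation (Y 0) = 0" "expectation (\<lambda>\<omega>. (Y 0 \<omega>)\<^sup>2) = 1"
    and V: "\<And>n. V n \<in> borel_measurable M"
    and approx: "\<And>p. p > 0 \<Longrightarrow> \<exists>\<eta>. (\<lambda>n. \<eta> n * sqrt (ln (real n))) \<longlonglongrightarrow> 0 \<and>
      (\<forall>\<^sub>F n in sequentially. \<eta> n \<ge> 0 \<and> (\<exists>G\<in>events. prob G \<ge> 1 - real n powr - p \<and>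
         (\<forall>\<omega>\<in>G. \<bar>V n \<omega> - (\<Sum>i<n. Y i \<omega>) / sqrt n\<bar> \<le> \<eta> n)))"
    and cc: "cc > 0" and e: "e > 0"
  shows "\<forall>\<^sub>F n in sequentially. \<forall>x \<le> cc * sqrt (ln (real n)).
    \<bar>prob {\<omega> \<in> space M. x < V n \<omega>} / (1 - Phi x) - 1\<bar> \<le> e \<and>
    \<bar>prob {\<omega> \<in> space M. x \<le> V n \<omega>} / (1 - Phi x) - 1\<bar> \<le> e"
proof -
  define b' where "b' = max b 1"
  have bound': "\<bar>Y i \<omega>\<bar> \<le> b'" for i \<omega> using bound[of i \<omega>] by (simp add: b'_def)
  have b': "b' \<ge> 1" by (simp add: b'_def)
  \<comment> \<open>The Gaussian factor at the right end of the range is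
    \<open>n powr (- cc^2/2)\<close>; the additional 1 makes the exceptional probability smaller
    than it by a factor \<open>1 / n\<close>.\<close>
  define p where "p = cc\<^sup>2 / 2 + 1"
  have "p > 0" using cc by (simp add: p_def add_nonneg_pos)
  from approx[OF this] obtain \<eta> where \<eta>: "(\<lambda>n. \<eta> n * sqrt (ln (real n))) \<longlonglongrightarrow> 0"
    and G: "\<forall>\<^sub>F n in sequentially. \<eta> n \<ge> 0 \<and> (\<exists>G\<in>events. prob G \<ge> 1 - real n powr - p \<and>
         (\<forall>\<omega>\<in>G. \<bar>V n \<omega> - (\<Sum>i<n. Y i \<omega>) / sqrt n\<bar> \<le> \<eta> n))" by auto
  define \<Lambda> where "\<Lambda> n = cc * sqrt (ln (real n))" for n :: nat
  \<comment> \<open>The smoothing scale is \<open>1 / ln n\<close>: negligible against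
    \<open>1 / sqrt (ln n)\<close>, yet its inverse cube is only a power of the logarithm.\<close>
  define \<theta> where "\<theta> n = \<eta> n + 3 * (1 / ln (real n))" for n
  define K where "K = 12 * (3 * b'^3 + cubic_exp_moment)"
  \<comment> \<open>The three terms are displacement, replacement error and exceptional event, each
    with \<open>exp (- l^2/2)\<close> factored out.\<close>
  define W where "W n = 3 * \<theta> n + K * (ln (real n) ^ 3 / sqrt n) + 1 / real n" for n
  have L\<theta>: "(\<lambda>n. \<Lambda> n * \<theta> n) \<longlonglongrightarrow> 0"
  proof -
    have "(\<lambda>n. cc * (\<eta> n * sqrt (ln (real n))) + 3 * cc * (sqrt (ln (real n)) * (1 / ln (real n)))) \<longlonglongrightarrow> cc * 0 + 3 * cc * 0"
      by (intro tendsto_intros \<eta>) real_asymp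
    then show ?thesis by (simp add: \<Lambda>_def \<theta>_def algebra_simps)
  qed
  have \<theta>0: "\<theta> \<longlonglongrightarrow> 0"
  proof -
    have "(\<lambda>n. (\<Lambda> n * \<theta> n) * (1 / (cc * sqrt (ln (real n))))) \<longlonglongrightarrow> 0 * 0"
      using cc by (intro tendsto_mult L\<theta>) real_asymp
    then have z: "(\<lambda>n. (\<Lambda> n * \<theta> n) * (1 / (cc * sqrt (ln (real n))))) \<longlonglongrightarrow> 0" by simp
    show ?thesis
    proof (rule Lim_transform_eventually[OF z])
      show "\<forall>\<^sub>F n in sequentially. (\<Lambda> n * \<theta> n) * (1 / (cc * sqrt (ln (real n)))) = \<theta> n"
        using eventually_gt_at_top[of 2]
        by eventually_elim (use cc in \<open>simp add: \<Lambda>_def\<close>)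
    qed
  qed
  have W: "(\<lambda>n. (1 + \<Lambda> n) * W n) \<longlonglongrightarrow> 0"
  proof -
    have "(\<lambda>n. 3 * \<theta> n + 3 * (\<Lambda> n * \<theta> n) + K * ((1 + cc * sqrt (ln (real n))) * (ln (real n) ^ 3 / sqrt n))
        + (1 + cc * sqrt (ln (real n))) * (1 / real n)) \<longlonglongrightarrow> 3 * 0 + 3 * 0 + K * 0 + 0"
    proof (intro tendsto_intros \<theta>0 L\<theta>)
      show "(\<lambda>n. (1 + cc * sqrt (ln (real n))) * (ln (real n) ^ 3 / sqrt n)) \<longlonglongrightarrow> 0"
        using cc by real_asymp
      show "(\<lambda>n. (1 + cc * sqrt (ln (real n))) * (1 / real n)) \<longlonglongrightarrow> 0"
        using cc by real_asymp
    qed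
    then show ?thesis by (simp add: W_def \<Lambda>_def algebra_simps)
  qed
  have l1: "(\<lambda>n. \<Lambda> n * b' / sqrt (real n)) \<longlonglongrightarrow> 0"
  proof -
    have "(\<lambda>n. cc * b' * (sqrt (ln (real n)) / sqrt (real n))) \<longlonglongrightarrow> cc * b' * 0"
      by (intro tendsto_intros) real_asymp
    then show ?thesis by (simp add: \<Lambda>_def mult_ac)
  qed
  have l2: "(\<lambda>n. (\<Lambda> n)^3 * b'^3 / sqrt (real n)) \<longlonglongrightarrow> 0"
  proof -
    have "(\<lambda>n. (cc * b')^3 * (sqrt (ln (real n)) ^ 3 / sqrt (real n))) \<longlonglongrightarrow> (cc * b')^3 * 0"
      by (intro tendsto_intros) real_asymp
    then show ?thesis by (simp add: \<Lambda>_def power_mult_distrib mult_ac)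
  qed
  have me: "e * mills > 0" using e mills_pos by simp
  show ?thesis
    using G eventually_gt_at_top[of 2] order_tendstoD(2)[OF W me] order_tendstoD(2)[OF L\<theta> zero_less_one]
      order_tendstoD(2)[OF l1 zero_less_one] order_tendstoD(2)[OF l2 zero_less_one]
  proof eventually_elim
    case (elim n)
    have n: "real n > 0" "ln (real n) > 0" using elim(2) by auto
    obtain G where G: "G \<in> events" "prob G \<ge> 1 - real n powr - p"
      "\<And>\<omega>. \<omega> \<in> G \<Longrightarrow> \<bar>V n \<omega> - (\<Sum>i<n. Y i \<omega>) / sqrt n\<bar> \<le> \<eta> n" using elim(1) by blast
    have \<eta>0: "\<eta> n \<ge> 0" using elim(1) by blast
    have \<theta>n: "\<theta> n \<ge> 0" using \<eta>0 n by (simp add: \<theta>_def)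
    have W0: "W n \<ge> 0" unfolding W_def K_def using \<theta>n n b' cubic_exp_moment_nonneg by simp
    show ?case
    proof (intro allI impI)
      fix x assume x: "x \<le> cc * sqrt (ln (real n))"
      define l where "l = max x 0"
      have l: "l \<ge> 0" "l \<le> \<Lambda> n" using x cc n by (auto simp: l_def \<Lambda>_def)
      have c1: "l * b' \<le> sqrt n"
      proof -
        have "l * b' \<le> \<Lambda> n * b'" using l b' by (intro mult_right_mono) auto
        then show ?thesis using elim(5) n by (simp add: field_simps)
      qed
      have c2: "l^3 * b'^3 \<le> sqrt n"
      proof -
        have "l^3 * b'^3 \<le> (\<Lambda> n)^3 * b'^3" using l b' by (intro mult_right_mono power_mono) auto
        then show ?thesis using elim(6) n by (simp add: field_simps)
      qed
      have c3: "l * \<theta> n \<le> 1"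
        using mult_right_mono[OF l(2) \<theta>n] elim(4) by linarith
      define R where "R = exp (- l\<^sup>2 / 2) * (3 * \<theta> n + 12 * (3 * b'^3 + cubic_exp_moment) / ((1 / ln n)^3 * sqrt n)) + real n powr - p"
      have main: "prob {\<omega> \<in> space M. x \<le> V n \<omega>} \<le> 1 - Phi x + R" "1 - Phi x - R \<le> prob {\<omega> \<in> space M. x < V n \<omega>}"
        unfolding R_def
        by (rule perturbed_sum_normal_approx[OF indep law bound' b' mom l_def _ c1 c2 _ \<eta>0 _ c3 V G];
            use n elim(2) in \<open>simp add: \<theta>_def\<close>)+
      have "real n powr - p \<le> exp (- l\<^sup>2 / 2) * (1 / real n)"
      proof -
        have "l\<^sup>2 \<le> (\<Lambda> n)\<^sup>2" using l by (intro power_mono) auto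
        then have l2: "l\<^sup>2 \<le> cc\<^sup>2 * ln (real n)" using n by (simp add: \<Lambda>_def power_mult_distrib)
        have "real n powr - p = exp (- p * ln (real n))" using n by (simp add: powr_def)
        also have "\<dots> \<le> exp (- l\<^sup>2 / 2 + - ln (real n))" using l2 by (simp add: p_def algebra_simps)
        also have "\<dots> = exp (- l\<^sup>2 / 2) * (1 / real n)" using n by (simp only: exp_add exp_minus exp_ln inverse_eq_divide)
        finally show ?thesis .
      qed
      then have R: "R \<le> exp (- l\<^sup>2 / 2) * W n"
        unfolding R_def W_def K_def by (simp add: power_divide field_simps)
      define q where "q = 1 - Phi x"
      have q: "q \<ge> mills * exp (- l\<^sup>2 / 2) / (1 + l)" unfolding q_def l_def by (rule normal_tail_ge)
      have "(1 + l) * W n \<le> (1 + \<Lambda> n) * W n" using l W0 by (intro mult_right_mono) auto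
      then have "W n \<le> e * mills / (1 + l)" using elim(3) l by (simp add: field_simps)
      then have "exp (- l\<^sup>2 / 2) * W n \<le> exp (- l\<^sup>2 / 2) * (e * mills / (1 + l))" by (intro mult_left_mono) auto
      also have "\<dots> = e * (mills * exp (- l\<^sup>2 / 2) / (1 + l))" by simp
      also have "\<dots> \<le> e * q" using q e by (intro mult_left_mono) auto
      finally have Rq: "R \<le> e * q" using R by simp
      have q0: "q > 0" using q mills_pos l by (smt (verit) divide_pos_pos exp_gt_zero mult_pos_pos)
      have mono: "prob {\<omega> \<in> space M. x < V n \<omega>} \<le> prob {\<omega> \<in> space M. x \<le> V n \<omega>}"
        using V[of n] by (intro finite_measure_mono) auto
      have fin: "\<bar>P / q - 1\<bar> \<le> e" if "\<bar>P - q\<bar> \<le> e * q" for P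
      proof -
        have "P / q - 1 = (P - q) / q" using q0 by (simp add: field_simps)
        then show ?thesis using that q0 by (simp add: field_simps)
      qed
      show "\<bar>prob {\<omega> \<in> space M. x < V n \<omega>} / (1 - Phi x) - 1\<bar> \<le> e \<and>
        \<bar>prob {\<omega> \<in> space M. x \<le> V n \<omega>} / (1 - Phi x) - 1\<bar> \<le> e"
        unfolding q_def[symmetric]
        by (intro conjI fin) (use main mono Rq in \<open>auto simp: q_def\<close>)
    qed
  qed
qed

section \<open>Quantiles and order statistics\<close>

context cdf_distribution
begin

lemma quantile_eq_Inf: "0 < u \<Longrightarrow> quantile C u = Inf {x. u \<le> C x}"
  by (simp add: quantile_def)

text \<open>The Galois connection between a distribution function and its left-continuous inverse.
  Level 1 is excluded because the set defining the infimum may then be empty, and nonpositive levels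
  because it is then the whole line.\<close>

lemma quantile_le_iff: "0 < u \<Longrightarrow> u < 1 \<Longrightarrow> quantile C u \<le> x \<longleftrightarrow> u \<le> C x"
  using pseudoinverse[of u x] by (simp add: quantile_eq_Inf)

lemma less_quantile_iff: "0 < u \<Longrightarrow> u < 1 \<Longrightarrow> x < quantile C u \<longleftrightarrow> C x < u"
  using quantile_le_iff[of u x] by linarith

lemma quantile_mono: "0 < u \<Longrightarrow> u \<le> v \<Longrightarrow> v < 1 \<Longrightarrow> quantile C u \<le> quantile C v"
  using quantile_le_iff[of u "quantile C v"] quantile_le_iff[of v "quantile C v"] by simp

text \<open>A band of levels has as preimage an interval closed on the left and open on the right,
  even if \<open>C\<close> has jumps or flat pieces. Hence its length is exactly an increment of the
  quantile function.\<close>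

lemma cdf_between_iff:
  "0 < u \<Longrightarrow> u < 1 \<Longrightarrow> 0 < v \<Longrightarrow> v < 1 \<Longrightarrow> {x. u \<le> C x \<and> C x < v} = {quantile C u..<quantile C v}"
  using quantile_le_iff less_quantile_iff by auto

lemma quantile_left_continuous:
  assumes "0 < u" "u < 1"
  shows "continuous (at_left u) (quantile C)"
  unfolding continuous_within
proof (rule tendstoI)
  fix e :: real assume "e > 0"
  define x where "x = quantile C u - e"
  have "C x < u" using \<open>e > 0\<close> assms less_quantile_iff[of u x] by (simp add: x_def)
  then have "max (C x) 0 < u" using assms by simp
  then have "\<forall>\<^sub>F v in at_left u. v \<in> {max (C x) 0<..<u}"
    by (intro eventually_at_leftI[of "max (C x) 0"]) auto
  then show "\<forall>\<^sub>F v in at_left u. dist (quantile C v) (quantile C u) < e"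
  proof eventually_elim
    case (elim v)
    then have "x < quantile C v" using assms less_quantile_iff[of v x] by auto
    moreover have "quantile C v \<le> quantile C u" using elim assms by (intro quantile_mono) auto
    ultimately show ?case by (auto simp: x_def dist_real_def)
  qed
qed

text \<open>The values of \<open>interval_measure\<close> on half-open intervals are available for
  nondecreasing right-continuous functions; reflecting the argument turns left limits of the
  quantile function into the required right limits.\<close>

lemma clamped_quantile_right_continuous:
  assumes ab: "0 < a" "a \<le> b" "b < 1"
  shows "continuous (at_right t) (\<lambda>t. - quantile C (max a (min b (- t))))"
proof -
  let ?g = "\<lambda>v. quantile C (max a (min b v))"
  have g: "(?g \<longlongrightarrow> ?g v) (at_left v)" for v
  proof -
    consider "v \<le> a" | "a < v" "v \<le> b" | "b < v" using ab by linarith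
    then show ?thesis
    proof cases
      case 1
      have "\<forall>\<^sub>F w in at_left v. w < v" unfolding eventually_at_filter by simp
      then have "\<forall>\<^sub>F w in at_left v. ?g w = ?g v"
        by eventually_elim (use 1 ab in auto)
      then show ?thesis by (rule tendsto_eventually)
    next
      case 2
      have "\<forall>\<^sub>F w in at_left v. w \<in> {a<..<v}" using 2 by (intro eventually_at_leftI[of a]) auto
      then have ev: "\<forall>\<^sub>F w in at_left v. quantile C w = ?g w"
        by eventually_elim (use 2 in auto)
      have "(quantile C \<longlongrightarrow> quantile C v) (at_left v)"
        using quantile_left_continuous[of v] 2 ab by (simp add: continuous_within)
      then have "(?g \<longlongrightarrow> quantile C v) (at_left v)"
        by (rule Lim_transform_eventually[OF _ ev])
      then show ?thesis using 2 by simp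
    next
      case 3
      have "\<forall>\<^sub>F w in at_left v. w \<in> {b<..<v}" using 3 by (intro eventually_at_leftI[of b]) auto
      then have "\<forall>\<^sub>F w in at_left v. ?g w = ?g v"
        by eventually_elim (use 3 in auto)
      then show ?thesis by (rule tendsto_eventually)
    qed
  qed
  have "filterlim uminus (at_left (- t)) (at_right t)"
    by (simp add: at_right_minus[of t] filterlim_def filtermap_filtermap)
  from filterlim_compose[OF g this] show ?thesis
    unfolding continuous_within by (intro tendsto_minus) simp
qed

text \<open>After reflection both measures are compared on intervals \<open>{s<..t}\<close>. The
  pushed-forward Lebesgue measure of such an interval is the length of a band of levels, and by
  \<open>cdf_between_iff\<close> that length is a quantile increment.\<close>

lemma lstieltjes_quantile:
  assumes ab: "0 < a" "a \<le> b" "b < 1"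
  shows "lstieltjes (quantile C) a b = distr (density lborel (indicator {quantile C a..<quantile C b})) borel C"
proof -
  let ?D = "{quantile C a..<quantile C b}"
  define cl where "cl t = max a (min b t)" for t
  have cl: "a \<le> cl t" "cl t \<le> b" "0 < cl t" "cl t < 1" for t using ab by (auto simp: cl_def)
  define G where "G t = - quantile C (max a (min b (- t)))" for t
  have Gm: "G x \<le> G y" if "x \<le> y" for x y
    unfolding G_def neg_le_iff_le using that ab by (intro quantile_mono) auto
  have Gc: "continuous (at_right x) G" for x
    unfolding G_def using clamped_quantile_right_continuous[OF ab] .
  define N where "N = distr (density lborel (indicator ?D)) borel (\<lambda>x. - C x)"
  have N: "emeasure N {s<..t} = ennreal (G t - G s)" if "s \<le> t" for s t
  proof -
    have "emeasure N {s<..t} = emeasure lborel (?D \<inter> ((\<lambda>x. - C x) -` {s<..t}))"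
    proof -
      have "(\<lambda>x. - C x) -` {s<..t} \<in> sets borel"
        using measurable_sets_borel[of "\<lambda>x. - C x" borel "{s<..t}"] by simp
      then show ?thesis unfolding N_def by (subst emeasure_distr) (simp_all add: emeasure_restricted)
    qed
    also have "?D \<inter> ((\<lambda>x. - C x) -` {s<..t}) = {x. cl (- t) \<le> C x \<and> C x < cl (- s)}"
    proof -
      have D: "?D = {x. a \<le> C x \<and> C x < b}" using ab by (intro cdf_between_iff[symmetric]) auto
      \<comment> \<open>Restricting to the window of levels amounts to clamping the endpoints of the
        band; if the band misses the window, the clamped endpoints coincide and both sides
        fail.\<close>
      have E: "(a \<le> c \<and> c < b) \<and> s < - c \<and> - c \<le> t \<longleftrightarrow> cl (- t) \<le> c \<and> c < cl (- s)" for c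
        unfolding cl_def max.bounded_iff min_le_iff_disj less_max_iff_disj min_less_iff_conj
        using ab that by argo
      show ?thesis unfolding D
        by (intro set_eqI) (simp only: Int_iff vimage_eq mem_Collect_eq greaterThanAtMost_iff E)
    qed
    also have "\<dots> = {quantile C (cl (- t))..<quantile C (cl (- s))}" by (rule cdf_between_iff) (use cl in auto)
    also have "emeasure lborel \<dots> = ennreal (quantile C (cl (- s)) - quantile C (cl (- t)))"
      using cl that by (intro emeasure_lborel_Ico quantile_mono) (auto simp: cl_def)
    finally show ?thesis by (simp add: G_def cl_def)
  qed
  have "interval_measure G = N"
  proof (rule measure_eqI_generator_eq[where \<Omega>=UNIV and E="range (\<lambda>(s, t). {s<..t::real})" and A="\<lambda>i. {- real i<..real i}"])
    show "Int_stable (range (\<lambda>(s, t). {s<..t::real}))"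
      by (auto simp: Int_stable_def intro!: image_eqI[where x="(max a b, min c d)" for a b c d])
    show "emeasure (interval_measure G) X = emeasure N X" if Xr: "X \<in> range (\<lambda>(s, t). {s<..t::real})" for X
    proof -
      obtain s t where X: "X = {s<..t}" using Xr by auto
      show ?thesis
      proof (cases "s \<le> t")
        case True
        then show ?thesis unfolding X by (subst N) (auto intro!: emeasure_interval_measure_Ioc Gm Gc)
      qed (simp add: X)
    qed
    show "sets (interval_measure G) = sigma_sets UNIV (range (\<lambda>(s, t). {s<..t::real}))"
      by (simp add: borel_sigma_sets_Ioc)
    show "sets N = sigma_sets UNIV (range (\<lambda>(s, t). {s<..t::real}))"
      by (simp add: N_def borel_sigma_sets_Ioc)
    show "emeasure (interval_measure G) {- real i<..real i} \<noteq> \<infinity>" for i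
      by (subst emeasure_interval_measure_Ioc) (auto intro!: Gm Gc)
  qed (auto simp: UN_Ioc_eq_UNIV)
  then have "lstieltjes (quantile C) a b = distr N borel uminus"
    unfolding lstieltjes_def G_def by simp
  then show ?thesis unfolding N_def by (simp add: distr_distr comp_def)
qed

end

text \<open>Sorting preserves the number of entries at most \<open>y\<close>, and in the sorted list
  these entries form an initial segment. The shift between \<open>i\<close> and \<open>i - 1\<close>
  reflects that order statistics are counted from 1 and list positions from 0.\<close>

lemma order_stat_le_iff:
  assumes i: "1 \<le> i" "i \<le> n"
  shows "order_stat x n i \<le> y \<longleftrightarrow> i \<le> card {j \<in> {..<n}. x j \<le> y}"
proof -
  define s where "s = sort (map x [0..<n])"
  have s: "sorted s" "length s = n" by (auto simp: s_def)
  have "card {j \<in> {..<n}. x j \<le> y} = length (filter (\<lambda>z. z \<le> y) (map x [0..<n]))"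
    unfolding length_filter_conv_card by (intro arg_cong[where f=card]) auto
  also have "\<dots> = length (filter (\<lambda>z. z \<le> y) s)"
    by (rule mset_eq_length) (simp only: mset_filter s_def mset_sort)
  also have "\<dots> = card {j. j < n \<and> s ! j \<le> y}" unfolding length_filter_conv_card s(2) ..
  finally have c: "card {j \<in> {..<n}. x j \<le> y} = card {j. j < n \<and> s ! j \<le> y}" .
  show ?thesis
  proof
    assume "order_stat x n i \<le> y"
    then have "s ! (i - 1) \<le> y" by (simp add: order_stat_def s_def)
    moreover have "s ! j \<le> s ! (i - 1)" if "j < i" for j
      using that i s by (intro sorted_nth_mono) auto
    ultimately have "{..<i} \<subseteq> {j. j < n \<and> s ! j \<le> y}"
      using i by (fastforce intro: order_trans)
    from card_mono[OF _ this] show "i \<le> card {j \<in> {..<n}. x j \<le> y}" unfolding c by simp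
  next
    assume a: "i \<le> card {j \<in> {..<n}. x j \<le> y}"
    show "order_stat x n i \<le> y"
    proof (rule ccontr)
      assume "\<not> order_stat x n i \<le> y"
      then have "y < s ! (i - 1)" by (simp add: order_stat_def s_def)
      moreover have "s ! (i - 1) \<le> s ! j" if "i - 1 \<le> j" "j < n" for j
        using that s by (intro sorted_nth_mono) auto
      ultimately have "j < i - 1" if "j < n" "s ! j \<le> y" for j
        using that by (meson leD le_less_trans not_le order_trans)
      then have "{j. j < n \<and> s ! j \<le> y} \<subseteq> {..<i - 1}" by auto
      from card_mono[OF _ this] a c i show False by simp
    qed
  qed
qed

lemma borel_measurable_order_stat:
  assumes i: "1 \<le> i" "i \<le> n" and X: "\<And>j. X j \<in> borel_measurable M"
  shows "(\<lambda>\<omega>. order_stat (\<lambda>j. X j \<omega>) n i) \<in> borel_measurable M"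
proof (rule borel_measurableI_le)
  fix y
  have "{\<omega> \<in> space M. order_stat (\<lambda>j. X j \<omega>) n i \<le> y} = {\<omega> \<in> space M. real i \<le> (\<Sum>j<n. indicator {..y} (X j \<omega>))}"
  proof -
    have "(\<Sum>j<n. indicator {..y} (X j \<omega>)) = real (card {j \<in> {..<n}. X j \<omega> \<le> y})" for \<omega>
      by (simp add: indicator_def sum.If_cases Int_def)
    then show ?thesis using order_stat_le_iff[OF i] by auto
  qed
  also have "\<dots> \<in> sets M" using X by measurable
  finally show "{\<omega> \<in> space M. order_stat (\<lambda>j. X j \<omega>) n i \<le> y} \<in> sets M" .
qed

section \<open>Linearization of the trimmed statistic\<close>

abbreviation clamp_to :: "real \<Rightarrow> real \<Rightarrow> real \<Rightarrow> real" where
  "clamp_to a b u \<equiv> max a (min b u)"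

text \<open>The mean value bound is applied to \<open>u \<mapsto> K u - J p * u\<close>, whose
  derivative \<open>J u - J p\<close> is at most \<open>C * \<bar>q - p\<bar>\<close> between
  \<open>p\<close> and \<open>q\<close>.\<close>

lemma primitive_taylor:
  fixes K J :: "real \<Rightarrow> real"
  assumes K: "\<And>u. u \<in> {lo..hi} \<Longrightarrow> (K has_real_derivative J u) (at u within {lo..hi})"
    and J: "C-lipschitz_on {lo..hi} J" and pq: "p \<in> {lo..hi}" "q \<in> {lo..hi}"
  shows "\<bar>K q - K p - J p * (q - p)\<bar> \<le> C * (q - p)\<^sup>2"
proof -
  have C: "C \<ge> 0" using J by (rule lipschitz_on_nonneg)
  let ?S = "{min p q..max p q}"
  have sub: "?S \<subseteq> {lo..hi}" using pq by auto
  have "norm ((K q - J p * q) - (K p - J p * p)) \<le> (C * \<bar>q - p\<bar>) * norm (q - p)"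
  proof (rule field_differentiable_bound)
    show "convex ?S" by simp
    fix z assume z: "z \<in> ?S"
    show "((\<lambda>u. K u - J p * u) has_field_derivative (J z - J p)) (at z within ?S)"
      using z sub by (auto intro!: derivative_eq_intros DERIV_subset[OF K sub])
    have "\<bar>J z - J p\<bar> \<le> C * \<bar>z - p\<bar>" using lipschitz_onD[OF J subsetD[OF sub z] pq(1)] by (simp add: dist_real_def)
    also have "\<dots> \<le> C * \<bar>q - p\<bar>" using z C by (intro mult_left_mono) auto
    finally show "norm (J z - J p) \<le> C * \<bar>q - p\<bar>" by simp
  qed auto
  then show ?thesis by (simp add: power2_eq_square algebra_simps flip: abs_mult)
qed

lemma primitive_lipschitz:
  fixes K J :: "real \<Rightarrow> real"
  assumes K: "\<And>u. u \<in> {lo..hi} \<Longrightarrow> (K has_real_derivative J u) (at u within {lo..hi})"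
    and J: "\<And>u. u \<in> {lo..hi} \<Longrightarrow> \<bar>J u\<bar> \<le> B" and pq: "p \<in> {lo..hi}" "q \<in> {lo..hi}"
  shows "\<bar>K q - K p\<bar> \<le> B * \<bar>q - p\<bar>"
proof -
  have "norm (K q - K p) \<le> B * norm (q - p)"
    by (rule field_differentiable_bound[of "{lo..hi}"]) (use assms in auto)
  then show ?thesis by simp
qed

lemma clamp_to_diff: "\<bar>clamp_to a b q - clamp_to a b p\<bar> \<le> \<bar>q - p\<bar>"
  by (simp add: max_def min_def)

text \<open>The margin \<open>2 * r\<close> has one \<open>r\<close> for the distance between the
  actual clamps and their limits and one for the distance between \<open>p\<close> and
  \<open>q\<close>. Beyond it, \<open>p\<close> and \<open>q\<close> lie on the same side of both
  clamps, so the increment is either fully clamped and zero or unclamped and covered by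
  \<open>primitive_taylor\<close>. Inside the margin both the increment and its linear term are
  merely bounded by \<open>B * r\<close>.\<close>

lemma trimmed_increment_bound:
  fixes K J :: "real \<Rightarrow> real"
  assumes K: "\<And>u. u \<in> {lo..hi} \<Longrightarrow> (K has_real_derivative J u) (at u within {lo..hi})"
    and J: "C-lipschitz_on {lo..hi} J" and B: "\<And>u. u \<in> {lo..hi} \<Longrightarrow> \<bar>J u\<bar> \<le> B"
    and r: "r \<ge> 0" "lo \<le> al - 2 * r" "al + 2 * r \<le> bl - 2 * r" "bl + 2 * r \<le> hi"
    and ab: "\<bar>a - al\<bar> \<le> r" "\<bar>b - bl\<bar> \<le> r" and pq: "\<bar>q - p\<bar> \<le> r"
  shows "\<bar>K (clamp_to a b q) - K (clamp_to a b p) - indicator {al..<bl} p * J p * (q - p)\<bar>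
    \<le> C * r\<^sup>2 + 2 * B * r * (indicator {al - 2 * r..<al + 2 * r} p + indicator {bl - 2 * r..<bl + 2 * r} p)"
proof -
  have C: "C \<ge> 0" using J by (rule lipschitz_on_nonneg)
  have "lo \<in> {lo..hi}" using r by auto
  then have B0: "B \<ge> 0" using B[of lo] by (meson abs_ge_zero order_trans)
  have rhs: "0 \<le> C * r\<^sup>2" "0 \<le> 2 * B * r" using C B0 r by auto
  have rhs0: "0 \<le> 2 * B * r * (indicator {al - 2 * r..<al + 2 * r} p + indicator {bl - 2 * r..<bl + 2 * r} p)"
    using rhs by (intro mult_nonneg_nonneg[OF rhs(2)]) auto
  have ab': "a \<le> b" "al - r \<le> a" "a \<le> al + r" "bl - r \<le> b" "b \<le> bl + r" using r ab by linarith+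
  have "lo \<le> a" "b \<le> hi" "a \<le> hi" using r ab' by linarith+
  then have cl: "clamp_to a b u \<in> {lo..hi}" for u by (simp add: le_max_iff_disj min_le_iff_disj)
  consider "p < al - 2 * r \<or> p \<ge> bl + 2 * r" | "al + 2 * r \<le> p \<and> p < bl - 2 * r"
    | "(al - 2 * r \<le> p \<and> p < al + 2 * r) \<or> (bl - 2 * r \<le> p \<and> p < bl + 2 * r)" by linarith
  then show ?thesis
  proof cases
    case 1
    have "(p \<le> a \<and> q \<le> a) \<or> (b \<le> p \<and> b \<le> q)" using 1 r ab' pq by linarith
    then have "clamp_to a b q = clamp_to a b p" using ab' by (elim disjE) simp_all
    moreover have "\<not> (al \<le> p \<and> p < bl)" using 1 r by linarith
    then have "indicator {al..<bl} p = (0::real)" by simp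
    ultimately show ?thesis using rhs rhs0 by simp
  next
    case 2
    have "a \<le> p" "p \<le> b" "a \<le> q" "q \<le> b" using 2 r ab' pq by linarith+
    then have e: "clamp_to a b q = q" "clamp_to a b p = p" by simp_all
    have "al \<le> p \<and> p < bl" using 2 r by linarith
    then have i: "indicator {al..<bl} p = (1::real)" by simp
    have m: "p \<in> {lo..hi}" "q \<in> {lo..hi}" using cl[of p] cl[of q] e by auto
    have "\<bar>K q - K p - J p * (q - p)\<bar> \<le> C * (q - p)\<^sup>2" by (rule primitive_taylor[OF K J m])
    also have "\<dots> \<le> C * r\<^sup>2" using C pq r by (intro mult_left_mono) (auto simp: abs_le_square_iff[symmetric])
    finally show ?thesis unfolding e i using rhs0 by simp
  next
    case 3
    have i: "1 \<le> (indicator {al - 2 * r..<al + 2 * r} p + indicator {bl - 2 * r..<bl + 2 * r} p :: real)"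
      using 3 by auto
    have "\<bar>K (clamp_to a b q) - K (clamp_to a b p)\<bar> \<le> B * \<bar>clamp_to a b q - clamp_to a b p\<bar>"
      by (rule primitive_lipschitz[OF K B cl cl])
    also have "\<dots> \<le> B * \<bar>q - p\<bar>" using B0 by (intro mult_left_mono) (simp_all add: clamp_to_diff)
    also have "\<dots> \<le> B * r" using B0 pq by (intro mult_left_mono)
    finally have 1: "\<bar>K (clamp_to a b q) - K (clamp_to a b p)\<bar> \<le> B * r" .
    have 2: "\<bar>indicator {al..<bl} p * J p * (q - p)\<bar> \<le> B * r"
    proof (cases "p \<in> {al..<bl}")
      case True
      then have "\<bar>J p\<bar> \<le> B" using r by (intro B) auto
      then show ?thesis using True pq B0 by (simp add: abs_mult mult_mono)
    qed (use B0 r in auto)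
    have "\<bar>K (clamp_to a b q) - K (clamp_to a b p) - indicator {al..<bl} p * J p * (q - p)\<bar> \<le> B * r + B * r"
      by (rule order_trans[OF abs_triangle_ineq4 add_mono[OF 1 2]])
    also have "\<dots> = 2 * B * r * 1" by simp
    also have "\<dots> \<le> 2 * B * r * (indicator {al - 2 * r..<al + 2 * r} p + indicator {bl - 2 * r..<bl + 2 * r} p)"
      by (intro mult_left_mono i rhs)
    finally show ?thesis using rhs(1) by (rule order_trans[OF _ add_increasing[OF _ order_refl]])
  qed
qed

text \<open>The indicator is written as a function of \<open>y\<close>, so that the empirical
  distribution function is a sum of fixed functions of \<open>y\<close> matching the integrand of
  \<open>influence\<close>.\<close>

definition emp_cdf :: "(nat \<Rightarrow> real) \<Rightarrow> nat \<Rightarrow> real \<Rightarrow> real" where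
  "emp_cdf x n y = (\<Sum>j<n. indicator {x j..} y) / n"

lemma emp_cdf_eq_card: "real n * emp_cdf x n y = real (card {j \<in> {..<n}. x j \<le> y})"
  by (cases "n = 0") (simp_all add: emp_cdf_def indicator_def sum.If_cases Int_def)

lemma borel_measurable_emp_cdf[measurable]: "emp_cdf x n \<in> borel_measurable borel"
  unfolding emp_cdf_def by measurable

lemma less_order_stat_iff:
  assumes "1 \<le> i" "i \<le> n"
  shows "y < order_stat x n i \<longleftrightarrow> emp_cdf x n y < i / n"
proof -
  have "y < order_stat x n i \<longleftrightarrow> real n * emp_cdf x n y < real i"
    using order_stat_le_iff[OF assms, of x y] by (simp add: emp_cdf_eq_card not_le[symmetric])
  then show ?thesis using assms by (simp add: field_simps)
qed

text \<open>Applied with \<open>z\<close> an order statistic and with \<open>z\<close> a quantile,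
  this turns the statistic and its centering into integrals over the same window.\<close>

lemma layer_cake:
  fixes z a b :: real
  assumes "a \<le> z" "z \<le> b"
  shows "has_bochner_integral lborel (\<lambda>y. indicator {a..<b} y * indicator {y. y < z} y) (z - a)"
proof -
  have "(\<lambda>y. indicator {a..<b} y * indicator {y. y < z} y :: real) = indicator {a..<z}"
    using assms by (auto simp: fun_eq_iff indicator_def)
  moreover have "has_bochner_integral lborel (indicator {a..<z} :: real \<Rightarrow> real) (measure lborel {a..<z})"
    using assms by (intro has_bochner_integral_real_indicator) (auto simp: emeasure_lborel_Ico)
  ultimately show ?thesis using assms by simp
qed

text \<open>With \<open>p = j / n\<close> the condition selects the indices above \<open>j\<close>,
  so the sum telescopes from \<open>j\<close>, cut off at \<open>k\<close> and \<open>N\<close>. The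
  clamp records these cut-offs.\<close>

lemma sum_increments_above:
  fixes K :: "real \<Rightarrow> real"
  assumes n: "n \<ge> 1" and kN: "k \<le> N" and p: "real n * p = real j"
  shows "(\<Sum>i\<in>{k+1..N}. (K (i / n) - K ((real i - 1) / n)) * (if p < i / n then 1 else 0))
     = K (N / n) - K (clamp_to (k / n) (N / n) p)"
  using kN
proof (induction N rule: dec_induct)
  case base
  then show ?case by simp
next
  case (step N)
  have p': "p = j / n" using p n by (simp add: field_simps)
  have "{k+1..Suc N} = insert (Suc N) {k+1..N}" using step by auto
  then have s: "(\<Sum>i\<in>{k+1..Suc N}. (K (i / n) - K ((real i - 1) / n)) * (if p < i / n then 1 else 0))
      = (K (Suc N / n) - K (N / n)) * (if p < Suc N / n then 1 else 0) + (K (N / n) - K (clamp_to (k / n) (N / n) p))"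
    using step.IH by simp
  have c: "k / n \<le> N / n" "N / n \<le> Suc N / n" using step by (auto intro!: divide_right_mono)
  show ?case
  proof (cases "j \<le> N")
    case True
    then have "p \<le> N / n" "p < Suc N / n" using n by (auto simp: p' intro!: divide_right_mono divide_strict_right_mono)
    then show ?thesis unfolding s using c by (auto simp: min_absorb2)
  next
    case False
    then have "p \<ge> Suc N / n" using n by (auto simp: p' intro!: divide_right_mono)
    then show ?thesis unfolding s using c by (simp add: min_absorb1 max_absorb2)
  qed
qed

text \<open>Summation by parts in integral form: each order statistic is written by
  \<open>layer_cake\<close>, it exceeds \<open>y\<close> exactly when the empirical distribution
  function at \<open>y\<close> is below \<open>i / n\<close>, and the increments of \<open>K\<close>
  then telescope for fixed \<open>y\<close>. The term with \<open>a\<close> compensates the base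
  point of the layers.\<close>

lemma sum_increments_order_stat:
  fixes K :: "real \<Rightarrow> real"
  assumes n: "n \<ge> 1" and kN: "k \<le> N" "N \<le> n"
    and X: "\<And>i. i \<in> {k+1..N} \<Longrightarrow> a \<le> order_stat x n i \<and> order_stat x n i \<le> b"
  shows "has_bochner_integral lborel
     (\<lambda>y. indicator {a..<b} y * (K (N / n) - K (clamp_to (k / n) (N / n) (emp_cdf x n y))))
     ((\<Sum>i\<in>{k+1..N}. (K (i / n) - K ((real i - 1) / n)) * order_stat x n i) - a * (K (N / n) - K (k / n)))"
proof -
  let ?d = "\<lambda>i. K (real i / n) - K ((real i - 1) / n)"
  have t: "(\<Sum>i\<in>{k+1..N}. ?d i) = K (N / n) - K (k / n)"
    using kN(1) by (induction N rule: dec_induct) (auto simp: atLeastAtMostSuc_conv)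
  have "has_bochner_integral lborel (\<lambda>y. \<Sum>i\<in>{k+1..N}. ?d i * (indicator {a..<b} y * indicator {y. y < order_stat x n i} y))
     (\<Sum>i\<in>{k+1..N}. ?d i * (order_stat x n i - a))"
    using X by (intro has_bochner_integral_sum has_bochner_integral_mult_right layer_cake) auto
  also have "(\<lambda>y. \<Sum>i\<in>{k+1..N}. ?d i * (indicator {a..<b} y * indicator {y. y < order_stat x n i} y))
     = (\<lambda>y. indicator {a..<b} y * (K (N / n) - K (clamp_to (k / n) (N / n) (emp_cdf x n y))))"
  proof
    fix y
    have "(\<Sum>i\<in>{k+1..N}. ?d i * (indicator {a..<b} y * indicator {y. y < order_stat x n i} y))
      = indicator {a..<b} y * (\<Sum>i\<in>{k+1..N}. ?d i * (if emp_cdf x n y < i / n then 1 else 0))"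
      unfolding sum_distrib_left using kN
      by (intro sum.cong refl) (auto simp: less_order_stat_iff indicator_def)
    then show "(\<Sum>i\<in>{k+1..N}. ?d i * (indicator {a..<b} y * indicator {y. y < order_stat x n i} y))
      = indicator {a..<b} y * (K (N / n) - K (clamp_to (k / n) (N / n) (emp_cdf x n y)))"
      using sum_increments_above[OF n kN(1) emp_cdf_eq_card] by simp
  qed
  also have "(\<Sum>i\<in>{k+1..N}. ?d i * (order_stat x n i - a)) = (\<Sum>i\<in>{k+1..N}. ?d i * order_stat x n i) - a * (K (N / n) - K (k / n))"
    unfolding t[symmetric] sum_distrib_left sum_subtractf[symmetric]
    by (intro sum.cong refl) (simp add: algebra_simps)
  finally show ?thesis .
qed

lemma integrable_on_Ico:
  fixes f :: "real \<Rightarrow> real"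
  assumes [measurable]: "f \<in> borel_measurable borel" and B: "\<And>y. y \<in> {a..<b} \<Longrightarrow> \<bar>f y\<bar> \<le> B"
  shows "integrable lborel (\<lambda>y. indicator {a..<b} y * f y)"
proof (rule Bochner_Integration.integrable_bound[of _ "\<lambda>y. B * indicator {a..<b} y"])
  have "emeasure lborel {a..<b} < \<infinity>" by (cases "a \<le> b") auto
  then show "integrable lborel (\<lambda>y. B * indicator {a..<b} y)" by (intro integrable_mult_right) simp
  show "AE y in lborel. norm (indicator {a..<b} y * f y) \<le> norm (B * indicator {a..<b} y)"
    using B by (auto intro!: always_eventually order_trans[OF B abs_ge_self] simp: indicator_def)
qed simp

lemma borel_measurable_indicator_mult_continuous:
  fixes J :: "real \<Rightarrow> real"
  assumes "continuous_on T J" "S \<subseteq> T" "S \<in> sets borel"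
  shows "(\<lambda>u. indicator S u * J u) \<in> borel_measurable borel"
  using borel_measurable_continuous_on_indicator[OF assms(3) continuous_on_subset[OF assms(1,2)]] by simp

lemma integral_Ioo_primitive:
  fixes K J :: "real \<Rightarrow> real"
  assumes K: "\<And>u. u \<in> {lo..hi} \<Longrightarrow> (K has_real_derivative J u) (at u within {lo..hi})"
    and J: "continuous_on {lo..hi} J" and cd: "lo \<le> c" "c \<le> d" "d \<le> hi"
  shows "(LBINT u=c..d. J u) = K d - K c"
    and "has_bochner_integral lborel (\<lambda>u. indicator {c<..<d} u * J u) (K d - K c)"
proof -
  have sub: "{c..d} \<subseteq> {lo..hi}" using cd by auto
  show 1: "(LBINT u=c..d. J u) = K d - K c"
  proof (rule interval_integral_FTC_finite)
    show "continuous_on {min c d..max c d} J" using cd sub by (auto intro: continuous_on_subset[OF J])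
    fix x assume "min c d \<le> x" "x \<le> max c d"
    then have "x \<in> {c..d}" using cd by auto
    then show "(K has_vector_derivative J x) (at x within {min c d..max c d})"
      using cd DERIV_subset[OF K sub, of x] sub
      by (auto simp flip: has_real_derivative_iff_has_vector_derivative)
  qed
  have "set_integrable lborel {c..d} J"
    by (rule borel_integrable_atLeastAtMost') (rule continuous_on_subset[OF J sub])
  then have "set_integrable lborel {c<..<d} J"
    by (rule set_integrable_subset) auto
  then have "integrable lborel (\<lambda>u. indicator {c<..<d} u * J u)"
    by (simp add: set_integrable_def)
  moreover have "(LINT u|lborel. indicator {c<..<d} u * J u) = K d - K c"
    using 1 cd by (simp add: interval_lebesgue_integral_def set_lebesgue_integral_def)
  ultimately show "has_bochner_integral lborel (\<lambda>u. indicator {c<..<d} u * J u) (K d - K c)"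
    by (simp add: has_bochner_integral_iff)
qed

context cdf_distribution
begin

text \<open>The continuous counterpart of \<open>sum_increments_order_stat\<close>: the quantile is
  written in layers, the order of integration is exchanged, and the integral of \<open>J\<close>
  over levels above \<open>C y\<close> is an increment of \<open>K\<close>. Window and compensating
  term agree with the discrete case, so both cancel in the difference.\<close>

lemma integral_J_quantile:
  fixes K J :: "real \<Rightarrow> real"
  assumes K: "\<And>u. u \<in> {lo..hi} \<Longrightarrow> (K has_real_derivative J u) (at u within {lo..hi})"
    and J: "continuous_on {lo..hi} J" and B: "\<And>u. u \<in> {lo..hi} \<Longrightarrow> \<bar>J u\<bar> \<le> B"
    and cd: "0 < lo" "lo \<le> c" "c \<le> d" "d \<le> hi" "hi < 1"
  defines "a \<equiv> quantile C lo" and "b \<equiv> quantile C hi"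
  shows "has_bochner_integral lborel (\<lambda>y. indicator {a..<b} y * (K d - K (clamp_to c d (C y))))
    ((LBINT u=c..d. J u * quantile C u) - a * (K d - K c))"
proof -
  define j where "j u = indicator {c<..<d} u * J u" for u
  have jm[measurable]: "j \<in> borel_measurable borel"
    unfolding j_def by (rule borel_measurable_indicator_mult_continuous[OF J]) (use cd in auto)
  have jB: "\<bar>j u\<bar> \<le> B * indicator {c<..<d} u" for u
    unfolding j_def using B[of u] cd by (auto simp: indicator_def)
  have hj: "has_bochner_integral lborel j (K d - K c)"
    unfolding j_def by (rule integral_Ioo_primitive[OF K J]) (use cd in auto)
  define H where "H u y = j u * (indicator {a..<b} y * indicator {u. C y < u} u)" for u y
  have Hm[measurable]: "case_prod H \<in> borel_measurable (lborel \<Otimes>\<^sub>M lborel)"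
    unfolding H_def by measurable
  have HI: "integrable (lborel \<Otimes>\<^sub>M lborel) (case_prod H)"
  proof (rule Bochner_Integration.integrable_bound)
    have "emeasure (lborel \<Otimes>\<^sub>M lborel) ({c<..<d} \<times> {a..<b}) = emeasure lborel {c<..<d} * emeasure lborel {a..<b}"
      by (rule lborel.emeasure_pair_measure_Times) auto
    also have "\<dots> < \<infinity>" using cd by (cases "a \<le> b") (auto simp: ennreal_mult_less_top)
    finally show "integrable (lborel \<Otimes>\<^sub>M lborel) (\<lambda>p. B * indicator ({c<..<d} \<times> {a..<b}) p)"
      by (intro integrable_mult_right) simp
    show "AE p in lborel \<Otimes>\<^sub>M lborel. norm (case_prod H p) \<le> norm (B * indicator ({c<..<d} \<times> {a..<b}) p)"
    proof (rule always_eventually, clarify)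
      fix u y
      have "\<bar>H u y\<bar> = \<bar>j u\<bar> * (indicator {a..<b} y * indicator {u. C y < u} u)"
        unfolding H_def by (simp add: abs_mult)
      also have "\<dots> \<le> (B * indicator {c<..<d} u) * (indicator {a..<b} y * 1)"
        using jB[of u] by (intro mult_mono) (auto simp: indicator_def intro: order_trans[OF abs_ge_zero])
      also have "\<dots> = B * indicator ({c<..<d} \<times> {a..<b}) (u, y)" by (simp add: indicator_def)
      finally show "norm (H u y) \<le> norm (B * indicator ({c<..<d} \<times> {a..<b}) (u, y))" by simp
    qed
  qed measurable
  have inner_y: "(LINT y|lborel. H u y) = j u * (quantile C u - a)" for u
  proof (cases "u \<in> {c<..<d}")
    case True
    have u: "0 < u" "u < 1" "lo \<le> u" "u \<le> hi" using True cd by auto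
    have "a \<le> quantile C u" "quantile C u \<le> b"
      unfolding a_def b_def using u cd by (auto intro!: quantile_mono)
    from layer_cake[OF this]
    have "(LINT y|lborel. indicator {a..<b} y * indicator {y. y < quantile C u} y) = quantile C u - a"
      by (rule has_bochner_integral_integral_eq)
    moreover have "H u y = j u * (indicator {a..<b} y * indicator {y. y < quantile C u} y)" for y
      unfolding H_def using less_quantile_iff[OF u(1,2), of y] by (simp add: indicator_def)
    ultimately show ?thesis by simp
  next
    case False
    then have "j u = 0" by (simp add: j_def)
    then show ?thesis by (simp add: H_def)
  qed
  have inner_u: "(LINT u|lborel. H u y) = indicator {a..<b} y * (K d - K (clamp_to c d (C y)))" for y
  proof -
    have "(LINT u|lborel. indicator {clamp_to c d (C y)<..<d} u * J u) = K d - K (clamp_to c d (C y))"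
      by (rule has_bochner_integral_integral_eq, rule integral_Ioo_primitive[OF K J])
         (use cd in \<open>auto simp: le_max_iff_disj\<close>)
    moreover have "H u y = indicator {a..<b} y * (indicator {clamp_to c d (C y)<..<d} u * J u)" for u
      unfolding H_def j_def using cd by (auto simp: indicator_def max_def min_def)
    ultimately show ?thesis by simp
  qed
  have "integrable lborel (\<lambda>u. LINT y|lborel. H u y)"
    using lborel_pair.integrable_fst'[OF HI] by simp
  then have i1: "integrable lborel (\<lambda>u. j u * (quantile C u - a))" unfolding inner_y .
  have i2: "integrable lborel (\<lambda>y. LINT u|lborel. H u y)"
    using lborel_pair.integrable_snd[OF HI] by simp
  have "(LINT y|lborel. LINT u|lborel. H u y) = (LINT u|lborel. LINT y|lborel. H u y)"
    by (rule lborel_pair.Fubini_integral[OF HI])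
  also have "\<dots> = (LINT u|lborel. (j u * (quantile C u - a) + a * j u) - a * j u)"
    unfolding inner_y by simp
  also have "\<dots> = (LINT u|lborel. j u * (quantile C u - a) + a * j u) - (LINT u|lborel. a * j u)"
    using i1 hj by (intro Bochner_Integration.integral_diff Bochner_Integration.integrable_add integrable_mult_right) (auto simp: has_bochner_integral_iff)
  also have "(LINT u|lborel. a * j u) = a * (K d - K c)" using hj by (simp add: has_bochner_integral_iff)
  also have "(LINT u|lborel. j u * (quantile C u - a) + a * j u) = (LBINT u=c..d. J u * quantile C u)"
    using cd by (auto simp: interval_lebesgue_integral_def set_lebesgue_integral_def j_def algebra_simps intro!: Bochner_Integration.integral_cong)
  finally show ?thesis using i2 unfolding inner_u by (simp add: has_bochner_integral_iff)
qed

text \<open>On the difference of the two integral representations the pointwise bound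
  \<open>trimmed_increment_bound\<close> is integrated. The bands of levels around \<open>al\<close>
  and \<open>bl\<close> become sets whose lengths are quantile increments. The localization of the
  order statistics makes the representation valid; it is also a conclusion because the change of
  weights needs it.\<close>

lemma trimmed_L_remainder:
  fixes K J :: "real \<Rightarrow> real"
  assumes K: "\<And>u. u \<in> {lo..hi} \<Longrightarrow> (K has_real_derivative J u) (at u within {lo..hi})"
    and J: "Cl-lipschitz_on {lo..hi} J" and B: "\<And>u. u \<in> {lo..hi} \<Longrightarrow> \<bar>J u\<bar> \<le> B"
    and lohi: "0 < lo" "hi < 1"
    and r: "r \<ge> 0" "lo \<le> al - 2 * r" "al + 2 * r \<le> bl - 2 * r" "bl + 2 * r \<le> hi"
    and n: "n \<ge> 1" "N \<le> n" and ab: "\<bar>k / n - al\<bar> \<le> r" "\<bar>N / n - bl\<bar> \<le> r"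
    and Fn: "\<And>y. \<bar>emp_cdf x n y - C y\<bar> \<le> r"
  defines "a \<equiv> quantile C lo" and "b \<equiv> quantile C hi"
  shows "\<And>i. i \<in> {k+1..N} \<Longrightarrow> a \<le> order_stat x n i \<and> order_stat x n i \<le> b"
    and "\<bar>(\<Sum>i\<in>{k+1..N}. (K (i / n) - K ((real i - 1) / n)) * order_stat x n i)
        - (LBINT u=real k / n..real N / n. J u * quantile C u)
        + (LINT y|lborel. indicator {al..<bl} (C y) * J (C y) * (emp_cdf x n y - C y))\<bar>
      \<le> Cl * r\<^sup>2 * (b - a) + 2 * B * r * (quantile C (al + 2 * r) - quantile C (al - 2 * r)
          + (quantile C (bl + 2 * r) - quantile C (bl - 2 * r)))"
proof -
  have Jc: "continuous_on {lo..hi} J" using J by (rule lipschitz_on_continuous_on)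
  have Cl0: "Cl \<ge> 0" using J by (rule lipschitz_on_nonneg)
  have "lo \<in> {lo..hi}" using r by auto
  then have B0: "B \<ge> 0" using B[of lo] by (meson abs_ge_zero order_trans)
  have an: "lo \<le> k / n" "k / n \<le> N / n" "N / n \<le> hi" using r ab by linarith+
  have kN: "k \<le> N" using an(2) n by (simp add: field_simps)
  show os: "a \<le> order_stat x n i \<and> order_stat x n i \<le> b" if i: "i \<in> {k+1..N}" for i
  proof
    have i1: "1 \<le> i" "i \<le> n" using i n by auto
    have i2: "k / n \<le> i / n" "i / n \<le> N / n" using i by (auto intro!: divide_right_mono)
    have "emp_cdf x n (order_stat x n i) \<ge> i / n" using less_order_stat_iff[OF i1, of "order_stat x n i" x] by linarith
    then have "C (order_stat x n i) \<ge> lo" using Fn[of "order_stat x n i"] i2 ab r by linarith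
    then show "a \<le> order_stat x n i" unfolding a_def using quantile_le_iff[of lo] lohi r by auto
    \<comment> \<open>At \<open>b\<close> the empirical distribution function is at least
      \<open>hi - r\<close>, and \<open>hi - r \<ge> bl + r \<ge> N / n\<close>, so it has already
      reached every level \<open>i / n\<close> in the sum.\<close>
    have "hi \<le> C b" unfolding b_def using quantile_le_iff[of hi] lohi r by auto
    then have "\<not> emp_cdf x n b < i / n" using Fn[of b] i2 ab r by linarith
    then show "order_stat x n i \<le> b" using less_order_stat_iff[OF i1, of b x] by simp
  qed
  let ?cl = "clamp_to (k / n) (N / n)" and ?Fn = "emp_cdf x n"
  let ?g = "\<lambda>p. indicator {al..<bl} p * J p"
  have gm[measurable]: "?g \<in> borel_measurable borel"
  proof (rule borel_measurable_indicator_mult_continuous[OF Jc])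
    show "{al..<bl} \<subseteq> {lo..hi}"
    proof
      fix z assume "z \<in> {al..<bl}"
      then have "lo \<le> z" "z \<le> hi" using r unfolding atLeastLessThan_iff by linarith+
      then show "z \<in> {lo..hi}" by simp
    qed
  qed simp
  have q: "0 < lo" "lo \<le> k / n" "k / n \<le> N / n" "N / n \<le> hi" "hi < 1" using lohi an by auto
  have h1: "has_bochner_integral lborel (\<lambda>y. indicator {a..<b} y * (K (N / n) - K (?cl (?Fn y))))
     ((\<Sum>i\<in>{k+1..N}. (K (i / n) - K ((real i - 1) / n)) * order_stat x n i) - a * (K (N / n) - K (k / n)))"
    by (rule sum_increments_order_stat[OF n(1) kN n(2) os])
  have h2: "has_bochner_integral lborel (\<lambda>y. indicator {a..<b} y * (K (N / n) - K (?cl (C y))))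
     ((LBINT u=real k / n..real N / n. J u * quantile C u) - a * (K (N / n) - K (k / n)))"
    unfolding a_def b_def by (rule integral_J_quantile[OF K Jc B q])
  \<comment> \<open>The linear term lives on levels inside \<open>{al..<bl}\<close>, hence on points
    inside the common window, and can be integrated over that window without change.\<close>
  have ind: "?g (C y) = indicator {a..<b} y * ?g (C y)" for y
  proof (cases "C y \<in> {al..<bl}")
    case True
    then have "lo \<le> C y" "C y < hi" using r unfolding atLeastLessThan_iff by linarith+
    then have "y \<in> {a..<b}" unfolding a_def b_def using quantile_le_iff[of lo y] less_quantile_iff[of hi y] lohi r by auto
    then show ?thesis by simp
  qed simp
  have h3: "has_bochner_integral lborel (\<lambda>y. indicator {a..<b} y * (?g (C y) * (?Fn y - C y)))
      (LINT y|lborel. ?g (C y) * (?Fn y - C y))"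
  proof -
    have "\<bar>?g (C y) * (?Fn y - C y)\<bar> \<le> B * r" for y
      unfolding abs_mult using B[of "C y"] B0 Fn[of y] r by (intro mult_mono) (auto simp: indicator_def)
    then have "integrable lborel (\<lambda>y. indicator {a..<b} y * (?g (C y) * (?Fn y - C y)))"
      by (intro integrable_on_Ico) auto
    moreover have "(\<lambda>y. indicator {a..<b} y * (?g (C y) * (?Fn y - C y))) = (\<lambda>y. ?g (C y) * (?Fn y - C y))"
      by (subst (2) ind) (simp add: mult_ac)
    ultimately show ?thesis by (simp add: has_bochner_integral_iff)
  qed
  let ?D = "\<lambda>y. K (?cl (?Fn y)) - K (?cl (C y)) - ?g (C y) * (?Fn y - C y)"
  have "has_bochner_integral lborel (\<lambda>y. indicator {a..<b} y * (K (N / n) - K (?cl (?Fn y)))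
      - indicator {a..<b} y * (K (N / n) - K (?cl (C y))) + indicator {a..<b} y * (?g (C y) * (?Fn y - C y)))
     ((\<Sum>i\<in>{k+1..N}. (K (i / n) - K ((real i - 1) / n)) * order_stat x n i) - a * (K (N / n) - K (k / n))
      - ((LBINT u=real k / n..real N / n. J u * quantile C u) - a * (K (N / n) - K (k / n)))
      + (LINT y|lborel. ?g (C y) * (?Fn y - C y)))" (is "has_bochner_integral _ ?f ?I")
    by (intro has_bochner_integral_add has_bochner_integral_diff h1 h2 h3)
  then have f: "integrable lborel ?f" "(LINT y|lborel. ?f y) = ?I" by (auto simp: has_bochner_integral_iff)
  have fD: "?f y = - (indicator {a..<b} y * ?D y)" for y by (simp add: algebra_simps)
  let ?i1 = "\<lambda>y. indicator {quantile C (al - 2 * r)..<quantile C (al + 2 * r)} y :: real"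
  let ?i2 = "\<lambda>y. indicator {quantile C (bl - 2 * r)..<quantile C (bl + 2 * r)} y :: real"
  have I: "0 < al - 2 * r" "al - 2 * r < 1" "0 < al + 2 * r" "al + 2 * r < 1"
    "0 < bl - 2 * r" "bl - 2 * r < 1" "0 < bl + 2 * r" "bl + 2 * r < 1"
    using r lohi by linarith+
  have i1: "indicator {al - 2 * r..<al + 2 * r} (C y) = ?i1 y" for y
    using quantile_le_iff[OF I(1,2), of y] less_quantile_iff[OF I(3,4), of y] by (simp add: indicator_def)
  have i2: "indicator {bl - 2 * r..<bl + 2 * r} (C y) = ?i2 y" for y
    using quantile_le_iff[OF I(5,6), of y] less_quantile_iff[OF I(7,8), of y] by (simp add: indicator_def)
  have q1: "quantile C (al - 2 * r) \<le> quantile C (al + 2 * r)" "quantile C (bl - 2 * r) \<le> quantile C (bl + 2 * r)" "a \<le> b"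
    unfolding a_def b_def using I lohi r by (auto intro!: quantile_mono)
  have "\<bar>?I\<bar> = \<bar>LINT y|lborel. ?f y\<bar>" unfolding f(2) ..
  also have "\<dots> \<le> (LINT y|lborel. \<bar>?f y\<bar>)" by (rule integral_abs_bound)
  also have "\<dots> \<le> (LINT y|lborel. Cl * r\<^sup>2 * indicator {a..<b} y + 2 * B * r * (?i1 y + ?i2 y))"
  proof (rule integral_mono)
    show "integrable lborel (\<lambda>y. \<bar>?f y\<bar>)" using f(1) by (rule integrable_abs)
    show "integrable lborel (\<lambda>y. Cl * r\<^sup>2 * indicator {a..<b} y + 2 * B * r * (?i1 y + ?i2 y))"
      using q1 by (intro Bochner_Integration.integrable_add integrable_mult_right) auto
    fix y
    have "\<bar>?f y\<bar> = indicator {a..<b} y * \<bar>?D y\<bar>" unfolding fD by (simp add: abs_mult)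
    also have "\<dots> \<le> indicator {a..<b} y * (Cl * r\<^sup>2 + 2 * B * r * (?i1 y + ?i2 y))"
      using trimmed_increment_bound[OF K J B r ab Fn[of y]] unfolding i1 i2
      by (intro mult_left_mono) auto
    also have "\<dots> \<le> Cl * r\<^sup>2 * indicator {a..<b} y + 2 * B * r * (?i1 y + ?i2 y)"
    proof -
      have "0 \<le> 2 * B * r * (?i1 y + ?i2 y)" using B0 r by (intro mult_nonneg_nonneg) auto
      then show ?thesis by (cases "y \<in> {a..<b}") simp_all
    qed
    finally show "\<bar>?f y\<bar> \<le> Cl * r\<^sup>2 * indicator {a..<b} y + 2 * B * r * (?i1 y + ?i2 y)" .
  qed
  also have "\<dots> = Cl * r\<^sup>2 * (b - a) + 2 * B * r * (quantile C (al + 2 * r) - quantile C (al - 2 * r)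
          + (quantile C (bl + 2 * r) - quantile C (bl - 2 * r)))"
    using q1 by (subst Bochner_Integration.integral_add) auto
  finally show "\<bar>(\<Sum>i\<in>{k+1..N}. (K (i / n) - K ((real i - 1) / n)) * order_stat x n i)
        - (LBINT u=real k / n..real N / n. J u * quantile C u)
        + (LINT y|lborel. indicator {al..<bl} (C y) * J (C y) * (?Fn y - C y))\<bar>
      \<le> Cl * r\<^sup>2 * (b - a) + 2 * B * r * (quantile C (al + 2 * r) - quantile C (al - 2 * r)
          + (quantile C (bl + 2 * r) - quantile C (bl - 2 * r)))" by simp
qed

end

section \<open>The influence function and its variance\<close>

context cdf_distribution
begin

text \<open>The bounded support of \<open>g\<close> makes the product integrable even though
  Lebesgue measure is infinite; mean and variance of the influence function both rest on this
  exchange.\<close>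

lemma fubini_weighted:
  fixes g :: "real \<Rightarrow> real" and \<phi> :: "real \<Rightarrow> real \<Rightarrow> real"
  assumes [measurable]: "g \<in> borel_measurable borel" and g: "\<And>y. \<bar>g y\<bar> \<le> B * indicator {a..<b} y"
    and \<phi>[measurable]: "case_prod \<phi> \<in> borel_measurable (borel \<Otimes>\<^sub>M borel)" and \<phi>B: "\<And>x y. \<bar>\<phi> x y\<bar> \<le> B'"
  shows "(LINT x|M. LINT y|lborel. g y * \<phi> x y) = (LINT y|lborel. g y * (LINT x|M. \<phi> x y))"
proof -
  interpret P: pair_sigma_finite M lborel ..
  have I: "integrable (M \<Otimes>\<^sub>M lborel) (\<lambda>(x, y). g y * \<phi> x y)"
  proof (rule Bochner_Integration.integrable_bound)
    have "emeasure (M \<Otimes>\<^sub>M lborel) (UNIV \<times> {a..<b}) = emeasure M UNIV * emeasure lborel {a..<b}"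
      by (rule lborel.emeasure_pair_measure_Times) auto
    also have "\<dots> < \<infinity>" by (cases "a \<le> b") (auto simp: ennreal_mult_less_top emeasure_eq_measure)
    finally show "integrable (M \<Otimes>\<^sub>M lborel) (\<lambda>p. (B * B') * indicator (UNIV \<times> {a..<b}) p)"
      by (intro integrable_mult_right) simp
    show "AE p in M \<Otimes>\<^sub>M lborel. norm (case p of (x, y) \<Rightarrow> g y * \<phi> x y) \<le> norm ((B * B') * indicator (UNIV \<times> {a..<b}) p)"
    proof (rule always_eventually, clarify)
      fix x y
      have "\<bar>g y * \<phi> x y\<bar> \<le> (B * indicator {a..<b} y) * B'"
        unfolding abs_mult using g[of y] \<phi>B[of x y] by (intro mult_mono) (auto intro: order_trans[OF abs_ge_zero])
      also have "\<dots> = (B * B') * indicator (UNIV \<times> {a..<b}) (x, y)" by (simp add: indicator_def)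
      finally show "norm (g y * \<phi> x y) \<le> norm ((B * B') * indicator (UNIV \<times> {a..<b}) (x, y))" by simp
    qed
  qed measurable
  have "(LINT x|M. LINT y|lborel. g y * \<phi> x y) = (LINT y|lborel. LINT x|M. g y * \<phi> x y)"
    by (rule P.Fubini_integral[symmetric, OF I])
  then show ?thesis by simp
qed

text \<open>For \<open>g\<close> equal to the truncated weight \<open>J\<close> composed with the
  distribution function, this is the influence function of the trimmed L-functional, its first-order
  von Mises term.\<close>

definition influence :: "(real \<Rightarrow> real) \<Rightarrow> real \<Rightarrow> real" where
  "influence g x = - (LINT y|lborel. g y * (indicator {x..} y - C y))"

lemma indicator_minus_cdf_bound: "\<bar>indicator {x..} y - C y\<bar> \<le> 1"
  using cdf_nonneg[of y] cdf_bounded_prob[of y] by (auto simp: indicator_def)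

lemma measurable_indicator_minus_cdf[measurable]:
  "(\<lambda>(x, y). indicator {x..} y - C y :: real) \<in> borel_measurable (borel \<Otimes>\<^sub>M borel)"
proof -
  have "(\<lambda>(x, y). indicator {x..} y - C y :: real) = (\<lambda>p. indicator {p. fst p \<le> snd p} p - C (snd p))"
    by (auto simp: fun_eq_iff indicator_def)
  also have "\<dots> \<in> borel_measurable (borel \<Otimes>\<^sub>M borel)" by measurable
  finally show ?thesis .
qed

context
  fixes g :: "real \<Rightarrow> real" and a b B :: real
  assumes gm[measurable]: "g \<in> borel_measurable borel" and gB: "\<And>y. \<bar>g y\<bar> \<le> B * indicator {a..<b} y"
    and ab: "a \<le> b"
begin

lemma weighted_integrable:
  assumes [measurable]: "w \<in> borel_measurable borel" and w: "\<And>y. \<bar>w y\<bar> \<le> 1"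
  shows "integrable lborel (\<lambda>y. g y * w y)" "\<bar>LINT y|lborel. g y * w y\<bar> \<le> B * (b - a)"
proof -
  have i: "integrable lborel (\<lambda>y. B * indicator {a..<b} y)" using ab by (intro integrable_mult_right) simp
  have bd: "\<bar>g y * w y\<bar> \<le> B * indicator {a..<b} y" for y
    unfolding abs_mult using mult_mono[OF gB[of y] w[of y]] order_trans[OF abs_ge_zero gB[of y]] by simp
  show I: "integrable lborel (\<lambda>y. g y * w y)"
  proof (rule Bochner_Integration.integrable_bound[OF i])
    show "AE y in lborel. norm (g y * w y) \<le> norm (B * indicator {a..<b} y)"
      unfolding real_norm_def by (intro always_eventually allI order_trans[OF bd abs_ge_self])
  qed simp
  have "\<bar>LINT y|lborel. g y * w y\<bar> \<le> (LINT y|lborel. \<bar>g y * w y\<bar>)" by (rule integral_abs_bound)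
  also have "\<dots> \<le> (LINT y|lborel. B * indicator {a..<b} y)"
    by (intro integral_mono i bd integrable_abs I)
  also have "\<dots> = B * (b - a)" using ab by simp
  finally show "\<bar>LINT y|lborel. g y * w y\<bar> \<le> B * (b - a)" .
qed

lemma influence_bound: "\<bar>influence g x\<bar> \<le> B * (b - a)"
  unfolding influence_def abs_minus_cancel
  by (rule weighted_integrable) (simp_all add: indicator_minus_cdf_bound)

lemma measurable_influence[measurable]: "influence g \<in> borel_measurable borel"
  unfolding influence_def by measurable

lemma expectation_influence: "(LINT x|M. influence g x) = 0"
proof -
  have "(LINT x|M. LINT y|lborel. g y * (indicator {x..} y - C y)) = (LINT y|lborel. g y * (LINT x|M. indicator {x..} y - C y))"
    by (rule fubini_weighted[OF gm gB measurable_indicator_minus_cdf indicator_minus_cdf_bound])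
  moreover have "(LINT x|M. indicator {x..} y - C y) = 0" for y
  proof -
    have "(LINT x|M. indicator {x..} y - C y) = (LINT x|M. indicator {..y} x - C y)"
      by (intro Bochner_Integration.integral_cong) (auto simp: indicator_def)
    then show ?thesis using prob_space by (simp add: cdf_def emeasure_eq_measure)
  qed
  ultimately show ?thesis unfolding influence_def by simp
qed

lemma covariance_indicators:
  "(LINT x|M. (indicator {x..} y - C y) * (indicator {x..} z - C z)) = C (min y z) - C y * C z"
proof -
  have "(LINT x|M. (indicator {x..} y - C y) * (indicator {x..} z - C z))
     = (LINT x|M. indicator {..min y z} x - C z * indicator {..y} x - C y * indicator {..z} x + C y * C z)"
    by (intro Bochner_Integration.integral_cong) (auto simp: indicator_def algebra_simps)
  also have "\<dots> = C (min y z) - C z * C y - C y * C z + C y * C z"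
    using prob_space by (simp add: cdf_def emeasure_eq_measure)
  finally show ?thesis by simp
qed

text \<open>One factor of the square is expanded while the other is kept as a bounded function of
  \<open>x\<close>. Two single applications of \<open>fubini_weighted\<close> then suffice, and the
  remaining expectation is the covariance of two indicators.\<close>

lemma variance_influence:
  "(LINT x|M. (influence g x)\<^sup>2) = (LINT z|lborel. g z * (LINT y|lborel. g y * (C (min y z) - C y * C z)))"
proof -
  let ?w = "\<lambda>x y. indicator {x..} y - C y"
  have "(LINT x|M. (influence g x)\<^sup>2) = - (LINT x|M. LINT z|lborel. g z * (?w x z * influence g x))"
  proof -
    have "(influence g x)\<^sup>2 = - (LINT z|lborel. g z * (?w x z * influence g x))" for x
      by (simp add: mult.assoc[symmetric]) (simp add: influence_def power2_eq_square)
    then show ?thesis by simp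
  qed
  also have "(LINT x|M. LINT z|lborel. g z * (?w x z * influence g x)) = (LINT z|lborel. g z * (LINT x|M. ?w x z * influence g x))"
  proof (rule fubini_weighted[OF gm gB])
    show "(\<lambda>(x, z). ?w x z * influence g x) \<in> borel_measurable (borel \<Otimes>\<^sub>M borel)"
      using measurable_indicator_minus_cdf measurable_influence by measurable
    show "\<bar>?w x z * influence g x\<bar> \<le> 1 * (B * (b - a))" for x z
      unfolding abs_mult by (intro mult_mono indicator_minus_cdf_bound influence_bound) auto
  qed
  also have "\<dots> = (LINT z|lborel. - (g z * (LINT y|lborel. g y * (C (min y z) - C y * C z))))"
  proof (intro Bochner_Integration.integral_cong refl)
    fix z
    have "(LINT x|M. ?w x z * influence g x) = - (LINT x|M. LINT y|lborel. g y * (?w x y * ?w x z))"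
      unfolding influence_def by (simp add: mult.assoc[symmetric]) (simp add: mult_ac)
    also have "(LINT x|M. LINT y|lborel. g y * (?w x y * ?w x z)) = (LINT y|lborel. g y * (LINT x|M. ?w x y * ?w x z))"
    proof (rule fubini_weighted[OF gm gB])
      have "(\<lambda>x. ?w x z) = (\<lambda>x. indicator {..z} x - C z)" by (auto simp: indicator_def fun_eq_iff)
      then have [measurable]: "(\<lambda>x. ?w x z) \<in> borel_measurable borel" by simp
      show "(\<lambda>(x, y). ?w x y * ?w x z) \<in> borel_measurable (borel \<Otimes>\<^sub>M borel)"
        using measurable_indicator_minus_cdf by measurable
      show "\<bar>?w x y * ?w x z\<bar> \<le> 1 * 1" for x y
        unfolding abs_mult by (intro mult_mono indicator_minus_cdf_bound) auto
    qed
    finally show "g z * (LINT x|M. ?w x z * influence g x) = - (g z * (LINT y|lborel. g y * (C (min y z) - C y * C z)))"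
      unfolding covariance_indicators by simp
  qed
  finally show ?thesis by simp
qed

end

text \<open>Both integrators are images of Lebesgue measure under \<open>C\<close>, so
  \<open>u = C y\<close> and \<open>v = C z\<close> can be substituted, and monotonicity gives
  \<open>min (C y) (C z) = C (min y z)\<close>.\<close>

lemma lstieltjes_variance:
  fixes J :: "real \<Rightarrow> real"
  assumes ab: "0 < al" "al \<le> bl" "bl < 1"
    and jm: "(\<lambda>u. indicator {al..<bl} u * J u) \<in> borel_measurable borel"
  defines "g \<equiv> \<lambda>y. indicator {al..<bl} (C y) * J (C y)"
  shows "(LINT v|lstieltjes (quantile C) al bl. indicator {al..<bl} v *
           (LINT u|lstieltjes (quantile C) al bl. indicator {al..<bl} u * (J u * J v * (min u v - u * v))))
     = (LINT z|lborel. g z * (LINT y|lborel. g y * (C (min y z) - C y * C z)))"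
proof -
  define S where "S = density lborel (indicator {quantile C al..<quantile C bl} :: real \<Rightarrow> ennreal)"
  define j where "j u = indicator {al..<bl} u * J u" for u
  have [measurable]: "j \<in> borel_measurable borel" using jm unfolding j_def[abs_def] .
  have L: "lstieltjes (quantile C) al bl = distr S borel C"
    unfolding S_def by (rule lstieltjes_quantile) (use ab in auto)
  have Ss: "sets S = sets borel" by (simp add: S_def)
  have Cm: "C \<in> S \<rightarrow>\<^sub>M borel" unfolding measurable_cong_sets[OF Ss refl] by simp
  have "finite_measure S"
    by (intro finite_measureI) (cases "quantile C al \<le> quantile C bl"; simp add: S_def emeasure_density)
  then interpret S: finite_measure S .
  have "finite_measure (distr S borel C)" using Cm by (rule S.finite_measure_distr)
  then interpret D: finite_measure "distr S borel C" .
  have I: "(LINT u|distr S borel C. j u * w u) = (LINT y|lborel. g y * w (C y))"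
    if [measurable]: "w \<in> borel_measurable borel" for w
  proof -
    have "(LINT u|distr S borel C. j u * w u) = (LINT y|S. j (C y) * w (C y))"
      by (rule integral_distr[OF Cm]) measurable
    also have "\<dots> = (LINT y|lborel. indicator {quantile C al..<quantile C bl} y * (j (C y) * w (C y)))"
    proof -
      have "S = density lborel (\<lambda>y. ennreal (indicator {quantile C al..<quantile C bl} y))"
        unfolding S_def ennreal_indicator ..
      then show ?thesis by (simp add: integral_density)
    qed
    also have "\<dots> = (LINT y|lborel. g y * w (C y))"
    proof (intro Bochner_Integration.integral_cong refl)
      fix y
      show "indicator {quantile C al..<quantile C bl} y * (j (C y) * w (C y)) = g y * w (C y)"
        using quantile_le_iff[of al y] less_quantile_iff[of bl y] ab by (simp add: g_def j_def indicator_def)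
    qed
    finally show ?thesis .
  qed
  have "(LINT v|distr S borel C. indicator {al..<bl} v * (LINT u|distr S borel C. indicator {al..<bl} u * (J u * J v * (min u v - u * v))))
     = (LINT v|distr S borel C. j v * (LINT u|distr S borel C. j u * (min u v - u * v)))"
  proof (intro Bochner_Integration.integral_cong refl)
    fix v
    have "(LINT u|distr S borel C. indicator {al..<bl} u * (J u * J v * (min u v - u * v)))
       = (LINT u|distr S borel C. J v * (j u * (min u v - u * v)))"
      by (simp add: j_def mult_ac)
    also have "\<dots> = J v * (LINT u|distr S borel C. j u * (min u v - u * v))"
      by (rule integral_mult_right_zero)
    finally show "indicator {al..<bl} v * (LINT u|distr S borel C. indicator {al..<bl} u * (J u * J v * (min u v - u * v)))
        = j v * (LINT u|distr S borel C. j u * (min u v - u * v))" by (simp add: j_def)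
  qed
  also have "\<dots> = (LINT z|lborel. g z * (LINT u|distr S borel C. j u * (min u (C z) - u * C z)))"
    by (rule I) measurable
  also have "\<dots> = (LINT z|lborel. g z * (LINT y|lborel. g y * (min (C y) (C z) - C y * C z)))"
    by (subst I) simp_all
  also have "\<dots> = (LINT z|lborel. g z * (LINT y|lborel. g y * (C (min y z) - C y * C z)))"
    by (simp add: min_of_mono[OF mono])
  finally show ?thesis unfolding L .
qed

end

section \<open>Uniform deviation of the empirical distribution function\<close>

context cdf_distribution
begin

text \<open>The left limit of \<open>C\<close> at the quantile is at most \<open>u\<close>. With the
  closed half-line this would fail at an atom, which is why the grid estimate also controls open
  half-lines.\<close>

lemma measure_lessThan_quantile_le:
  assumes u: "0 < u" "u < 1"
  shows "measure M {..<quantile C u} \<le> u"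
proof (rule tendsto_upperbound[OF cdf_at_left])
  have "\<forall>\<^sub>F x in at_left (quantile C u). x < quantile C u" unfolding eventually_at_filter by simp
  then show "\<forall>\<^sub>F x in at_left (quantile C u). C x \<le> u"
    by eventually_elim (use less_quantile_iff[OF u] in \<open>auto intro: less_imp_le\<close>)
qed simp

text \<open>Both functions are nondecreasing, so between neighbouring quantiles of levels
  \<open>j / n\<close> control at the grid suffices up to one step \<open>1 / n\<close>.\<close>

lemma emp_cdf_uniform_bound_from_grid:
  assumes n: "n \<ge> 1" and \<rho>: "\<rho> \<ge> 0"
    and le: "\<And>j::nat. j \<in> {1..<n} \<Longrightarrow> \<bar>(\<Sum>i<n. indicator {..quantile C (j / n)} (x i)) / n - measure M {..quantile C (j / n)}\<bar> \<le> \<rho>"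
    and less: "\<And>j::nat. j \<in> {1..<n} \<Longrightarrow> \<bar>(\<Sum>i<n. indicator {..<quantile C (j / n)} (x i)) / n - measure M {..<quantile C (j / n)}\<bar> \<le> \<rho>"
  shows "\<bar>emp_cdf x n y - C y\<bar> \<le> \<rho> + 1 / n"
proof -
  have n0: "real n > 0" using n by simp
  have e: "emp_cdf x n z = (\<Sum>i<n. indicator {..z} (x i)) / n" for z
    unfolding emp_cdf_def by (simp add: indicator_def)
  have mono: "emp_cdf x n z \<le> emp_cdf x n z'" if "z \<le> z'" for z z'
    unfolding e using that by (intro divide_right_mono sum_mono) (auto simp: indicator_def)
  have e01: "0 \<le> emp_cdf x n z" "emp_cdf x n z \<le> 1" for z
  proof -
    show "0 \<le> emp_cdf x n z" unfolding e by (intro divide_nonneg_nonneg sum_nonneg) auto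
    have "(\<Sum>i<n. indicator {..z} (x i)) \<le> (\<Sum>i<n. 1 :: real)" by (intro sum_mono) (auto simp: indicator_def)
    then show "emp_cdf x n z \<le> 1" unfolding e using n0 by simp
  qed
  have C01: "0 \<le> C y" "C y \<le> 1" using cdf_nonneg cdf_bounded_prob by auto
  define j where "j = nat \<lfloor>real n * C y\<rfloor>"
  have "0 \<le> real n * C y" using C01 n0 by simp
  then have "real j = of_int \<lfloor>real n * C y\<rfloor>" unfolding j_def by simp
  then have "real j \<le> real n * C y" "real n * C y < real j + 1" by linarith+
  then have j: "real j / n \<le> C y" "C y < real (Suc j) / n" using n0 by (simp_all add: field_simps)
  have s: "real (Suc j) / n = real j / n + 1 / n" by (simp add: add_divide_distrib)
  have lower: "C y - (\<rho> + 1 / n) \<le> emp_cdf x n y"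
  proof -
    \<comment> \<open>The grid stops at level \<open>(n - 1) / n\<close>; the minimum covers
      \<open>C y = 1\<close>, where \<open>j = n\<close>.\<close>
    define i where "i = min j (n - 1)"
    have i: "i < n" "i \<le> j" using n by (auto simp: i_def)
    have Ci: "C y \<le> real i / n + 1 / n"
    proof (cases "j \<le> n - 1")
      case True
      then show ?thesis using j s by (simp add: i_def)
    next
      case False
      then have "real i + 1 = real n" using n by (simp add: i_def of_nat_diff)
      then have "real i / n + 1 / n = 1" using n0 by (simp flip: add_divide_distrib)
      then show ?thesis using C01 by simp
    qed
    show ?thesis
    proof (cases "i = 0")
      case True
      then show ?thesis using Ci e01(1)[of y] \<rho> by simp
    next
      case False
      then have iu: "0 < real i / n" "real i / n < 1" "i \<in> {1..<n}" using i n0 by auto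
      have "real i / n \<le> real j / n" using i by (intro divide_right_mono) auto
      then have q: "quantile C (i / n) \<le> y" using quantile_le_iff[OF iu(1,2)] j by simp
      have "real i / n \<le> C (quantile C (i / n))" using quantile_le_iff[OF iu(1,2)] by blast
      also have "\<dots> \<le> emp_cdf x n (quantile C (i / n)) + \<rho>"
        using le[OF iu(3)] unfolding e cdf_def by linarith
      also have "\<dots> \<le> emp_cdf x n y + \<rho>" using mono[OF q] by simp
      finally show ?thesis using Ci by linarith
    qed
  qed
  have upper: "emp_cdf x n y \<le> C y + (\<rho> + 1 / n)"
  proof (cases "Suc j < n")
    case True
    then have iu: "0 < real (Suc j) / n" "real (Suc j) / n < 1" "Suc j \<in> {1..<n}" using n0 by auto
    \<comment> \<open>Here \<open>y\<close> lies strictly below the next grid point, so the open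
      half-line contains every observation up to \<open>y\<close> without picking up a possible atom
      there.\<close>
    have q: "y < quantile C (Suc j / n)" using less_quantile_iff[OF iu(1,2)] j by simp
    have "emp_cdf x n y \<le> (\<Sum>i<n. indicator {..<quantile C (Suc j / n)} (x i)) / n"
      unfolding e using q by (intro divide_right_mono sum_mono) (auto simp: indicator_def)
    also have "\<dots> \<le> measure M {..<quantile C (Suc j / n)} + \<rho>" using less[OF iu(3)] by linarith
    also have "\<dots> \<le> real (Suc j) / n + \<rho>" using measure_lessThan_quantile_le[OF iu(1,2)] by simp
    finally show ?thesis using j s by linarith
  next
    case False
    then have "1 \<le> real (Suc j) / n" using n0 by (simp add: field_simps)
    then show ?thesis using e01(2)[of y] j s \<rho> by linarith
  qed
  show ?thesis using lower upper by linarith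
qed

end

lemma (in prob_space) hoeffding_empirical:
  fixes X :: "nat \<Rightarrow> 'a \<Rightarrow> real"
  assumes indep: "indep_vars (\<lambda>_. borel) X UNIV"
    and ident: "\<And>i. distr M borel (X i) = distr M borel (X 0)"
    and A[measurable]: "A \<in> sets borel" and n: "n \<ge> 1" and \<rho>: "\<rho> \<ge> 0"
  shows "prob {\<omega> \<in> space M. \<bar>(\<Sum>i<n. indicator A (X i \<omega>)) / n - measure (distr M borel (X 0)) A\<bar> \<ge> \<rho>}
    \<le> 2 * exp (- 2 * real n * \<rho>\<^sup>2)"
proof -
  have Xm[measurable]: "X i \<in> borel_measurable M" for i using indep by (auto simp: indep_vars_def)
  let ?Y = "\<lambda>i \<omega>. indicator A (X i \<omega>) :: real"
  have law: "distr M borel (?Y i) = distr M borel (?Y 0)" for i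
  proof -
    have "distr M borel (?Y i) = distr (distr M borel (X i)) borel (indicator A)" for i
      by (subst distr_distr) (auto simp: comp_def)
    then show ?thesis by (simp only: ident[of i])
  qed
  interpret H: Hoeffding_ineq_iid M "{..<n}" ?Y "?Y 0" 0 1 "expectation (?Y 0)"
  proof unfold_locales
    show "indep_vars (\<lambda>_. borel) ?Y {..<n}"
      by (rule indep_vars_compose2[OF indep_vars_subset[OF indep], of "{..<n}" "\<lambda>_. indicator A"]) auto
    show "distr M borel (?Y i) = distr M borel (?Y 0)" for i by (rule law)
  qed (simp_all add: indicator_def)
  have "expectation (?Y 0) = (LINT x|distr M borel (X 0). indicator A x)"
    by (rule integral_distr[symmetric]) measurable
  also have "\<dots> = measure (distr M borel (X 0)) A" by simp
  finally have e: "expectation (?Y 0) = measure (distr M borel (X 0)) A" .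
  show ?thesis
    using H.Hoeffding_ineq_abs_ge'[OF \<rho>] n unfolding e by (simp add: lessThan_empty_iff)
qed

text \<open>A union bound over the \<open>n - 1\<close> grid levels with two half-lines each,
  Hoeffding giving \<open>2 * exp (- 2 * n * \<rho>^2)\<close> for each. The polynomial factor is
  harmless because \<open>\<rho>\<close> will be a large multiple of sqrt(log n / n).\<close>

lemma (in prob_space) emp_cdf_deviation:
  fixes X :: "nat \<Rightarrow> 'a \<Rightarrow> real"
  assumes indep: "indep_vars (\<lambda>_. borel) X UNIV"
    and ident: "\<And>i. distr M borel (X i) = distr M borel (X 0)"
    and n: "n \<ge> 1" and \<rho>: "\<rho> \<ge> 0"
  obtains G where "G \<in> events" "prob G \<ge> 1 - 4 * real n * exp (- 2 * real n * \<rho>\<^sup>2)"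
    "\<And>\<omega> y. \<omega> \<in> G \<Longrightarrow> \<bar>emp_cdf (\<lambda>i. X i \<omega>) n y - cdf (distr M borel (X 0)) y\<bar> \<le> \<rho> + 1 / n"
proof -
  have Xm[measurable]: "X i \<in> borel_measurable M" for i using indep by (auto simp: indep_vars_def)
  define \<nu> where "\<nu> = distr M borel (X 0)"
  interpret nu: cdf_distribution \<nu>
    unfolding cdf_distribution_def \<nu>_def by (rule real_distribution_distr) simp
  define bad where "bad A = {\<omega> \<in> space M. \<bar>(\<Sum>i<n. indicator A (X i \<omega>)) / n - measure \<nu> A\<bar> \<ge> \<rho>}" for A
  have badm[measurable]: "bad A \<in> events" if [measurable]: "A \<in> sets borel" for A
    unfolding bad_def by measurable
  have badp: "prob (bad A) \<le> 2 * exp (- 2 * real n * \<rho>\<^sup>2)" if "A \<in> sets borel" for A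
    unfolding bad_def \<nu>_def by (rule hoeffding_empirical[OF indep ident that n \<rho>])
  define q where "q j = quantile (cdf \<nu>) (real j / n)" for j :: nat
  define U where "U = (\<Union>j\<in>{1..<n}. bad {..q j} \<union> bad {..<q j})"
  have Um: "U \<in> events" unfolding U_def by (intro sets.finite_UN) auto
  have "prob U \<le> (\<Sum>j\<in>{1..<n}. prob (bad {..q j} \<union> bad {..<q j}))"
    unfolding U_def by (intro finite_measure_subadditive_finite) auto
  also have "\<dots> \<le> (\<Sum>j\<in>{1..<n}. 4 * exp (- 2 * real n * \<rho>\<^sup>2))"
  proof (intro sum_mono)
    fix j
    have "prob (bad {..q j} \<union> bad {..<q j}) \<le> prob (bad {..q j}) + prob (bad {..<q j})"
      by (intro measure_Un_le) auto
    also have "\<dots> \<le> 4 * exp (- 2 * real n * \<rho>\<^sup>2)" using badp[of "{..q j}"] badp[of "{..<q j}"] by simp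
    finally show "prob (bad {..q j} \<union> bad {..<q j}) \<le> 4 * exp (- 2 * real n * \<rho>\<^sup>2)" .
  qed
  also have "\<dots> = real (n - 1) * (4 * exp (- 2 * real n * \<rho>\<^sup>2))" by simp
  also have "\<dots> \<le> real n * (4 * exp (- 2 * real n * \<rho>\<^sup>2))" by (intro mult_right_mono) auto
  finally have pU: "prob U \<le> 4 * real n * exp (- 2 * real n * \<rho>\<^sup>2)" by simp
  show thesis
  proof (rule that)
    show "space M - U \<in> events" using Um by simp
    show "prob (space M - U) \<ge> 1 - 4 * real n * exp (- 2 * real n * \<rho>\<^sup>2)" using pU prob_compl[OF Um] by simp
    fix \<omega> y assume w: "\<omega> \<in> space M - U"
    then have "\<bar>(\<Sum>i<n. indicator {..q j} (X i \<omega>)) / n - measure \<nu> {..q j}\<bar> \<le> \<rho>"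
      "\<bar>(\<Sum>i<n. indicator {..<q j} (X i \<omega>)) / n - measure \<nu> {..<q j}\<bar> \<le> \<rho>" if "j \<in> {1..<n}" for j
      using that unfolding U_def bad_def by (auto dest!: bspec[of _ _ j] intro: less_imp_le simp: not_le)
    then show "\<bar>emp_cdf (\<lambda>i. X i \<omega>) n y - cdf (distr M borel (X 0)) y\<bar> \<le> \<rho> + 1 / n"
      unfolding \<nu>_def[symmetric] q_def by (intro nu.emp_cdf_uniform_bound_from_grid n \<rho>)
  qed
qed

text \<open>Replacing the weights costs at most their total difference times
  \<open>max \<bar>a\<bar> \<bar>b\<bar> / n\<close>, because all order statistics involved lie
  between \<open>a\<close> and \<open>b\<close>. With the reference weights the remainder bound
  applies.\<close>

lemma (in cdf_distribution) trimmed_L_linearization: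
  fixes K J :: "real \<Rightarrow> real" and k m n :: nat
  assumes K: "\<And>u. u \<in> {lo..hi} \<Longrightarrow> (K has_real_derivative J u) (at u within {lo..hi})"
    and J: "Cl-lipschitz_on {lo..hi} J" and B: "\<And>u. u \<in> {lo..hi} \<Longrightarrow> \<bar>J u\<bar> \<le> B"
    and lohi: "0 < lo" "hi < 1"
    and r: "r \<ge> 0" "lo \<le> al - 2 * r" "al + 2 * r \<le> bl - 2 * r" "bl + 2 * r \<le> hi"
    and n: "n \<ge> 1" "m \<le> n" and ab: "\<bar>k / n - al\<bar> \<le> r" "\<bar>(1 - m / n) - bl\<bar> \<le> r"
    and Fn: "\<And>y. \<bar>emp_cdf x n y - C y\<bar> \<le> r"
  defines "a \<equiv> quantile C lo" and "b \<equiv> quantile C hi"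
    and "g \<equiv> \<lambda>y. indicator {al..<bl} (C y) * J (C y)"
  shows "\<bar>1 / n * (\<Sum>i\<in>{k+1..n-m}. c i * order_stat x n i)
      - (LBINT u=real k / n..1 - real m / n. J u * quantile C u) - 1 / n * (\<Sum>j<n. influence g (x j))\<bar>
    \<le> Cl * r\<^sup>2 * (b - a) + 2 * B * r * (quantile C (al + 2 * r) - quantile C (al - 2 * r)
        + (quantile C (bl + 2 * r) - quantile C (bl - 2 * r)))
      + max \<bar>a\<bar> \<bar>b\<bar> * (\<Sum>i\<in>{k+1..n-m}. \<bar>c i - n * (LBINT u=(real i - 1) / n..real i / n. J u)\<bar>) / n"
proof -
  define N where "N = n - m"
  have n0: "real n > 0" using n by simp
  have Nn: "N \<le> n" "real N / n = 1 - real m / n"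
    using n n0 by (simp_all add: N_def of_nat_diff field_simps)
  have Jc: "continuous_on {lo..hi} J" using J by (rule lipschitz_on_continuous_on)
  have "lo \<in> {lo..hi}" using r by auto
  then have B0: "B \<ge> 0" using B[of lo] by (meson abs_ge_zero order_trans)
  have ab': "\<bar>k / n - al\<bar> \<le> r" "\<bar>N / n - bl\<bar> \<le> r" using ab Nn by auto
  have an: "lo \<le> k / n" "N / n \<le> hi" using r ab' by linarith+
  have osr: "a \<le> order_stat x n i \<and> order_stat x n i \<le> b" if "i \<in> {k+1..N}" for i
    unfolding a_def b_def by (rule trimmed_L_remainder(1)[OF K J B lohi r n(1) Nn(1) ab' Fn that])
  have rem: "\<bar>(\<Sum>i\<in>{k+1..N}. (K (i / n) - K ((real i - 1) / n)) * order_stat x n i)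
        - (LBINT u=real k / n..real N / n. J u * quantile C u)
        + (LINT y|lborel. indicator {al..<bl} (C y) * J (C y) * (emp_cdf x n y - C y))\<bar>
      \<le> Cl * r\<^sup>2 * (b - a) + 2 * B * r * (quantile C (al + 2 * r) - quantile C (al - 2 * r)
          + (quantile C (bl + 2 * r) - quantile C (bl - 2 * r)))"
    unfolding a_def b_def by (rule trimmed_L_remainder(2)[OF K J B lohi r n(1) Nn(1) ab' Fn])
  \<comment> \<open>A reference weight is \<open>n\<close> times an increment of the primitive, so
    the factor \<open>1 / n\<close> of the statistic leaves exactly the increments used
    before.\<close>
  have K': "n * (LBINT u=(real i - 1) / n..real i / n. J u) = n * (K (i / n) - K ((real i - 1) / n))"
    if i: "i \<in> {k+1..N}" for i
  proof -
    have "k / n \<le> (real i - 1) / n" "real i / n \<le> N / n" "(real i - 1) / n \<le> i / n"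
      using i by (auto intro!: divide_right_mono)
    then show ?thesis by (subst integral_Ioo_primitive(1)[OF K Jc]) (use an in auto)
  qed
  have osb: "\<bar>order_stat x n i\<bar> \<le> max \<bar>a\<bar> \<bar>b\<bar>" if "i \<in> {k+1..N}" for i using osr[OF that] by linarith
  define L0 where "L0 = (\<Sum>i\<in>{k+1..N}. (K (i / n) - K ((real i - 1) / n)) * order_stat x n i)"
  define S where "S = (\<Sum>i\<in>{k+1..N}. \<bar>c i - n * (LBINT u=(real i - 1) / n..real i / n. J u)\<bar>)"
  have e: "1 / n * (\<Sum>i\<in>{k+1..N}. c i * order_stat x n i) - L0
      = 1 / n * (\<Sum>i\<in>{k+1..N}. (c i - n * (LBINT u=(real i - 1) / n..real i / n. J u)) * order_stat x n i)"
  proof -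
    have "L0 = 1 / n * (\<Sum>i\<in>{k+1..N}. n * (LBINT u=(real i - 1) / n..real i / n. J u) * order_stat x n i)"
      unfolding L0_def sum_distrib_left using n0 by (intro sum.cong refl) (simp only: K', simp)
    then show ?thesis by (simp only: left_diff_distrib sum_subtractf right_diff_distrib)
  qed
  have "\<bar>\<Sum>i\<in>{k+1..N}. (c i - n * (LBINT u=(real i - 1) / n..real i / n. J u)) * order_stat x n i\<bar>
      \<le> (\<Sum>i\<in>{k+1..N}. \<bar>c i - n * (LBINT u=(real i - 1) / n..real i / n. J u)\<bar> * max \<bar>a\<bar> \<bar>b\<bar>)"
    by (rule order_trans[OF sum_abs sum_mono]) (simp only: abs_mult mult_left_mono[OF osb abs_ge_zero])
  also have "\<dots> = max \<bar>a\<bar> \<bar>b\<bar> * S" unfolding S_def sum_distrib_right[symmetric] by (rule mult.commute)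
  finally have 1: "\<bar>1 / n * (\<Sum>i\<in>{k+1..N}. c i * order_stat x n i) - L0\<bar> \<le> max \<bar>a\<bar> \<bar>b\<bar> * S / n"
    unfolding e abs_mult using n0 by (simp add: divide_right_mono)
  have qab: "quantile C al \<le> quantile C bl" using r lohi by (intro quantile_mono) linarith+
  have gm: "g \<in> borel_measurable borel"
  proof -
    have [measurable]: "(\<lambda>p. indicator {al..<bl} p * J p) \<in> borel_measurable borel"
    proof (rule borel_measurable_indicator_mult_continuous[OF Jc])
      show "{al..<bl} \<subseteq> {lo..hi}"
      proof
        fix z assume "z \<in> {al..<bl}"
        then have "lo \<le> z" "z \<le> hi" using r unfolding atLeastLessThan_iff by linarith+
        then show "z \<in> {lo..hi}" by simp
      qed
    qed simp
    show ?thesis unfolding g_def by measurable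
  qed
  have gB: "\<bar>g y\<bar> \<le> B * indicator {quantile C al..<quantile C bl} y" for y
  proof (cases "C y \<in> {al..<bl}")
    case True
    then have "lo \<le> C y" "C y \<le> hi" using r unfolding atLeastLessThan_iff by linarith+
    then have "\<bar>J (C y)\<bar> \<le> B" by (intro B) simp
    moreover have "0 < al" "al < 1" "0 < bl" "bl < 1" using r lohi by linarith+
    then have "y \<in> {quantile C al..<quantile C bl}"
      using True quantile_le_iff[of al y] less_quantile_iff[of bl y] by simp
    ultimately show ?thesis using True by (simp add: g_def)
  qed (use B0 in \<open>simp add: g_def\<close>)
  have wi: "integrable lborel (\<lambda>y. g y * (indicator {x j..} y - C y))" for j
    by (rule weighted_integrable[OF gm gB qab]) (simp_all add: indicator_minus_cdf_bound)
  \<comment> \<open>The integral is linear in the empirical distribution function, so the linear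
    term is an average of influence values; the sign is the one built into
    \<open>influence\<close>.\<close>
  have "(LINT y|lborel. g y * (emp_cdf x n y - C y)) = (LINT y|lborel. 1 / n * (\<Sum>j<n. g y * (indicator {x j..} y - C y)))"
    using n0 by (intro Bochner_Integration.integral_cong refl)
      (simp add: emp_cdf_def field_simps sum_distrib_left sum_subtractf)
  also have "\<dots> = 1 / n * (\<Sum>j<n. LINT y|lborel. g y * (indicator {x j..} y - C y))"
    using wi by simp
  also have "\<dots> = - (1 / n * (\<Sum>j<n. influence g (x j)))"
    by (simp add: influence_def sum_negf)
  finally have 2: "(LINT y|lborel. indicator {al..<bl} (C y) * J (C y) * (emp_cdf x n y - C y)) = - (1 / n * (\<Sum>j<n. influence g (x j)))"
    by (simp add: g_def)
  show ?thesis
    using rem 1 unfolding 2 L0_def[symmetric] S_def[symmetric] N_def[symmetric] Nn(2) by linarith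
qed

text \<open>The boundary zones extend to both sides of a trimming level, whereas the hypothesis
  speaks of increments from the level itself; it is used for \<open>t\<close> and for
  \<open>- t\<close>.\<close>

lemma symmetric_increment_bigo:
  fixes Q :: "real \<Rightarrow> real" and s w :: "nat \<Rightarrow> real"
  assumes "(\<lambda>n::nat. Q (u + t * s n) - Q u) \<in> O(w)" "(\<lambda>n. Q (u + (- t) * s n) - Q u) \<in> O(w)"
  shows "(\<lambda>n::nat. Q (u + t * s n) - Q (u - t * s n)) \<in> O(w)"
proof -
  have "(\<lambda>n. (Q (u + t * s n) - Q u) - (Q (u + (- t) * s n) - Q u)) \<in> O(w)"
    using assms by (rule sum_in_bigo)
  then show ?thesis by simp
qed

section \<open>The moderate deviation theorem\<close>

theorem theorem1p1:
  fixes M :: "'a measure"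
    and X :: "nat \<Rightarrow> 'a \<Rightarrow> real"
    and F :: "real \<Rightarrow> real"
    and k m :: "nat \<Rightarrow> nat"
    and alpha beta :: real
    and c :: "nat \<Rightarrow> nat \<Rightarrow> real"
    and J :: "real \<Rightarrow> real"
    and I :: "real set"
    and sigma :: real
    and L :: "nat \<Rightarrow> 'a \<Rightarrow> real"
    and mu :: "nat \<Rightarrow> real"
    and FL :: "nat \<Rightarrow> real \<Rightarrow> real"
  assumes P: "prob_space M"
    and indep: "prob_space.indep_vars M (\<lambda>_. borel) X UNIV"
    and ident: "\<And>i. distr M borel (X i) = distr M borel (X 0)"
    and F_def: "F = cdf (distr M borel (X 0))"
    and km: "\<And>n. n \<ge> 1 \<Longrightarrow> k n + m n < n"
    and alpha_lim: "(\<lambda>n. real (k n) / real n) \<longlonglongrightarrow> alpha"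
    and beta_lim: "(\<lambda>n. real (m n) / real n) \<longlonglongrightarrow> beta"
    and ab: "0 < alpha" "alpha < 1 - beta" "1 - beta < 1"
    and L_def: "L = (\<lambda>n \<omega>. (1 / real n) *
                  (\<Sum>i\<in>{k n + 1..n - m n}. c i n * order_stat (\<lambda>j. X j \<omega>) n i))"
    and I_open: "open I" and I_sub: "{alpha..1 - beta} \<subseteq> I" "I \<subseteq> {0<..<1}"
    and cond_i: "\<exists>C. C-lipschitz_on I J"
    and cond_ii: "\<exists>eps>0. \<forall>t::real.
        (\<lambda>n::nat. quantile F (alpha + t * sqrt (ln (real n) / real n)) - quantile F alpha)
          \<in> O(\<lambda>n. ln (real n) powr (-(1 + eps))) \<and>
        (\<lambda>n::nat. quantile F (1 - beta + t * sqrt (ln (real n) / real n)) - quantile F (1 - beta))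
          \<in> O(\<lambda>n. ln (real n) powr (-(1 + eps)))"
    and cond_iii: "(\<lambda>n::nat. max \<bar>real (k n) / real n - alpha\<bar> \<bar>real (m n) / real n - beta\<bar>)
          \<in> O(\<lambda>n. sqrt (ln (real n) / real n))"
    and cond_iv: "\<exists>eps'>0.
        (\<lambda>n::nat. \<Sum>i\<in>{k n + 1..n - m n}.
            \<bar>c i n - real n * (LBINT u=(real i - 1) / real n..real i / real n. J u)\<bar>)
          \<in> O(\<lambda>n. 1 / ln (real n) powr eps' * sqrt (real n / ln (real n)))"
    and mu_def: "mu = (\<lambda>n. LBINT u=real (k n) / real n..1 - real (m n) / real n.
                          J u * quantile F u)"
    and sigma_pos: "sigma > 0"
    and sigma_sq: "sigma\<^sup>2 =
        (LINT v|lstieltjes (quantile F) alpha (1 - beta).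
           indicator {alpha..<1 - beta} v *
           (LINT u|lstieltjes (quantile F) alpha (1 - beta).
              indicator {alpha..<1 - beta} u * (J u * J v * (min u v - u * v))))"
    and FL_def: "FL = (\<lambda>n x. measure M {\<omega> \<in> space M.
                         sqrt (real n) * (L n \<omega> - mu n) / sigma \<le> x})"
  shows "\<forall>cc>0. \<forall>A>0. \<forall>e>0. eventually (\<lambda>n. \<forall>x. -A \<le> x \<and> x \<le> cc * sqrt (ln (real n)) \<longrightarrow>
            \<bar>(1 - FL n x) / (1 - Phi x) - 1\<bar> \<le> e \<and>
            \<bar>FL n (-x) / Phi (-x) - 1\<bar> \<le> e) sequentially"
proof -
  interpret prob_space M by (rule P)
  have Xm[measurable]: "X i \<in> borel_measurable M" for i using indep by (auto simp: indep_vars_def)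
  define \<nu> where "\<nu> = distr M borel (X 0)"
  interpret nu: cdf_distribution \<nu>
    unfolding cdf_distribution_def \<nu>_def by (rule real_distribution_distr) simp
  have F: "F = cdf \<nu>" unfolding F_def \<nu>_def ..
  define bl where "bl = 1 - beta"
  obtain C0 where C0: "C0-lipschitz_on I J" using cond_i by blast
  \<comment> \<open>Openness of \<open>I\<close> gives room on both sides of the trimming levels.
    With half the radii the closed interval from \<open>lo\<close> to \<open>hi\<close> stays inside
    \<open>I\<close>, so \<open>J\<close> is bounded there and the levels occurring for large
    \<open>n\<close> remain inside.\<close>
  obtain e1 where e1: "e1 > 0" "ball alpha e1 \<subseteq> I"
    using I_open I_sub(1) ab by (meson atLeastAtMost_iff less_imp_le openE order_refl subsetD)
  obtain e2 where e2: "e2 > 0" "ball bl e2 \<subseteq> I"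
    using I_open I_sub(1) ab unfolding bl_def by (meson atLeastAtMost_iff less_imp_le openE order_refl subsetD)
  define lo hi where "lo = alpha - e1 / 2" and "hi = bl + e2 / 2"
  have lohiI: "{lo..hi} \<subseteq> I"
  proof
    fix u assume u: "u \<in> {lo..hi}"
    consider "u < alpha" | "alpha \<le> u" "u \<le> bl" | "bl < u" by linarith
    then show "u \<in> I"
    proof cases
      case 1
      then have "u \<in> ball alpha e1" using u e1 by (simp add: lo_def dist_real_def)
      then show ?thesis using e1 by blast
    next
      case 2
      then show ?thesis using I_sub(1) by (auto simp: bl_def)
    next
      case 3
      then have "u \<in> ball bl e2" using u e2 by (simp add: hi_def dist_real_def)
      then show ?thesis using e2 by blast
    qed
  qed
  have lt: "lo < alpha" "alpha < bl" "bl < hi" using e1 e2 ab by (auto simp: lo_def hi_def bl_def)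
  then have "lo \<in> {lo..hi}" "hi \<in> {lo..hi}" by auto
  then have lohi: "0 < lo" "hi < 1" using lohiI I_sub(2) by (meson greaterThanLessThan_iff subsetD)+
  have J: "C0-lipschitz_on {lo..hi} J" using C0 lohiI by (rule lipschitz_on_subset)
  have Jc: "continuous_on {lo..hi} J" using J by (rule lipschitz_on_continuous_on)
  have "compact (J ` {lo..hi})" by (intro compact_continuous_image Jc compact_Icc)
  then have "bounded (J ` {lo..hi})" by (rule compact_imp_bounded)
  then obtain B where "\<forall>y\<in>J ` {lo..hi}. norm y \<le> B" unfolding bounded_iff by blast
  then have B: "\<bar>J u\<bar> \<le> B" if "u \<in> {lo..hi}" for u using that by auto
  have B0: "B \<ge> 0" using B[OF \<open>lo \<in> {lo..hi}\<close>] by linarith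
  \<comment> \<open>The base point is immaterial, since only increments of \<open>K\<close>
    occur.\<close>
  define K where "K u = integral {lo..u} J" for u
  have K: "(K has_real_derivative J u) (at u within {lo..hi})" if "u \<in> {lo..hi}" for u
    unfolding K_def by (rule integral_has_real_derivative[OF Jc that])

  \<comment> \<open>Standardized influence variables\<close>
  let ?Q = "quantile (cdf \<nu>)"
  define g where "g y = indicator {alpha..<bl} (cdf \<nu> y) * J (cdf \<nu> y)" for y
  have jm[measurable]: "(\<lambda>u. indicator {alpha..<bl} u * J u) \<in> borel_measurable borel"
    by (rule borel_measurable_indicator_mult_continuous[OF Jc]) (use lt in auto)
  have gm[measurable]: "g \<in> borel_measurable borel" unfolding g_def by measurable
  have I01: "0 < alpha" "alpha < 1" "0 < bl" "bl < 1" using ab by (auto simp: bl_def)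
  have qab: "?Q alpha \<le> ?Q bl" using ab by (intro nu.quantile_mono) (auto simp: bl_def)
  have gB: "\<bar>g y\<bar> \<le> B * indicator {?Q alpha..<?Q bl} y" for y
  proof (cases "cdf \<nu> y \<in> {alpha..<bl}")
    case True
    then have "\<bar>J (cdf \<nu> y)\<bar> \<le> B" using lt by (intro B) auto
    moreover have "y \<in> {?Q alpha..<?Q bl}"
      using True nu.quantile_le_iff[OF I01(1,2), of y] nu.less_quantile_iff[OF I01(3,4), of y] by simp
    ultimately show ?thesis using True by (simp add: g_def)
  qed (use B0 in \<open>simp add: g_def\<close>)
  define h where "h = nu.influence g"
  have hm[measurable]: "h \<in> borel_measurable borel"
    unfolding h_def by (rule nu.measurable_influence[OF gm gB qab])
  have hB: "\<bar>h x\<bar> \<le> B * (?Q bl - ?Q alpha)" for x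
    unfolding h_def by (rule nu.influence_bound[OF gm gB qab])
  have h1: "expectation (\<lambda>\<omega>. h (X 0 \<omega>)) = 0"
  proof -
    have "expectation (\<lambda>\<omega>. h (X 0 \<omega>)) = (LINT x|\<nu>. h x)"
      unfolding \<nu>_def by (subst integral_distr) auto
    also have "\<dots> = 0" unfolding h_def by (rule nu.expectation_influence[OF gm gB qab])
    finally show ?thesis .
  qed
  \<comment> \<open>This identifies the Stieltjes double integral in the hypothesis with the
    variance of the linear term.\<close>
  have h2: "expectation (\<lambda>\<omega>. (h (X 0 \<omega>))\<^sup>2) = sigma\<^sup>2"
  proof -
    have "expectation (\<lambda>\<omega>. (h (X 0 \<omega>))\<^sup>2) = (LINT x|\<nu>. (h x)\<^sup>2)"
      unfolding \<nu>_def by (subst integral_distr) auto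
    also have "\<dots> = (LINT z|lborel. g z * (LINT y|lborel. g y * (cdf \<nu> (min y z) - cdf \<nu> y * cdf \<nu> z)))"
      unfolding h_def by (rule nu.variance_influence[OF gm gB qab])
    also have "\<dots> = sigma\<^sup>2"
      unfolding sigma_sq F g_def
      using nu.lstieltjes_variance[OF I01(1) less_imp_le[OF lt(2)] I01(4) jm] by (simp add: bl_def)
    finally show ?thesis .
  qed
  define Y where "Y i \<omega> = h (X i \<omega>) / sigma" for i \<omega>
  have Yi: "indep_vars (\<lambda>_. borel) Y UNIV"
    unfolding Y_def by (rule indep_vars_compose2[OF indep, of "\<lambda>_ x. h x / sigma"]) simp
  have Yl: "distr M borel (Y i) = distr M borel (Y 0)" for i
  proof -
    have "distr M borel (Y i) = distr (distr M borel (X i)) borel (\<lambda>x. h x / sigma)" for i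
      unfolding Y_def by (subst distr_distr) (auto simp: comp_def)
    then show ?thesis by (simp only: ident[of i])
  qed
  have Yb: "\<bar>Y i \<omega>\<bar> \<le> B * (?Q bl - ?Q alpha) / sigma" for i \<omega>
    unfolding Y_def using hB sigma_pos by (simp add: abs_divide divide_right_mono)
  have Ym: "expectation (Y 0) = 0" "expectation (\<lambda>\<omega>. (Y 0 \<omega>)\<^sup>2) = 1"
    unfolding Y_def using h1 h2 sigma_pos by (simp_all add: power_divide)

  \<comment> \<open>The normalized statistic as a perturbed sum\<close>
  define V where "V n \<omega> = sqrt (real n) * (L n \<omega> - mu n) / sigma" for n \<omega>
  have Vm[measurable]: "V n \<in> borel_measurable M" for n
    unfolding V_def L_def
    by (intro borel_measurable_divide borel_measurable_times borel_measurable_diff borel_measurable_sum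
        borel_measurable_const borel_measurable_order_stat Xm) auto
  have approx: "\<exists>\<eta>. (\<lambda>n. \<eta> n * sqrt (ln (real n))) \<longlonglongrightarrow> 0 \<and>
      (\<forall>\<^sub>F n in sequentially. \<eta> n \<ge> 0 \<and> (\<exists>G\<in>events. prob G \<ge> 1 - real n powr - p \<and>
         (\<forall>\<omega>\<in>G. \<bar>V n \<omega> - (\<Sum>i<n. Y i \<omega>) / sqrt n\<bar> \<le> \<eta> n)))" if p: "p > 0" for p
  proof -
    define s where "s n = sqrt (ln (real n) / real n)" for n :: nat
    \<comment> \<open>Chosen so that Hoeffding's exponent \<open>2 * n * (t * s n)^2\<close> equals
      \<open>(p + 2) * ln n\<close>. The surplus 2 absorbs the factor \<open>4 * n\<close> of the
      union bound once \<open>n \<ge> 4\<close>.\<close>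
    define t where "t = sqrt ((p + 2) / 2)"
    have t: "t > 0" "2 * t\<^sup>2 = p + 2" using p by (simp_all add: t_def)
    obtain A1 where A1: "A1 > 0" "\<forall>\<^sub>F n in sequentially. norm (max \<bar>real (k n) / real n - alpha\<bar> \<bar>real (m n) / real n - beta\<bar>) \<le> A1 * norm (s n)"
      using landau_o.bigE[OF cond_iii] unfolding s_def by blast
    \<comment> \<open>One radius \<open>r = T * s n\<close> serves everywhere: \<open>t\<close> for
      the empirical deviation, 1 for the grid step \<open>1 / n\<close>, and \<open>A1\<close> for
      the distance of the trimming proportions from their limits.\<close>
    define T where "T = t + 1 + A1"
    have T0: "T > 0" using t A1 by (simp add: T_def)
    obtain eps where eps: "eps > 0" and ii: "\<And>t. (\<lambda>n::nat. ?Q (alpha + t * s n) - ?Q alpha) \<in> O(\<lambda>n. ln (real n) powr (-(1 + eps)))"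
        "\<And>t. (\<lambda>n::nat. ?Q (bl + t * s n) - ?Q bl) \<in> O(\<lambda>n. ln (real n) powr (-(1 + eps)))"
      using cond_ii unfolding F s_def bl_def by blast
    define E where "E n = ?Q (alpha + 2 * T * s n) - ?Q (alpha - 2 * T * s n) + (?Q (bl + 2 * T * s n) - ?Q (bl - 2 * T * s n))" for n
    have "E \<in> O(\<lambda>n. ln (real n) powr (-(1 + eps)))"
      unfolding E_def by (intro sum_in_bigo symmetric_increment_bigo ii)
    then obtain A2 where A2: "A2 > 0" "\<forall>\<^sub>F n in sequentially. norm (E n) \<le> A2 * norm (ln (real n) powr (-(1 + eps)))"
      by (rule landau_o.bigE)
    define Z where "Z n = (\<Sum>i\<in>{k n + 1..n - m n}. \<bar>c i n - real n * (LBINT u=(real i - 1) / real n..real i / real n. J u)\<bar>)" for n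
    obtain eps' where eps': "eps' > 0" and iv: "Z \<in> O(\<lambda>n. 1 / ln (real n) powr eps' * sqrt (real n / ln (real n)))"
      using cond_iv unfolding Z_def by blast
    obtain A3 where A3: "A3 > 0" "\<forall>\<^sub>F n in sequentially. norm (Z n) \<le> A3 * norm (1 / ln (real n) powr eps' * sqrt (real n / ln (real n)))"
      using landau_o.bigE[OF iv] .
    define a b where "a = ?Q lo" and "b = ?Q hi"
    define Bx where "Bx = max \<bar>a\<bar> \<bar>b\<bar>"
    \<comment> \<open>After scaling by \<open>sqrt n / sigma\<close> these are the constants of the
      quadratic remainder, the boundary zones and the change of weights.\<close>
    define D1 D2 D3 where "D1 = C0 * T\<^sup>2 * (b - a) / sigma" and "D2 = 2 * B * T * A2 / sigma" and "D3 = Bx * A3 / sigma"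
    define \<eta> where "\<eta> n = D1 * (sqrt (real n) * (s n)\<^sup>2) + D2 * (sqrt (real n) * s n * ln (real n) powr (-(1 + eps)))
       + D3 * (sqrt (real n) / real n * (1 / ln (real n) powr eps' * sqrt (real n / ln (real n))))" for n
    have ab': "a \<le> b" unfolding a_def b_def using lt lohi by (intro nu.quantile_mono) auto
    have D: "D1 \<ge> 0" "D2 \<ge> 0" "D3 \<ge> 0"
      unfolding D1_def D2_def D3_def Bx_def using ab' B0 T0 A2 A3 sigma_pos lipschitz_on_nonneg[OF J] by auto
    have \<eta>0: "(\<lambda>n. \<eta> n * sqrt (ln (real n))) \<longlonglongrightarrow> 0"
    proof -
      \<comment> \<open>The three terms have orders \<open>(ln n)^(3/2) / sqrt n\<close>,
        \<open>(ln n) powr - eps\<close> and \<open>(ln n) powr - eps'\<close>; positivity of the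
        two exponents is exactly what makes the last two vanish.\<close>
      have "(\<lambda>n. D1 * (sqrt (real n) * (sqrt (ln (real n) / real n))\<^sup>2 * sqrt (ln (real n)))
        + D2 * (sqrt (real n) * sqrt (ln (real n) / real n) * ln (real n) powr (-(1 + eps)) * sqrt (ln (real n)))
        + D3 * (sqrt (real n) / real n * (1 / ln (real n) powr eps' * sqrt (real n / ln (real n))) * sqrt (ln (real n)))) \<longlonglongrightarrow> D1 * 0 + D2 * 0 + D3 * 0"
      proof (intro tendsto_intros)
        show "(\<lambda>n::nat. sqrt (real n) * (sqrt (ln (real n) / real n))\<^sup>2 * sqrt (ln (real n))) \<longlonglongrightarrow> 0" by real_asymp
        show "(\<lambda>n::nat. sqrt (real n) * sqrt (ln (real n) / real n) * ln (real n) powr (-(1 + eps)) * sqrt (ln (real n))) \<longlonglongrightarrow> 0"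
          using eps by real_asymp
        show "(\<lambda>n::nat. sqrt (real n) / real n * (1 / ln (real n) powr eps' * sqrt (real n / ln (real n))) * sqrt (ln (real n))) \<longlonglongrightarrow> 0"
          using eps' by real_asymp
      qed
      then show ?thesis by (simp add: \<eta>_def s_def distrib_right mult.assoc)
    qed
    have s0: "s \<longlonglongrightarrow> 0" unfolding s_def by real_asymp
    have r0: "(\<lambda>n. 2 * (T * s n)) \<longlonglongrightarrow> 0"
      using tendsto_mult_right_zero[OF tendsto_mult_right_zero[OF s0, of T], of 2] .
    \<comment> \<open>The outer gaps keep the zones of half-width \<open>2 * r\<close> inside
      \<open>{lo..hi}\<close>; half the inner gap keeps the two zones apart.\<close>
    have gap: "0 < alpha - lo" "0 < (bl - alpha) / 2" "0 < hi - bl" using lt by auto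
    have ev: "\<forall>\<^sub>F n in sequentially. \<eta> n \<ge> 0 \<and> (\<exists>G\<in>events. prob G \<ge> 1 - real n powr - p \<and>
         (\<forall>\<omega>\<in>G. \<bar>V n \<omega> - (\<Sum>i<n. Y i \<omega>) / sqrt n\<bar> \<le> \<eta> n))"
      using A1(2) A2(2) A3(2) order_tendstoD(2)[OF r0 gap(1)] order_tendstoD(2)[OF r0 gap(2)]
        order_tendstoD(2)[OF r0 gap(3)] eventually_ge_at_top[of 4]
    proof eventually_elim
      case (elim n)
      have n: "real n \<ge> 4" "n \<ge> 1" using elim(7) by auto
      have "exp 1 \<le> real n" using n exp_le by linarith
      then have ln1: "ln (real n) \<ge> 1" using n by (subst ln_ge_iff) auto
      have s: "s n > 0" using n ln1 by (simp add: s_def)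
      define r where "r = T * s n"
      have r: "r \<ge> 0" "lo \<le> alpha - 2 * r" "alpha + 2 * r \<le> bl - 2 * r" "bl + 2 * r \<le> hi"
        using s T0 elim(4-6) by (simp_all add: r_def)
      have mx: "max \<bar>real (k n) / real n - alpha\<bar> \<bar>real (m n) / real n - beta\<bar> \<le> A1 * s n"
        using elim(1) s by simp
      also have "A1 * s n \<le> r" using s t by (simp add: r_def T_def algebra_simps)
      finally have abr: "\<bar>real (k n) / real n - alpha\<bar> \<le> r" "\<bar>(1 - real (m n) / real n) - bl\<bar> \<le> r"
        by (auto simp: bl_def)
      have mn: "m n \<le> n" using km[of n] n by simp
      have \<rho>: "t * s n \<ge> 0" using t s by simp
      obtain G where G: "G \<in> events" "prob G \<ge> 1 - 4 * real n * exp (- 2 * real n * (t * s n)\<^sup>2)"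
        "\<And>\<omega> y. \<omega> \<in> G \<Longrightarrow> \<bar>emp_cdf (\<lambda>i. X i \<omega>) n y - cdf \<nu> y\<bar> \<le> t * s n + 1 / n"
        using emp_cdf_deviation[OF indep ident n(2) \<rho>] unfolding \<nu>_def by blast
      have "1 / real n \<le> s n"
      proof (rule power2_le_imp_le)
        have "1 / real n * (1 / real n) \<le> 1 / real n * ln (real n)" using n ln1 by (intro mult_left_mono) (auto intro: order_trans[of _ 1])
        then show "(1 / real n)\<^sup>2 \<le> (s n)\<^sup>2" using n ln1 by (simp add: s_def power2_eq_square)
      qed (use s in simp)
      moreover have "r = t * s n + s n + A1 * s n" by (simp add: r_def T_def algebra_simps)
      moreover have "A1 * s n \<ge> 0" using s A1(1) by simp
      ultimately have "t * s n + 1 / real n \<le> r" by linarith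
      then have Fn: "\<bar>emp_cdf (\<lambda>i. X i \<omega>) n y - cdf \<nu> y\<bar> \<le> r" if "\<omega> \<in> G" for \<omega> y using G(3)[OF that, of y] by linarith
      have "4 * real n * exp (- 2 * real n * (t * s n)\<^sup>2) \<le> real n powr - p"
      proof -
        have "- 2 * real n * (t * s n)\<^sup>2 = - (2 * t\<^sup>2) * ln (real n)"
          using n ln1 by (simp add: s_def power_mult_distrib)
        then have "exp (- 2 * real n * (t * s n)\<^sup>2) = real n powr - (p + 2)"
          unfolding t(2) using n by (simp add: powr_def)
        also have "\<dots> = real n powr - p * real n powr - 2" by (simp flip: powr_add)
        also have "real n powr - 2 = 1 / (real n)\<^sup>2" using n by (simp add: powr_minus_divide)
        finally have "4 * real n * exp (- 2 * real n * (t * s n)\<^sup>2) = real n powr - p * (4 / real n)"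
          using n by (simp add: power2_eq_square)
        also have "\<dots> \<le> real n powr - p * 1" using n by (intro mult_left_mono) auto
        finally show ?thesis by simp
      qed
      then have PG: "prob G \<ge> 1 - real n powr - p" using G(2) by linarith
      have E: "E n \<le> A2 * ln (real n) powr (-(1 + eps))" using elim(2) by simp
      have Z: "Z n \<le> A3 * (1 / ln (real n) powr eps' * sqrt (real n / ln (real n)))"
        using elim(3) ln1 n by simp
      have \<eta>n: "\<eta> n \<ge> 0" unfolding \<eta>_def using D s ln1 n by (intro add_nonneg_nonneg mult_nonneg_nonneg) auto
      have "\<bar>V n \<omega> - (\<Sum>i<n. Y i \<omega>) / sqrt n\<bar> \<le> \<eta> n" if w: "\<omega> \<in> G" for \<omega>
      proof -
        define R where "R = L n \<omega> - mu n - 1 / n * (\<Sum>j<n. h (X j \<omega>))"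
        have "\<bar>R\<bar> \<le> C0 * r\<^sup>2 * (b - a) + 2 * B * r * (?Q (alpha + 2 * r) - ?Q (alpha - 2 * r)
          + (?Q (bl + 2 * r) - ?Q (bl - 2 * r))) + Bx * Z n / n"
          using nu.trimmed_L_linearization[OF K J B lohi r n(2) mn abr Fn[OF w], of "\<lambda>i. c i n"]
          unfolding R_def h_def g_def[abs_def] L_def mu_def Z_def Bx_def a_def b_def F by simp
        also have "\<dots> = C0 * r\<^sup>2 * (b - a) + 2 * B * r * E n + Bx * Z n / n"
          unfolding E_def r_def by (simp add: mult.assoc)
        also have "\<dots> \<le> C0 * r\<^sup>2 * (b - a) + 2 * B * r * (A2 * ln (real n) powr (-(1 + eps)))
            + Bx * (A3 * (1 / ln (real n) powr eps' * sqrt (real n / ln (real n)))) / n"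
          using E Z B0 r by (intro add_mono mult_left_mono divide_right_mono order_refl) (auto simp: Bx_def)
        finally have R: "\<bar>R\<bar> \<le> C0 * r\<^sup>2 * (b - a) + 2 * B * r * (A2 * ln (real n) powr (-(1 + eps)))
            + Bx * (A3 * (1 / ln (real n) powr eps' * sqrt (real n / ln (real n)))) / n" .
        have "V n \<omega> - (\<Sum>i<n. Y i \<omega>) / sqrt n = sqrt n / sigma * R"
        proof -
          have "sqrt (real n) * (1 / n) = 1 / sqrt n" using n by (simp add: real_div_sqrt field_simps)
          then have "sqrt n / sigma * (1 / n * (\<Sum>j<n. h (X j \<omega>))) = (\<Sum>j<n. Y j \<omega>) / sqrt n"
            unfolding Y_def sum_divide_distrib[symmetric] using sigma_pos n by (simp add: field_simps)
          then show ?thesis unfolding R_def V_def by (simp add: algebra_simps diff_divide_distrib)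
        qed
        then have "\<bar>V n \<omega> - (\<Sum>i<n. Y i \<omega>) / sqrt n\<bar> = sqrt n / sigma * \<bar>R\<bar>"
          using sigma_pos n by (simp add: abs_mult)
        also have "\<dots> \<le> sqrt n / sigma * (C0 * r\<^sup>2 * (b - a) + 2 * B * r * (A2 * ln (real n) powr (-(1 + eps)))
            + Bx * (A3 * (1 / ln (real n) powr eps' * sqrt (real n / ln (real n)))) / n)"
          using R sigma_pos n by (intro mult_left_mono) auto
        also have "\<dots> = \<eta> n"
          unfolding \<eta>_def D1_def D2_def D3_def r_def power_mult_distrib distrib_left
          by (simp add: mult_ac)
        finally show ?thesis .
      qed
      then show ?case using \<eta>n G(1) PG by blast
    qed
    show ?thesis using \<eta>0 ev by blast
  qed

  \<comment> \<open>Upper and lower tails\<close>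
  have FL: "FL n x = prob {\<omega> \<in> space M. V n \<omega> \<le> x}" for n x unfolding FL_def V_def ..
  have FL1: "1 - FL n x = prob {\<omega> \<in> space M. x < V n \<omega>}" for n x
  proof -
    have "{\<omega> \<in> space M. x < V n \<omega>} = space M - {\<omega> \<in> space M. V n \<omega> \<le> x}" by auto
    then show ?thesis unfolding FL by (simp add: prob_compl)
  qed
  \<comment> \<open>The lower tail of \<open>V\<close> is the closed upper tail of
    \<open>- V\<close>. The same deviation result then applies to the negated summands, and its
    control of closed events is used here.\<close>
  have FL2: "FL n (- x) = prob {\<omega> \<in> space M. x \<le> - V n \<omega>}" for n x
    unfolding FL by (intro arg_cong[where f=prob]) auto
  have approx': "\<exists>\<eta>. (\<lambda>n. \<eta> n * sqrt (ln (real n))) \<longlonglongrightarrow> 0 \<and>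
      (\<forall>\<^sub>F n in sequentially. \<eta> n \<ge> 0 \<and> (\<exists>G\<in>events. prob G \<ge> 1 - real n powr - p \<and>
         (\<forall>\<omega>\<in>G. \<bar>- V n \<omega> - (\<Sum>i<n. - Y i \<omega>) / sqrt n\<bar> \<le> \<eta> n)))" if p: "p > 0" for p
  proof -
    have "\<bar>- V n \<omega> - (\<Sum>i<n. - Y i \<omega>) / sqrt n\<bar> = \<bar>V n \<omega> - (\<Sum>i<n. Y i \<omega>) / sqrt n\<bar>" for n \<omega>
      by (simp add: sum_negf abs_minus_commute)
    then show ?thesis using approx[OF p] by simp
  qed
  have Yi': "indep_vars (\<lambda>_. borel) (\<lambda>i \<omega>. - Y i \<omega>) UNIV"
    by (rule indep_vars_compose2[OF Yi, of "\<lambda>_ x. - x"]) simp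
  have Yl': "distr M borel (\<lambda>\<omega>. - Y i \<omega>) = distr M borel (\<lambda>\<omega>. - Y 0 \<omega>)" for i
  proof -
    have Ymeas: "Y i \<in> borel_measurable M" for i using Yi by (auto simp: indep_vars_def)
    have "distr M borel (\<lambda>\<omega>. - Y i \<omega>) = distr (distr M borel (Y i)) borel uminus" for i
      using Ymeas[of i] by (subst distr_distr) (auto simp: comp_def)
    then show ?thesis by (simp only: Yl[of i])
  qed
  have Ym': "expectation (\<lambda>\<omega>. - Y 0 \<omega>) = 0" "expectation (\<lambda>\<omega>. (- Y 0 \<omega>)\<^sup>2) = 1"
    using Ym by simp_all
  have Yb': "\<bar>- Y i \<omega>\<bar> \<le> B * (?Q bl - ?Q alpha) / sigma" for i \<omega> using Yb by simp
  have Vm': "(\<lambda>\<omega>. - V n \<omega>) \<in> borel_measurable M" for n by measurable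
  show ?thesis
  proof (intro allI impI)
    fix cc A e :: real
    assume cc: "cc > 0" and A: "A > 0" and e: "e > 0"
    have 1: "\<forall>\<^sub>F n in sequentially. \<forall>x \<le> cc * sqrt (ln (real n)).
        \<bar>prob {\<omega> \<in> space M. x < V n \<omega>} / (1 - Phi x) - 1\<bar> \<le> e \<and>
        \<bar>prob {\<omega> \<in> space M. x \<le> V n \<omega>} / (1 - Phi x) - 1\<bar> \<le> e"
      by (rule moderate_deviations_perturbed_sum[OF Yi Yl Yb Ym Vm approx cc e])
    have 2: "\<forall>\<^sub>F n in sequentially. \<forall>x \<le> cc * sqrt (ln (real n)).
        \<bar>prob {\<omega> \<in> space M. x < - V n \<omega>} / (1 - Phi x) - 1\<bar> \<le> e \<and>
        \<bar>prob {\<omega> \<in> space M. x \<le> - V n \<omega>} / (1 - Phi x) - 1\<bar> \<le> e"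
      by (rule moderate_deviations_perturbed_sum[OF Yi' Yl' Yb' Ym' Vm' approx' cc e])
    show "\<forall>\<^sub>F n in sequentially. \<forall>x. -A \<le> x \<and> x \<le> cc * sqrt (ln (real n)) \<longrightarrow>
            \<bar>(1 - FL n x) / (1 - Phi x) - 1\<bar> \<le> e \<and> \<bar>FL n (-x) / Phi (-x) - 1\<bar> \<le> e"
      using 1 2 by eventually_elim (simp add: FL1 FL2 Phi_minus)
  qed
qed

end
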